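(* Let $n,p$ be integers with $p\ge3$ and $p+2\le n<2p$, let $N>0$, and let $0<\gamma\le -n+2p$. Observe $Y\in\mathbb R^{n\times p}$ with independent entries $Y_{ai}\sim\mathrm N(M_{ai},N^{-1})$. Then the generalized Bayes estimator with respect to $\pi_{\mathrm{MSVS2}}(M)=\det(M^\top M)^{-(n-p-1)/2}\prod_{i=1}^p\|M_{\cdot i}\|^{-\gamma}$ (where $M_{\cdot i}$ is the $i$-th column of $M$) is minimax under the Frobenius loss $\|\hat M-M\|_{\mathrm F}^2$, i.e., $\sup_M\mathrm E_M\|\hat M-M\|_{\mathrm F}^2\le np/N$.
   Context: The generalized Bayes estimator with respect to a nonnegative function $\pi$ with finite marginal $m_\pi(Y)=\int p(Y\mid M)\pi(M)\,\mathrm dM$ for all $Y$ is the posterior mean $\int Mp(Y\mid M)\pi(M)\,\mathrm dM/m_\pi(Y)$. *)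

theory Defs
  imports "HOL-Analysis.Analysis"
begin

text \<open>Matrices Y, M in R^{n x p} are rendered as real^'p^'n (row index of type 'n,
  column index of type 'p), so n = CARD('n), p = CARD('p).\<close>

definition gauss_lik :: "real \<Rightarrow> real^'p^'n \<Rightarrow> real^'p^'n \<Rightarrow> real" where
  "gauss_lik N Y M =
     (\<Prod>a\<in>UNIV. \<Prod>i\<in>UNIV. sqrt (N / (2 * pi)) * exp (- (N / 2) * (Y$a$i - M$a$i)^2))"

definition frob_sq :: "real^'p^'n \<Rightarrow> real" where
  "frob_sq A = (\<Sum>a\<in>UNIV. \<Sum>i\<in>UNIV. (A$a$i)^2)"

definition msvs2_prior :: "real \<Rightarrow> real^'p^'n \<Rightarrow> real" where
  "msvs2_prior \<gamma> M =
     det (transpose M ** M) powr (- (real CARD('n) - real CARD('p) - 1) / 2)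
     * (\<Prod>i\<in>UNIV. norm (column i M) powr (- \<gamma>))"

definition gb_marginal :: "real \<Rightarrow> real \<Rightarrow> real^'p^'n \<Rightarrow> real" where
  "gb_marginal N \<gamma> Y = (\<integral>M. gauss_lik N Y M * msvs2_prior \<gamma> M \<partial>lborel)"

definition gb_estimator :: "real \<Rightarrow> real \<Rightarrow> real^'p^'n \<Rightarrow> real^'p^'n" where
  "gb_estimator N \<gamma> Y =
     (1 / gb_marginal N \<gamma> Y) *\<^sub>R (\<integral>M. (gauss_lik N Y M * msvs2_prior \<gamma> M) *\<^sub>R M \<partial>lborel)"

definition gb_risk :: "real \<Rightarrow> real \<Rightarrow> real^'p^'n \<Rightarrow> ennreal" where
  "gb_risk N \<gamma> M =
     (\<integral>\<^sup>+Y. ennreal (gauss_lik N Y M * frob_sq (gb_estimator N \<gamma> Y - M)) \<partial>lborel)"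

end

theory Submission
  imports Defs "HOL-Probability.Distributions"
begin

text \<open>
  As a function of the \<open>i\<close>-th column \<open>x\<close>, with the other columns fixed and independent, the prior is a
  constant times \<open>|P x| powr - (d - 2) * |x| powr - \<gamma>\<close>, where \<open>P\<close> is the orthogonal projection along the
  span of the other columns and \<open>d = n - p + 1\<close> is its rank. This function is a mixture of the Gaussians
  \<open>exp (- |x - P x|\<^sup>2 / u - |P x|\<^sup>2 / w)\<close> over \<open>0 < w < u\<close>; the heat flow merely translates \<open>(u, w)\<close>
  along the diagonal, and \<open>\<gamma> \<le> 2 p - n\<close> says precisely that the mixing density increases along the
  diagonal. Hence the heat flow decreases the prior, column by column and so on the whole matrix space,
  without any analysis of its singularities.

  Consequently the marginal is finite and decreases in the noise level \<open>t\<close>. Its derivative in \<open>t\<close> is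
  read off as a bound on a posterior moment: the posterior mean of \<open>|M - Y|\<^sup>2\<close> is at most \<open>n p / N\<close>.
  Stein's identity, applied to the vector field posterior mean minus \<open>Y\<close>, which is now known to be
  bounded, turns this into the risk bound.
\<close>

section \<open>Gaussian integrals and the heat kernel\<close>

text \<open>The prior is singular on the rank-deficient matrices, so superharmonicity is stated
  through the heat semigroup, as an inequality of integrals, and not through a Laplacian. Put b = (n
  - p - 1) / 2 and g = gamma / 2, the exponents of |P x|^2 and |x|^2. Relative to Gaussians
  normalised by u^(-(p-1)/2) w^(-(n-p+1)/2), the mixing density is u^e (u - w)^(b-1) with e =
  (p-1)/2 - b - g. A diagonal shift fixes u - w, so only u^e changes, and e >= 0 says gamma <= 2 p -
  n. For the risk at theta, let v be the posterior mean minus Y and S the posterior mean of |M -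
  Y|^2. Then div v = N (S - |v|^2) - n p, and Stein's identity turns n p / N + 2 E<Y - theta, v> +
  E|v|^2 into 2 E S - E|v|^2 - n p / N. Inserting S <= n p / N and dropping E|v|^2 leaves n p /
  N.\<close>

lemma nn_integral_gaussian_real:
  fixes A \<mu> :: real
  assumes "A > 0"
  shows "(\<integral>\<^sup>+x. ennreal (exp (- A * (x - \<mu>)\<^sup>2)) \<partial>lborel) = ennreal (sqrt (pi / A))"
proof -
  define \<sigma> where "\<sigma> = sqrt (1 / (2 * A))"
  have \<sigma>: "\<sigma> > 0" "\<sigma>\<^sup>2 = 1 / (2 * A)"
    using assms by (auto simp: \<sigma>_def)
  have eq: "exp (- A * (x - \<mu>)\<^sup>2) = sqrt (pi / A) * normal_density \<mu> \<sigma> x" for x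
    using assms by (simp add: normal_density_def \<sigma>(2) real_sqrt_divide mult.commute)
  have "(\<integral>\<^sup>+x. ennreal (exp (- A * (x - \<mu>)\<^sup>2)) \<partial>lborel)
      = ennreal (sqrt (pi / A)) * (\<integral>\<^sup>+x. ennreal (normal_density \<mu> \<sigma> x) \<partial>lborel)"
    unfolding eq by (subst nn_integral_cmult[symmetric]) (auto simp: ennreal_mult assms less_imp_le)
  also have "(\<integral>\<^sup>+x. ennreal (normal_density \<mu> \<sigma> x) \<partial>lborel) = 1"
    using \<sigma>(1) by (simp add: nn_integral_eq_integral normal_density_nonneg)
  finally show ?thesis by simp
qed

lemma nn_integral_gaussian:
  fixes A :: real
  assumes "A > 0"
  shows "(\<integral>\<^sup>+x. ennreal (exp (- A * (norm (x::'a::euclidean_space))\<^sup>2)) \<partial>lborel)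
    = ennreal (sqrt (pi / A) ^ DIM('a))"
proof -
  have "(\<integral>\<^sup>+x. ennreal (exp (- A * (norm (x::'a))\<^sup>2)) \<partial>lborel)
      = (\<integral>\<^sup>+(x::'a). (\<Prod>b\<in>Basis. ennreal (exp (- A * (x \<bullet> b - 0)\<^sup>2))) \<partial>lborel)"
    by (intro nn_integral_cong)
       (simp add: norm_eq_sqrt_inner euclidean_inner[of x x for x] sum_nonneg sum_distrib_left
          exp_sum prod_ennreal power2_eq_square flip: sum_negf)
  also have "\<dots> = (\<Prod>b\<in>(Basis::'a set). ennreal (sqrt (pi / A)))"
    by (subst nn_integral_lborel_prod[where f="\<lambda>b t. ennreal (exp (- A * (t - 0)\<^sup>2))"])
       (auto simp: nn_integral_gaussian_real[OF assms, of 0, simplified])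
  finally show ?thesis
    using assms by (simp add: ennreal_power)
qed

text \<open>Uniqueness of Haar measure, normalised by a Gaussian integral because that is invariant under isometries:
  integrate \<open>f (x + y) * g y\<close>, with \<open>g\<close> Gaussian, in both orders.\<close>

lemma lborel_eqI_gaussian:
  fixes \<mu> :: "'a::euclidean_space measure"
  assumes sets: "sets \<mu> = sets borel"
    and inv: "\<And>a (f::'a \<Rightarrow> ennreal). f \<in> borel_measurable borel \<Longrightarrow>
      (\<integral>\<^sup>+x. f (a + x) \<partial>\<mu>) = (\<integral>\<^sup>+x. f x \<partial>\<mu>)"
    and gauss: "(\<integral>\<^sup>+x. ennreal (exp (- (norm x)\<^sup>2)) \<partial>\<mu>) = (\<integral>\<^sup>+(x::'a). ennreal (exp (- (norm x)\<^sup>2)) \<partial>lborel)"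
  shows "\<mu> = lborel"
proof -
  note [measurable_cong] = sets
  define g :: "'a \<Rightarrow> ennreal" where "g x = ennreal (exp (- (norm x)\<^sup>2))" for x
  have [measurable]: "g \<in> borel_measurable borel" unfolding g_def by measurable
  define G where "G = (\<integral>\<^sup>+x. g x \<partial>lborel)"
  have G: "G = ennreal (sqrt pi ^ DIM('a))"
    using nn_integral_gaussian[of 1, where 'a='a] by (simp add: G_def g_def)
  have G0: "G \<noteq> 0" "G \<noteq> \<infinity>" unfolding G by auto
  have G\<mu>: "(\<integral>\<^sup>+x. g x \<partial>\<mu>) = G" using gauss by (simp add: G_def g_def)
  have space: "space \<mu> = UNIV" using sets_eq_imp_space_eq[OF sets] by simp
  \<comment> \<open>Exchanging the integrals needs sigma-finiteness. On the ball of radius n the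
    Gaussian is at least exp (- n^2), and its integral is finite, so the ball has finite
    measure.\<close>
  interpret \<mu>: sigma_finite_measure \<mu>
  proof
    define C where "C = range (\<lambda>n::nat. cball (0::'a) (real n))"
    show "\<exists>A. countable A \<and> A \<subseteq> sets \<mu> \<and> \<Union> A = space \<mu> \<and> (\<forall>a\<in>A. emeasure \<mu> a \<noteq> \<infinity>)"
    proof (intro exI[of _ C] conjI ballI)
      show "countable C" by (auto simp: C_def)
      show "C \<subseteq> sets \<mu>" by (auto simp: C_def sets)
      show "\<Union> C = space \<mu>" using real_arch_simple by (auto simp: C_def space)
      fix S assume "S \<in> C"
      then obtain n :: nat where S: "S = cball 0 (real n)" by (auto simp: C_def)
      have "ennreal (exp (- (real n)\<^sup>2)) * emeasure \<mu> S = (\<integral>\<^sup>+x. ennreal (exp (- (real n)\<^sup>2)) * indicator S x \<partial>\<mu>)"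
        by (subst nn_integral_cmult_indicator) (auto simp: S sets)
      also have "\<dots> \<le> (\<integral>\<^sup>+x. g x \<partial>\<mu>)"
        by (intro nn_integral_mono)
           (auto simp: g_def S indicator_def intro!: ennreal_leI power_mono)
      finally have "ennreal (exp (- (real n)\<^sup>2)) * emeasure \<mu> S \<le> G" by (simp add: G\<mu>)
      then show "emeasure \<mu> S \<noteq> \<infinity>" using G0 by (auto simp: ennreal_mult_top top_unique)
    qed
  qed
  interpret P: pair_sigma_finite \<mu> lborel ..
  show ?thesis
  proof (rule measure_eqI)
    fix A assume "A \<in> sets \<mu>"
    then have [measurable]: "A \<in> sets borel" by (simp add: sets)
    define f :: "'a \<Rightarrow> ennreal" where "f = indicator A"
    have [measurable]: "f \<in> borel_measurable borel" by (simp add: f_def)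
    have "(\<integral>\<^sup>+x. f x \<partial>\<mu>) * G = (\<integral>\<^sup>+y. (\<integral>\<^sup>+x. f (y + x) * g y \<partial>\<mu>) \<partial>lborel)"
      by (simp add: G_def nn_integral_multc inv nn_integral_cmult)
    also have "\<dots> = (\<integral>\<^sup>+x. (\<integral>\<^sup>+y. f (y + x) * g y \<partial>lborel) \<partial>\<mu>)"
      by (rule P.Fubini') measurable
    also have "\<dots> = (\<integral>\<^sup>+x. (\<integral>\<^sup>+y. f y * g (y - x) \<partial>lborel) \<partial>\<mu>)"
    proof (rule nn_integral_cong)
      fix x
      have "(\<integral>\<^sup>+y. f y * g (y - x) \<partial>lborel) = (\<integral>\<^sup>+y. f y * g (y - x) \<partial>(distr lborel borel ((+) x)))"
        by (simp add: lborel_distr_plus)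
      also have "\<dots> = (\<integral>\<^sup>+y. f (y + x) * g y \<partial>lborel)"
        by (subst nn_integral_distr) (auto simp: add.commute)
      finally show "(\<integral>\<^sup>+y. f (y + x) * g y \<partial>lborel) = (\<integral>\<^sup>+y. f y * g (y - x) \<partial>lborel)" ..
    qed
    also have "\<dots> = (\<integral>\<^sup>+y. (\<integral>\<^sup>+x. f y * g (y - x) \<partial>\<mu>) \<partial>lborel)"
      by (rule P.Fubini'[symmetric]) measurable
    also have "\<dots> = (\<integral>\<^sup>+y. f y * G \<partial>lborel)"
    proof (intro nn_integral_cong)
      fix y
      have "(\<integral>\<^sup>+x. f y * g (y - x) \<partial>\<mu>) = f y * (\<integral>\<^sup>+x. g (- y + x) \<partial>\<mu>)"
        by (subst nn_integral_cmult[symmetric]) (auto simp: g_def norm_minus_commute)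
      then show "(\<integral>\<^sup>+x. f y * g (y - x) \<partial>\<mu>) = f y * G"
        using inv[of g "- y"] by (simp add: G\<mu>)
    qed
    also have "\<dots> = (\<integral>\<^sup>+y. f y \<partial>lborel) * G" by (simp add: nn_integral_multc)
    finally have "(\<integral>\<^sup>+x. f x \<partial>\<mu>) = (\<integral>\<^sup>+y. f y \<partial>lborel)"
      using G0 by (simp add: mult.commute[of _ G] ennreal_mult_cancel_left)
    then show "emeasure \<mu> A = emeasure lborel A" by (simp add: f_def sets)
  qed (simp add: sets)
qed

section \<open>Lebesgue measure in orthonormal and blockwise coordinates\<close>

lemma PiM_lborel_translation:
  fixes a :: "'i \<Rightarrow> 'b::euclidean_space"
  assumes I: "finite I"
  shows "distr (PiM I (\<lambda>_. lborel)) (PiM I (\<lambda>_. lborel)) (\<lambda>x. \<lambda>i\<in>I. a i + x i) = PiM I (\<lambda>_. lborel)"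
proof -
  interpret product_sigma_finite "\<lambda>_::'i. lborel::'b measure" ..
  show ?thesis
  proof (rule PiM_eqI[OF I])
    fix A :: "'i \<Rightarrow> 'b set" assume A: "\<And>i. i \<in> I \<Longrightarrow> A i \<in> sets lborel"
    have [measurable]: "(\<lambda>x. \<lambda>i\<in>I. a i + x i) \<in> PiM I (\<lambda>_. lborel) \<rightarrow>\<^sub>M PiM I (\<lambda>_. lborel)"
      by measurable
    have [measurable]: "(\<lambda>x. a i + x) -` A i \<in> sets borel" if "i \<in> I" for i
      using A[OF that] measurable_sets_borel[of "\<lambda>x. a i + x" borel "A i"] by simp
    have "emeasure (distr (PiM I (\<lambda>_. lborel)) (PiM I (\<lambda>_. lborel)) (\<lambda>x. \<lambda>i\<in>I. a i + x i)) (Pi\<^sub>E I A)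
      = emeasure (PiM I (\<lambda>_. lborel)) ((\<lambda>x. \<lambda>i\<in>I. a i + x i) -` Pi\<^sub>E I A \<inter> space (PiM I (\<lambda>_. lborel)))"
      using A I by (intro emeasure_distr) (auto intro!: sets_PiM_I_finite)
    also have "(\<lambda>x. \<lambda>i\<in>I. a i + x i) -` Pi\<^sub>E I A \<inter> space (PiM I (\<lambda>_. lborel)) = Pi\<^sub>E I (\<lambda>i. (\<lambda>x. a i + x) -` A i)"
      by (auto simp: space_PiM PiE_iff extensional_def)
    also have "emeasure (PiM I (\<lambda>_. lborel)) \<dots> = (\<Prod>i\<in>I. emeasure lborel ((\<lambda>x. a i + x) -` A i))"
      using I by (intro emeasure_PiM) auto
    also have "\<dots> = (\<Prod>i\<in>I. emeasure lborel (A i))"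
    proof (intro prod.cong refl)
      fix i assume "i \<in> I"
      have "emeasure lborel (A i) = emeasure (distr lborel borel ((+) (a i))) (A i)"
        by (simp add: lborel_distr_plus)
      also have "\<dots> = emeasure lborel ((\<lambda>x. a i + x) -` A i)"
        using A[OF \<open>i \<in> I\<close>] by (subst emeasure_distr) auto
      finally show "emeasure lborel ((\<lambda>x. a i + x) -` A i) = emeasure lborel (A i)" ..
    qed
    finally show "emeasure (distr (PiM I (\<lambda>_. lborel)) (PiM I (\<lambda>_. lborel)) (\<lambda>x. \<lambda>i\<in>I. a i + x i)) (Pi\<^sub>E I A)
      = (\<Prod>i\<in>I. emeasure lborel (A i))" .
  qed simp
qed

text \<open>The image measure is translation invariant because the map is linear and onto, and its
  Gaussian integral is the right power of sqrt pi because norms and dimensions match. Blocks of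
  dimension one give the coordinates of an arbitrary orthonormal basis; blocks that are columns
  split the matrix space.\<close>

lemma lborel_eq_distr_PiM_isometry:
  fixes T :: "'i \<Rightarrow> 'b::euclidean_space \<Rightarrow> 'a::euclidean_space"
  assumes I: "finite I" and lin: "\<And>i. i \<in> I \<Longrightarrow> linear (T i)"
    and norm: "\<And>x. (norm (\<Sum>i\<in>I. T i (x i)))\<^sup>2 = (\<Sum>i\<in>I. (norm (x i))\<^sup>2)"
    and surj: "\<And>a. \<exists>x. a = (\<Sum>i\<in>I. T i (x i))"
    and dim: "card I * DIM('b) = DIM('a)"
  shows "distr (PiM I (\<lambda>_. lborel)) borel (\<lambda>x. \<Sum>i\<in>I. T i (x i)) = lborel"
proof (rule lborel_eqI_gaussian)
  interpret product_sigma_finite "\<lambda>_::'i. lborel::'b measure" ..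
  have T[measurable]: "T i \<in> borel_measurable borel" if "i \<in> I" for i
    using lin[OF that] by (intro borel_measurable_continuous_onI linear_continuous_on)
      (simp add: linear_conv_bounded_linear)
  let ?S = "\<lambda>x. \<Sum>i\<in>I. T i (x i)"
  have S[measurable]: "?S \<in> PiM I (\<lambda>_. lborel) \<rightarrow>\<^sub>M borel"
    by measurable
  {
    fix a and f :: "'a \<Rightarrow> ennreal" assume [measurable]: "f \<in> borel_measurable borel"
    obtain y where y: "a = ?S y" using surj by blast
    have "(\<integral>\<^sup>+x. f x \<partial>distr (PiM I (\<lambda>_. lborel)) borel ?S)
        = (\<integral>\<^sup>+x. f (?S x) \<partial>PiM I (\<lambda>_. lborel))"
      by (intro nn_integral_distr) measurable
    also have "\<dots> = (\<integral>\<^sup>+x. f (?S x) \<partial>distr (PiM I (\<lambda>_. lborel)) (PiM I (\<lambda>_. lborel)) (\<lambda>x. \<lambda>i\<in>I. y i + x i))"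
      by (simp add: PiM_lborel_translation[OF I])
    also have "\<dots> = (\<integral>\<^sup>+x. f (?S (\<lambda>i\<in>I. y i + x i)) \<partial>PiM I (\<lambda>_. lborel))"
      by (intro nn_integral_distr) measurable
    also have "\<dots> = (\<integral>\<^sup>+x. f (a + ?S x) \<partial>PiM I (\<lambda>_. lborel))"
      using lin by (simp add: y linear_add sum.distrib cong: sum.cong)
    also have "\<dots> = (\<integral>\<^sup>+x. f (a + x) \<partial>distr (PiM I (\<lambda>_. lborel)) borel ?S)"
      by (intro nn_integral_distr[symmetric]) measurable
    finally show "(\<integral>\<^sup>+x. f (a + x) \<partial>distr (PiM I (\<lambda>_. lborel)) borel ?S)
      = (\<integral>\<^sup>+x. f x \<partial>distr (PiM I (\<lambda>_. lborel)) borel ?S)" ..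
  }
  have "(\<integral>\<^sup>+x. ennreal (exp (- (norm x)\<^sup>2)) \<partial>distr (PiM I (\<lambda>_. lborel)) borel ?S)
     = (\<integral>\<^sup>+x. ennreal (exp (- (norm (?S x))\<^sup>2)) \<partial>PiM I (\<lambda>_. lborel))"
    by (intro nn_integral_distr) measurable
  also have "\<dots> = (\<integral>\<^sup>+x. (\<Prod>i\<in>I. ennreal (exp (- 1 * (norm (x i :: 'b))\<^sup>2))) \<partial>PiM I (\<lambda>_. lborel))"
    by (simp add: norm exp_sum I prod_ennreal flip: sum_negf)
  also have "\<dots> = (\<Prod>i\<in>I. \<integral>\<^sup>+x. ennreal (exp (- 1 * (norm (x::'b))\<^sup>2)) \<partial>lborel)"
    by (intro product_nn_integral_prod[OF I]) measurable
  also have "\<dots> = ennreal (sqrt pi ^ DIM('a))"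
    by (subst nn_integral_gaussian) (auto simp: ennreal_power mult.commute simp flip: dim power_mult)
  also have "\<dots> = (\<integral>\<^sup>+x. ennreal (exp (- 1 * (norm (x::'a))\<^sup>2)) \<partial>lborel)"
    by (subst nn_integral_gaussian) auto
  finally show "(\<integral>\<^sup>+x. ennreal (exp (- (norm x)\<^sup>2)) \<partial>distr (PiM I (\<lambda>_. lborel)) borel ?S)
     = (\<integral>\<^sup>+(x::'a). ennreal (exp (- (norm x)\<^sup>2)) \<partial>lborel)" by simp
qed simp

section \<open>The heat kernel acting on Gaussians\<close>

definition heat_kernel :: "real \<Rightarrow> 'a::euclidean_space \<Rightarrow> real" where
  "heat_kernel s z = exp (- (norm z)\<^sup>2 / (2 * s)) / sqrt (2 * pi * s) ^ DIM('a)"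

lemma heat_kernel_measurable [measurable]: "heat_kernel s \<in> borel_measurable borel"
  unfolding heat_kernel_def by measurable

lemma heat_kernel_pos: "s > 0 \<Longrightarrow> heat_kernel s z > 0"
  by (simp add: heat_kernel_def)

lemma heat_kernel_nonneg [simp]: "s > 0 \<Longrightarrow> heat_kernel s z \<ge> 0"
  using heat_kernel_pos[of s z] by simp

text \<open>The kernel has variance \<open>s\<close>, whereas \<open>u\<close> is twice the variance
  of the Gaussian it meets; hence the shift by \<open>2 * s\<close>.\<close>

lemma nn_integral_heat_gaussian_real:
  fixes s u x :: real
  assumes "s > 0" "u > 0"
  shows "(\<integral>\<^sup>+z. ennreal (exp (- z\<^sup>2 / (2 * s)) / sqrt (2 * pi * s) * exp (- (x + z)\<^sup>2 / u)) \<partial>lborel)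
    = ennreal (sqrt (u / (u + 2 * s)) * exp (- x\<^sup>2 / (u + 2 * s)))"
proof -
  \<comment> \<open>Completing the square: \<open>A\<close> is 1 / (2 s) + 1 / u, and the exponent
    is extremal at z = \<open>\<mu>\<close>.\<close>
  define A where "A = (u + 2 * s) / (2 * s * u)"
  define \<mu> where "\<mu> = - x * (2 * s) / (u + 2 * s)"
  have A: "A > 0" using assms by (simp add: A_def)
  have sq: "z\<^sup>2 / (2 * s) + (x + z)\<^sup>2 / u = A * (z - \<mu>)\<^sup>2 + x\<^sup>2 / (u + 2 * s)" for z
  proof -
    have nz: "u + 2 * s \<noteq> 0" "s \<noteq> 0" "u \<noteq> 0" using assms by auto
    have "z - \<mu> = ((u + 2 * s) * z + 2 * s * x) / (u + 2 * s)"
      using nz(1) by (simp add: \<mu>_def field_simps)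
    then have "A * (z - \<mu>)\<^sup>2 = ((u + 2 * s) * z + 2 * s * x)\<^sup>2 / (2 * s * u * (u + 2 * s))"
      using nz by (simp add: A_def power_divide power2_eq_square)
    moreover have "((u + 2 * s) * z + 2 * s * x)\<^sup>2 + 2 * s * u * x\<^sup>2
        = (u + 2 * s) * (u * z\<^sup>2 + 2 * s * (x + z)\<^sup>2)" by algebra
    moreover have "z\<^sup>2 / (2 * s) + (x + z)\<^sup>2 / u = (u + 2 * s) * (u * z\<^sup>2 + 2 * s * (x + z)\<^sup>2) / (2 * s * u * (u + 2 * s))"
    proof -
      have "z\<^sup>2 / (2 * s) + (x + z)\<^sup>2 / u = (u * z\<^sup>2 + 2 * s * (x + z)\<^sup>2) / (2 * s * u)"
        using nz by (simp add: add_divide_distrib)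
      then show ?thesis using nz by simp
    qed
    moreover have "x\<^sup>2 / (u + 2 * s) = 2 * s * u * x\<^sup>2 / (2 * s * u * (u + 2 * s))"
      using nz by simp
    ultimately show ?thesis by (simp only: add_divide_distrib[symmetric])
  qed
  have eq: "exp (- z\<^sup>2 / (2 * s)) / sqrt (2 * pi * s) * exp (- (x + z)\<^sup>2 / u)
      = exp (- x\<^sup>2 / (u + 2 * s)) / sqrt (2 * pi * s) * exp (- A * (z - \<mu>)\<^sup>2)" for z
  proof -
    have "- z\<^sup>2 / (2 * s) + - (x + z)\<^sup>2 / u = - x\<^sup>2 / (u + 2 * s) + - A * (z - \<mu>)\<^sup>2"
      using sq[of z] by simp
    then have "exp (- z\<^sup>2 / (2 * s)) * exp (- (x + z)\<^sup>2 / u) = exp (- x\<^sup>2 / (u + 2 * s)) * exp (- A * (z - \<mu>)\<^sup>2)"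
      by (simp only: exp_add[symmetric])
    then show ?thesis by (simp add: divide_simps)
  qed
  have "(\<integral>\<^sup>+z. ennreal (exp (- z\<^sup>2 / (2 * s)) / sqrt (2 * pi * s) * exp (- (x + z)\<^sup>2 / u)) \<partial>lborel)
    = (\<integral>\<^sup>+z. ennreal (exp (- x\<^sup>2 / (u + 2 * s)) / sqrt (2 * pi * s)) * ennreal (exp (- A * (z - \<mu>)\<^sup>2)) \<partial>lborel)"
    using assms by (simp only: eq ennreal_mult[symmetric] divide_nonneg_nonneg exp_ge_zero real_sqrt_ge_zero mult_nonneg_nonneg less_imp_le pi_gt_zero zero_le_numeral)
  also have "\<dots> = ennreal (exp (- x\<^sup>2 / (u + 2 * s)) / sqrt (2 * pi * s)) * ennreal (sqrt (pi / A))"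
    by (subst nn_integral_cmult, measurable) (subst nn_integral_gaussian_real[OF A], rule refl)
  also have "\<dots> = ennreal (sqrt (u / (u + 2 * s)) * exp (- x\<^sup>2 / (u + 2 * s)))"
  proof -
    have "sqrt (pi / A) / sqrt (2 * pi * s) = sqrt (u / (u + 2 * s))"
      using assms unfolding A_def real_sqrt_divide[symmetric]
      by (intro arg_cong[of _ _ sqrt]) (simp add: divide_simps)
    then have "exp (- x\<^sup>2 / (u + 2 * s)) / sqrt (2 * pi * s) * sqrt (pi / A) = sqrt (u / (u + 2 * s)) * exp (- x\<^sup>2 / (u + 2 * s))"
      by (metis (no_types, opaque_lifting) mult.commute times_divide_eq_left)
    moreover have "0 \<le> exp (- x\<^sup>2 / (u + 2 * s)) / sqrt (2 * pi * s)" "0 \<le> sqrt (pi / A)" using assms A by auto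
    ultimately show ?thesis by (simp only: ennreal_mult[symmetric])
  qed
  finally show ?thesis .
qed

lemma norm_sum_orthonormal:
  fixes B :: "'a::real_inner set"
  assumes "finite B" and orth: "pairwise orthogonal B" and nrm: "\<And>b. b \<in> B \<Longrightarrow> norm b = 1"
  shows "(norm (\<Sum>b\<in>B. x b *\<^sub>R b))\<^sup>2 = (\<Sum>b\<in>B. (x b)\<^sup>2)"
proof -
  have "(norm (\<Sum>b\<in>B. x b *\<^sub>R b))\<^sup>2 = (\<Sum>b\<in>B. (norm (x b *\<^sub>R b))\<^sup>2)"
    using orth by (intro norm_sum_Pythagorean \<open>finite B\<close>) (auto simp: pairwise_def orthogonal_def)
  then show ?thesis by (simp add: nrm)
qed

lemma inner_sum_orthonormal:
  fixes B :: "'a::real_inner set"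
  assumes "finite B" and orth: "pairwise orthogonal B" and nrm: "\<And>b. b \<in> B \<Longrightarrow> norm b = 1"
    and "b \<in> B"
  shows "(\<Sum>c\<in>B. x c *\<^sub>R c) \<bullet> b = x b"
proof -
  have "(\<Sum>c\<in>B. x c *\<^sub>R c) \<bullet> b = (\<Sum>c\<in>B. if c = b then x b else 0)"
    unfolding inner_sum_left using orth nrm[OF \<open>b \<in> B\<close>] \<open>b \<in> B\<close>
    by (intro sum.cong) (auto simp: pairwise_def orthogonal_def norm_eq_1)
  then show ?thesis using assms by simp
qed

lemma span_orthonormal_expansion:
  fixes B :: "'a::real_inner set"
  assumes "finite B" and orth: "pairwise orthogonal B" and nrm: "\<And>b. b \<in> B \<Longrightarrow> norm b = 1"
    and "x \<in> span B"
  shows "x = (\<Sum>b\<in>B. (x \<bullet> b) *\<^sub>R b)"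
proof -
  obtain y where y: "x = (\<Sum>b\<in>B. y b *\<^sub>R b)"
    using \<open>x \<in> span B\<close> by (auto simp: span_finite[OF \<open>finite B\<close>])
  show ?thesis
    by (subst (1) y) (auto intro!: sum.cong simp: y inner_sum_orthonormal[OF assms(1-3)])
qed

text \<open>In the coordinates of \<open>B\<close> the kernel and the Gaussian both factor, so each
  direction evolves by the one-dimensional formula with its own width. Later there are two widths,
  one inside the span of the other columns and one orthogonal to it.\<close>

lemma heat_kernel_orthonormal_gaussian:
  fixes B :: "'a::euclidean_space set" and u :: "'a \<Rightarrow> real"
  assumes orth: "pairwise orthogonal B" and nrm: "\<And>b. b \<in> B \<Longrightarrow> norm b = 1"
    and spanB: "span B = UNIV" and card: "card B = DIM('a)" and s: "s > 0" and u: "\<And>b. b \<in> B \<Longrightarrow> u b > 0"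
  shows "(\<integral>\<^sup>+z. ennreal (heat_kernel s z * (\<Prod>b\<in>B. exp (- ((x + z) \<bullet> b)\<^sup>2 / u b))) \<partial>lborel)
    = ennreal (\<Prod>b\<in>B. sqrt (u b / (u b + 2 * s)) * exp (- (x \<bullet> b)\<^sup>2 / (u b + 2 * s)))"
proof -
  have fin: "finite B" using card card.infinite[of B] by (metis DIM_positive less_numeral_extra(3))
  note on = fin orth nrm
  interpret product_sigma_finite "\<lambda>_::'a. lborel::real measure" ..
  have D: "distr (PiM B (\<lambda>_. lborel)) borel (\<lambda>z. \<Sum>b\<in>B. z b *\<^sub>R b) = lborel"
  proof (rule lborel_eq_distr_PiM_isometry[OF fin, where T="\<lambda>b t. t *\<^sub>R b"])
    show "linear (\<lambda>t. t *\<^sub>R b)" for b :: 'a by (simp add: linear_iff scaleR_left_distrib)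
    show "\<exists>x. a = (\<Sum>b\<in>B. x b *\<^sub>R b)" for a
      using span_orthonormal_expansion[OF on, of a] spanB by (intro exI[of _ "\<lambda>b. a \<bullet> b"]) auto
  qed (use norm_sum_orthonormal[OF on] card in auto)
  have "(\<integral>\<^sup>+z. ennreal (heat_kernel s z * (\<Prod>b\<in>B. exp (- ((x + z) \<bullet> b)\<^sup>2 / u b))) \<partial>lborel)
     = (\<integral>\<^sup>+z. ennreal (heat_kernel s (\<Sum>b\<in>B. z b *\<^sub>R b) * (\<Prod>b\<in>B. exp (- ((x + (\<Sum>b\<in>B. z b *\<^sub>R b)) \<bullet> b)\<^sup>2 / u b))) \<partial>PiM B (\<lambda>_. lborel))"
    by (subst D[symmetric], intro nn_integral_distr) measurable
  also have "\<dots> = (\<integral>\<^sup>+z. (\<Prod>b\<in>B. ennreal (exp (- (z b)\<^sup>2 / (2 * s)) / sqrt (2 * pi * s) * exp (- (x \<bullet> b + z b)\<^sup>2 / u b))) \<partial>PiM B (\<lambda>_. lborel))"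
  proof (intro nn_integral_cong)
    fix z
    have "heat_kernel s (\<Sum>b\<in>B. z b *\<^sub>R b) = (\<Prod>b\<in>B. exp (- (z b)\<^sup>2 / (2 * s)) / sqrt (2 * pi * s))"
    proof -
      have "- (norm (\<Sum>b\<in>B. z b *\<^sub>R b))\<^sup>2 / (2 * s) = (\<Sum>b\<in>B. - (z b)\<^sup>2 / (2 * s))"
        using norm_sum_orthonormal[OF on, of z] by (simp add: sum_negf sum_divide_distrib)
      then show ?thesis
        by (simp only: heat_kernel_def prod_dividef exp_sum[OF fin] card prod_constant)
    qed
    then show "ennreal (heat_kernel s (\<Sum>b\<in>B. z b *\<^sub>R b) * (\<Prod>b\<in>B. exp (- ((x + (\<Sum>b\<in>B. z b *\<^sub>R b)) \<bullet> b)\<^sup>2 / u b)))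
      = (\<Prod>b\<in>B. ennreal (exp (- (z b)\<^sup>2 / (2 * s)) / sqrt (2 * pi * s) * exp (- (x \<bullet> b + z b)\<^sup>2 / u b)))"
      using s by (simp add: prod_ennreal inner_add_left inner_sum_orthonormal[OF on] prod.distrib prod_dividef)
  qed
  also have "\<dots> = (\<Prod>b\<in>B. \<integral>\<^sup>+t. ennreal (exp (- t\<^sup>2 / (2 * s)) / sqrt (2 * pi * s) * exp (- (x \<bullet> b + t)\<^sup>2 / u b)) \<partial>lborel)"
    by (intro product_nn_integral_prod[OF fin]) measurable
  also have "\<dots> = (\<Prod>b\<in>B. ennreal (sqrt (u b / (u b + 2 * s)) * exp (- (x \<bullet> b)\<^sup>2 / (u b + 2 * s))))"
    using s u by (intro prod.cong refl nn_integral_heat_gaussian_real) auto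
  also have "\<dots> = ennreal (\<Prod>b\<in>B. sqrt (u b / (u b + 2 * s)) * exp (- (x \<bullet> b)\<^sup>2 / (u b + 2 * s)))"
    using s u by (intro prod_ennreal) (simp add: less_imp_le)
  finally show ?thesis .
qed

section \<open>Powers of quadratic forms as Gaussian mixtures\<close>

text \<open>Inversion maps each interval [1/r, r] onto itself, so the identity is proved there and
  extended by monotone convergence. Inversion is composed of a reflection, absorbed in
  \<open>G\<close>, and t |-> -1/t, which is increasing with derivative 1/t^2.\<close>

lemma nn_integral_inverse_substitution:
  fixes F :: "real \<Rightarrow> real"
  assumes [measurable]: "F \<in> borel_measurable borel"
  shows "(\<integral>\<^sup>+x. ennreal (F x) * indicator {0<..} x \<partial>lborel)
    = (\<integral>\<^sup>+t. ennreal (F (1 / t) / t\<^sup>2) * indicator {0<..} t \<partial>lborel)"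
proof -
  define G where "G t = F (- t)" for t
  have [measurable]: "G \<in> borel_measurable borel" unfolding G_def by measurable
  define A where "A n = {1 / real (Suc n)..real (Suc n)}" for n
  have A_mono: "A m \<subseteq> A n" if "m \<le> n" for m n
    using that by (auto simp: A_def intro: order_trans[rotated] frac_le)
  have A_Un: "(\<Union>n. A n) = {0<..}"
  proof safe
    fix x n assume "x \<in> A n"
    then have "1 / real (Suc n) \<le> x" by (simp add: A_def)
    moreover have "0 < 1 / real (Suc n)" by simp
    ultimately show "0 < x" by linarith
  next
    fix x :: real assume x: "0 < x"
    obtain n :: nat where n: "max x (1 / x) \<le> real n" using real_arch_simple by blast
    have "1 / x \<le> real (Suc n)" using n by simp
    then have "1 / real (Suc n) \<le> x" using x by (simp add: field_simps)
    then show "x \<in> (\<Union>n. A n)" using n by (auto simp: A_def intro!: exI[of _ n])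
  qed
  have A_inc: "incseq A" using A_mono by (auto simp: incseq_def)
  have A_sets: "range A \<subseteq> sets borel" by (auto simp: A_def)
  have step: "(\<integral>\<^sup>+x. ennreal (F x) * indicator (A n) x \<partial>lborel)
      = (\<integral>\<^sup>+t. ennreal (F (1 / t) / t\<^sup>2) * indicator (A n) t \<partial>lborel)" for n
  proof -
    define r where "r = real (Suc n)"
    have r: "r \<ge> 1" by (simp add: r_def)
    have A: "A n = {1 / r..r}" by (simp add: A_def r_def)
    have "(\<integral>\<^sup>+x. ennreal (F x) * indicator (A n) x \<partial>lborel)
        = (\<integral>\<^sup>+x. ennreal (F (- x)) * indicator (A n) (- x) \<partial>lborel)"
      using nn_integral_real_affine[of "\<lambda>x. ennreal (F x) * indicator (A n) x" "-1" 0] by (simp add: A)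
    also have "\<dots> = (\<integral>\<^sup>+x. G x * indicator {- 1 / (1 / r).. - 1 / r} x \<partial>lborel)"
      unfolding A by (intro nn_integral_cong) (auto simp: G_def split: split_indicator)
    also have "\<dots> = (\<integral>\<^sup>+t. G (- 1 / t) * (1 / t\<^sup>2) * indicator {1 / r..r} t \<partial>lborel)"
    proof (rule nn_integral_substitution)
      have pos: "x > 0" if "x \<in> {1 / r..r}" for x
        using that r by (auto intro: less_le_trans[of 0 "1 / r"])
      show "set_borel_measurable borel {- 1 / (1 / r).. - 1 / r} G"
        unfolding set_borel_measurable_def by measurable
      show "((\<lambda>t. - 1 / t) has_real_derivative 1 / x\<^sup>2) (at x)" if "x \<in> {1 / r..r}" for x
        using pos[OF that] by (auto intro!: derivative_eq_intros simp: power2_eq_square)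
      show "continuous_on {1 / r..r} (\<lambda>x. 1 / x\<^sup>2)"
        using pos by (intro continuous_intros) force
      show "1 / r \<le> r" using r by (auto intro: order_trans[of _ 1])
    qed simp
    also have "\<dots> = (\<integral>\<^sup>+t. ennreal (F (1 / t) / t\<^sup>2) * indicator (A n) t \<partial>lborel)"
      unfolding A by (intro nn_integral_cong) (auto simp: G_def split: split_indicator)
    finally show ?thesis .
  qed
  have lim: "(\<integral>\<^sup>+x. ennreal (H x) * indicator {0<..} x \<partial>lborel)
      = (SUP n. \<integral>\<^sup>+x. ennreal (H x) * indicator (A n) x \<partial>lborel)"
    if [measurable]: "H \<in> borel_measurable borel" for H :: "real \<Rightarrow> real"
  proof -
    have [simp]: "A n \<in> sets borel" for n by (simp add: A_def)
    show ?thesis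
      using SUP_emeasure_incseq[of A "density lborel (\<lambda>x. ennreal (H x))"] A_sets A_inc
      by (simp add: emeasure_density A_Un)
  qed
  show ?thesis by (simp add: lim step)
qed

text \<open>The value \<open>\<infinity>\<close> at \<open>0\<close> makes the mixture representations below hold everywhere, whereas
  \<^term>\<open>0 powr (- b)\<close> is \<open>0\<close>.\<close>

definition inv_powr :: "real \<Rightarrow> real \<Rightarrow> ennreal" where
  "inv_powr r b = (if r = 0 then \<infinity> else ennreal (r powr (- b)))"

lemma nn_integral_Gamma_mixture:
  fixes b r :: real
  assumes b: "b > 0" and r: "r \<ge> 0"
  shows "(\<integral>\<^sup>+x. ennreal (x powr (b - 1) * exp (- r * x)) * indicator {0<..} x \<partial>lborel)
    = ennreal (Gamma b) * inv_powr r b"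
proof -
  define I where "I r = (\<integral>\<^sup>+x. ennreal (x powr (b - 1) * exp (- r * x)) * indicator {0<..} x \<partial>lborel)" for r
  have pos: "I r = ennreal (Gamma b * r powr (- b))" if r: "r > 0" for r
  proof -
    have "I r = ennreal \<bar>1 / r\<bar> * (\<integral>\<^sup>+x. ennreal ((0 + 1 / r * x) powr (b - 1) * exp (- r * (0 + 1 / r * x))) * indicator {0<..} (0 + 1 / r * x) \<partial>lborel)"
      unfolding I_def using r by (intro nn_integral_real_affine) auto
    also have "(\<integral>\<^sup>+x. ennreal ((0 + 1 / r * x) powr (b - 1) * exp (- r * (0 + 1 / r * x))) * indicator {0<..} (0 + 1 / r * x) \<partial>lborel)
       = (\<integral>\<^sup>+x. ennreal (r powr (1 - b)) * ennreal (indicator {0..} x * x powr (b - 1) / exp x) \<partial>lborel)"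
    proof (intro nn_integral_cong)
      fix x :: real
      show "ennreal ((0 + 1 / r * x) powr (b - 1) * exp (- r * (0 + 1 / r * x))) * indicator {0<..} (0 + 1 / r * x)
        = ennreal (r powr (1 - b)) * ennreal (indicator {0..} x * x powr (b - 1) / exp x)"
      proof (cases "x > 0")
        case True
        have "(1 / r * x) powr (b - 1) = r powr (1 - b) * x powr (b - 1)"
          using r True by (simp add: powr_mult powr_divide powr_minus_divide[symmetric] flip: powr_minus) (simp add: powr_diff mult.commute)
        then show ?thesis using r True by (simp add: ennreal_mult[symmetric] exp_minus divide_inverse)
      next
        case False
        then show ?thesis using r by (cases "x = 0") (auto simp: zero_less_divide_iff split: split_indicator)
      qed
    qed
    also have "\<dots> = ennreal (r powr (1 - b)) * ennreal (Gamma b)"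
      by (subst nn_integral_cmult) (auto simp: Gamma_conv_nn_integral_real[OF b])
    also have "ennreal \<bar>1 / r\<bar> * \<dots> = ennreal (Gamma b * r powr (- b))"
    proof -
      have "1 / r * r powr (1 - b) = r powr (- b)" using r by (simp add: powr_diff powr_minus_divide)
      then show ?thesis using r Gamma_real_pos[OF b]
        by (simp add: ennreal_mult[symmetric] mult.assoc[symmetric])
    qed
    finally show ?thesis .
  qed
  show ?thesis
  proof (cases "r = 0")
    case False
    then show ?thesis using r pos[of r] Gamma_real_pos[OF b]
      by (simp add: I_def inv_powr_def ennreal_mult)
  next
    case True
    have "I 0 = top"
    proof (rule ccontr)
      assume "I 0 \<noteq> top"
      then obtain x where x: "I 0 = ennreal x" "x \<ge> 0" by (cases "I 0") auto
      \<comment> \<open>This \<open>q\<close> makes \<open>I q\<close> equal to x + 1, above the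
        supposed finite value x of \<open>I 0\<close>, although the integrand at \<open>q\<close> is
        the smaller one.\<close>
      define q where "q = ((x + 1) / Gamma b) powr (- 1 / b)"
      have q: "q > 0" using x Gamma_real_pos[OF b] by (simp add: q_def)
      have "q powr (- b) = (x + 1) / Gamma b"
        using x Gamma_real_pos[OF b] b by (simp add: q_def powr_powr)
      then have "I q = ennreal (x + 1)" using pos[OF q] Gamma_real_pos[OF b] by simp
      moreover have "I q \<le> I 0" unfolding I_def
      proof (intro nn_integral_mono)
        fix x :: real
        have "x powr (b - 1) * exp (- q * x) \<le> x powr (b - 1) * exp (- 0 * x)" if "x > 0"
          using q that by (intro mult_left_mono) auto
        then show "ennreal (x powr (b - 1) * exp (- q * x)) * indicator {0<..} x
          \<le> ennreal (x powr (b - 1) * exp (- 0 * x)) * indicator {0<..} x"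
          by (auto split: split_indicator intro!: ennreal_leI)
      qed
      ultimately show False using x by simp
    qed
    then show ?thesis using True Gamma_real_pos[OF b]
      by (simp add: I_def inv_powr_def ennreal_mult_top)
  qed
qed

text \<open>Under w = 1/x the range becomes x > 1/u and the powers of x cancel, leaving (u x -
  1)^(b-1) exp (- a x). Moving the origin to 1/u makes this a Gamma integral and splits off exp (- a
  / u).\<close>

lemma nn_integral_mixture_inner:
  fixes a b u :: real
  assumes b: "b > 0" and a: "a \<ge> 0" and u: "u > 0"
  shows "(\<integral>\<^sup>+w. ennreal ((u - w) powr (b - 1) * w powr (- b - 1) * exp (- a / w)) * indicator {0<..<u} w \<partial>lborel)
    = ennreal (u powr (b - 1) * exp (- a / u)) * (ennreal (Gamma b) * inv_powr a b)"
proof -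
  define F where "F w = (u - w) powr (b - 1) * w powr (- b - 1) * exp (- a / w) * indicator {..<u} w" for w
  have [measurable]: "F \<in> borel_measurable borel" unfolding F_def by measurable
  define k where "k x = (u * x - 1) powr (b - 1) * exp (- a * x)" for x
  have [measurable]: "k \<in> borel_measurable borel" unfolding k_def by measurable
  have "(\<integral>\<^sup>+w. ennreal ((u - w) powr (b - 1) * w powr (- b - 1) * exp (- a / w)) * indicator {0<..<u} w \<partial>lborel)
     = (\<integral>\<^sup>+w. ennreal (F w) * indicator {0<..} w \<partial>lborel)"
    by (intro nn_integral_cong) (auto simp: F_def split: split_indicator)
  also have "\<dots> = (\<integral>\<^sup>+x. ennreal (F (1 / x) / x\<^sup>2) * indicator {0<..} x \<partial>lborel)"
    by (rule nn_integral_inverse_substitution) measurable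
  also have "\<dots> = (\<integral>\<^sup>+x. ennreal (k x) * indicator {1 / u<..} x \<partial>lborel)"
  proof (intro nn_integral_cong)
    fix x :: real
    show "ennreal (F (1 / x) / x\<^sup>2) * indicator {0<..} x = ennreal (k x) * indicator {1 / u<..} x"
    proof (cases "x > 0")
      case False
      then have "\<not> x > 1 / u" using u by (meson divide_pos_pos less_trans zero_less_one)
      then show ?thesis using False by simp
    next
      case True
      have iff: "1 / x < u \<longleftrightarrow> 1 / u < x" using True u by (simp add: field_simps)
      show ?thesis
      proof (cases "1 / u < x")
        case False then show ?thesis using iff by (simp add: F_def)
      next
        case ux: True
        then have ux1: "u * x - 1 > 0" using u by (simp add: field_simps)
        have "u - 1 / x = (u * x - 1) / x" using True by (simp add: field_simps)
        then have "(u - 1 / x) powr (b - 1) = (u * x - 1) powr (b - 1) / x powr (b - 1)"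
          using ux1 True by (simp add: powr_divide)
        moreover have "(1 / x) powr (- b - 1) = x powr (b + 1)"
          using True by (simp add: powr_divide powr_minus_divide powr_diff powr_add)
        moreover have "x powr (b + 1) = x powr (b - 1) * x\<^sup>2"
          using True by (simp add: powr_diff powr_add power2_eq_square)
        ultimately have "F (1 / x) / x\<^sup>2 = k x"
          using True iff ux by (simp add: F_def k_def)
        then show ?thesis using True ux by simp
      qed
    qed
  qed
  also have "\<dots> = (\<integral>\<^sup>+x. ennreal (k (1 / u + 1 * x)) * indicator {1 / u<..} (1 / u + 1 * x) \<partial>lborel)"
    using nn_integral_real_affine[of "\<lambda>x. ennreal (k x) * indicator {1 / u<..} x" 1 "1 / u"] by simp
  also have "\<dots> = (\<integral>\<^sup>+x. ennreal (u powr (b - 1) * exp (- a / u)) * (ennreal (x powr (b - 1) * exp (- a * x)) * indicator {0<..} x) \<partial>lborel)"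
  proof (intro nn_integral_cong)
    fix x :: real
    have "k (1 / u + 1 * x) = u powr (b - 1) * exp (- a / u) * (x powr (b - 1) * exp (- a * x))" if "x > 0"
    proof -
      have "u * (1 / u + 1 * x) - 1 = u * x" using u by (simp add: distrib_left)
      moreover have "- a * (1 / u + 1 * x) = - a / u + - a * x" by (simp add: distrib_left)
      ultimately show ?thesis using u that unfolding k_def
        by (simp only: exp_add powr_mult less_imp_le) simp
    qed
    then show "ennreal (k (1 / u + 1 * x)) * indicator {1 / u<..} (1 / u + 1 * x)
      = ennreal (u powr (b - 1) * exp (- a / u)) * (ennreal (x powr (b - 1) * exp (- a * x)) * indicator {0<..} x)"
      by (auto split: split_indicator simp: ennreal_mult[symmetric])
  qed
  also have "\<dots> = ennreal (u powr (b - 1) * exp (- a / u)) * (ennreal (Gamma b) * inv_powr a b)"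
    by (subst nn_integral_cmult) (auto simp: nn_integral_Gamma_mixture[OF b a, simplified])
  finally show ?thesis .
qed

text \<open>The condition on \<open>d\<close> turns the normalising factor in w into the power -b -
  1 of the preceding lemma. The inner integral then contributes the power of \<open>a\<close> and
  replaces exp (- a / w) by exp (- a / u), so that only q + a remains in the exponent. The value of
  \<open>e\<close> makes the total power of u equal to -g - 1, which inversion turns into a Gamma
  integral with parameter \<open>g\<close>.\<close>

lemma nn_integral_mixture:
  fixes a q b g e :: real and k d :: nat
  assumes b: "b > 0" and g: "g > 0" and a: "a \<ge> 0" and q: "q \<ge> 0"
    and d: "real d / 2 = b + 1" and e: "e = real k / 2 - b - g"
  shows "(\<integral>\<^sup>+u. (\<integral>\<^sup>+w. ennreal (u powr e * (u - w) powr (b - 1) * ((1 / sqrt u) ^ k * (1 / sqrt w) ^ d * exp (- q / u) * exp (- a / w)))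
        * indicator {0<..<u} w \<partial>lborel) \<partial>lborel)
    = ennreal (Gamma b * Gamma g) * (inv_powr a b * inv_powr (q + a) g)"
proof -
  have sq: "(1 / sqrt u) ^ m = u powr (- real m / 2)" if "u > 0" for u and m :: nat
    using that by (simp add: powr_minus_divide power_one_over powr_half_sqrt[symmetric] powr_realpow[symmetric] powr_powr)
  define P where "P = ennreal (Gamma b) * inv_powr a b"
  define F where "F u = u powr (- g - 1) * exp (- (q + a) / u)" for u
  have [measurable]: "F \<in> borel_measurable borel" unfolding F_def by measurable
  have inner: "(\<integral>\<^sup>+w. ennreal (u powr e * (u - w) powr (b - 1) * ((1 / sqrt u) ^ k * (1 / sqrt w) ^ d * exp (- q / u) * exp (- a / w)))
        * indicator {0<..<u} w \<partial>lborel) = ennreal (F u) * indicator {0<..} u * P" for u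
  proof (cases "u > 0")
    case False
    then have "{0<..<u} = {}" by auto
    then show ?thesis using False by simp
  next
    case u: True
    have "(\<integral>\<^sup>+w. ennreal (u powr e * (u - w) powr (b - 1) * ((1 / sqrt u) ^ k * (1 / sqrt w) ^ d * exp (- q / u) * exp (- a / w)))
        * indicator {0<..<u} w \<partial>lborel)
      = (\<integral>\<^sup>+w. ennreal (u powr e * u powr (- real k / 2) * exp (- q / u)) * (ennreal ((u - w) powr (b - 1) * w powr (- b - 1) * exp (- a / w)) * indicator {0<..<u} w) \<partial>lborel)"
    proof (intro nn_integral_cong)
      fix w :: real
      show "ennreal (u powr e * (u - w) powr (b - 1) * ((1 / sqrt u) ^ k * (1 / sqrt w) ^ d * exp (- q / u) * exp (- a / w))) * indicator {0<..<u} w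
        = ennreal (u powr e * u powr (- real k / 2) * exp (- q / u)) * (ennreal ((u - w) powr (b - 1) * w powr (- b - 1) * exp (- a / w)) * indicator {0<..<u} w)"
      proof (cases "w \<in> {0<..<u}")
        case True
        have "- real d / 2 = - b - 1" using d by simp
        then have "u powr e * (u - w) powr (b - 1) * ((1 / sqrt u) ^ k * (1 / sqrt w) ^ d * exp (- q / u) * exp (- a / w))
          = u powr e * u powr (- real k / 2) * exp (- q / u) * ((u - w) powr (b - 1) * w powr (- b - 1) * exp (- a / w))"
          using True sq[OF u, of k] sq[of w d] by (simp only: greaterThanLessThan_iff) (simp only: mult_ac)
        then show ?thesis using True by (simp add: ennreal_mult[symmetric])
      qed simp
    qed
    also have "\<dots> = ennreal (u powr e * u powr (- real k / 2) * exp (- q / u)) * (ennreal (u powr (b - 1) * exp (- a / u)) * P)"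
      unfolding P_def by (subst nn_integral_cmult) (auto simp: nn_integral_mixture_inner[OF b a u, simplified])
    also have "\<dots> = ennreal (F u) * P"
    proof -
      have "u powr e * u powr (- real k / 2) * u powr (b - 1) = u powr (- g - 1)"
        using u e by (simp flip: powr_add)
      moreover have "exp (- q / u) * exp (- a / u) = exp (- (q + a) / u)"
        by (simp add: add_divide_distrib diff_divide_distrib flip: exp_add)
      ultimately have "u powr e * u powr (- real k / 2) * exp (- q / u) * (u powr (b - 1) * exp (- a / u)) = F u"
        unfolding F_def by (metis (no_types, opaque_lifting) mult.assoc mult.left_commute)
      then show ?thesis by (simp add: mult.assoc[symmetric] ennreal_mult[symmetric])
    qed
    finally show ?thesis using u by simp
  qed
  have "(\<integral>\<^sup>+u. ennreal (F u) * indicator {0<..} u * P \<partial>lborel) = (\<integral>\<^sup>+u. ennreal (F u) * indicator {0<..} u \<partial>lborel) * P"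
    by (rule nn_integral_multc) measurable
  also have "(\<integral>\<^sup>+u. ennreal (F u) * indicator {0<..} u \<partial>lborel) = (\<integral>\<^sup>+x. ennreal (F (1 / x) / x\<^sup>2) * indicator {0<..} x \<partial>lborel)"
    by (rule nn_integral_inverse_substitution) measurable
  also have "\<dots> = (\<integral>\<^sup>+x. ennreal (x powr (g - 1) * exp (- (q + a) * x)) * indicator {0<..} x \<partial>lborel)"
  proof (intro nn_integral_cong)
    fix x :: real
    have "F (1 / x) / x\<^sup>2 = x powr (g - 1) * exp (- (q + a) * x)" if "x > 0"
      using that by (simp add: F_def powr_divide powr_minus_divide powr_diff power2_eq_square)
    then show "ennreal (F (1 / x) / x\<^sup>2) * indicator {0<..} x = ennreal (x powr (g - 1) * exp (- (q + a) * x)) * indicator {0<..} x"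
      by (auto split: split_indicator)
  qed
  also have "\<dots> = ennreal (Gamma g) * inv_powr (q + a) g"
    by (rule nn_integral_Gamma_mixture) (use g a q in auto)
  finally show ?thesis
    unfolding inner using Gamma_real_pos[OF b] Gamma_real_pos[OF g] by (simp add: P_def ennreal_mult mult_ac)
qed

text \<open>In the application \<open>B1\<close> spans the other columns and \<open>B2\<close> their
  orthogonal complement. After the heat flow has shifted both widths, the density is replaced by its
  larger value at the shifted point, and translation invariance of the integral over (u, w) restores
  the original mixture.\<close>

lemma heat_kernel_inv_powr_le:
  fixes B1 B2 :: "'a::euclidean_space set"
  assumes orth: "pairwise orthogonal (B1 \<union> B2)" and nrm: "\<And>b. b \<in> B1 \<union> B2 \<Longrightarrow> norm b = 1"
    and span: "span (B1 \<union> B2) = UNIV" and card: "card (B1 \<union> B2) = DIM('a)" and disj: "B1 \<inter> B2 = {}"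
    and b: "b > 0" "real (card B2) / 2 = b + 1" and g: "g > 0" "b + g \<le> real (card B1) / 2" and s: "s > 0"
  defines "f \<equiv> \<lambda>x::'a. inv_powr (\<Sum>v\<in>B2. (x \<bullet> v)\<^sup>2) b * inv_powr ((norm x)\<^sup>2) g"
  shows "(\<integral>\<^sup>+z. ennreal (heat_kernel s z) * f (x + z) \<partial>lborel) \<le> f x"
proof -
  have fin: "finite (B1 \<union> B2)" using card card.infinite[of "B1 \<union> B2"] by (metis DIM_positive less_numeral_extra(3))
  then have fin1: "finite B1" and fin2: "finite B2" by auto
  define k d where "k = card B1" and "d = card B2"
  define e where "e = real k / 2 - b - g"
  \<comment> \<open>The only use of the upper bound on \<open>g\<close>.\<close>
  have e: "e \<ge> 0" using g by (simp add: e_def k_def)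
  define q where "q x = (\<Sum>v\<in>B1. (x \<bullet> v)\<^sup>2)" for x
  define a where "a x = (\<Sum>v\<in>B2. (x \<bullet> v)\<^sup>2)" for x
  have qa: "q x \<ge> 0" "a x \<ge> 0" for x by (auto simp: q_def a_def intro!: sum_nonneg)
  have [measurable]: "q \<in> borel_measurable borel" "a \<in> borel_measurable borel" unfolding q_def a_def by measurable
  have nx: "(norm x)\<^sup>2 = q x + a x" for x
  proof -
    have "x = (\<Sum>v\<in>B1 \<union> B2. (x \<bullet> v) *\<^sub>R v)" using span by (intro span_orthonormal_expansion fin orth nrm) auto
    then have "(norm x)\<^sup>2 = (\<Sum>v\<in>B1 \<union> B2. (x \<bullet> v)\<^sup>2)"
      using norm_sum_orthonormal[OF fin orth nrm, of "\<lambda>v. x \<bullet> v"] by simp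
    then show ?thesis by (simp add: q_def a_def sum.union_disjoint fin1 fin2 disj)
  qed
  \<comment> \<open>The root factors normalise the Gaussian up to a power of pi. With them the heat
    flow produces no extra factor but moves \<open>u\<close> and \<open>w\<close> to
    \<open>u + 2 * s\<close> and \<open>w + 2 * s\<close>.\<close>
  define G where "G u w x = (1 / sqrt u) ^ k * (1 / sqrt w) ^ d * exp (- q x / u) * exp (- a x / w)" for u w and x :: 'a
  define h where "h u w = ennreal (u powr e * (u - w) powr (b - 1)) * indicator {w. 0 < w \<and> w < u} w" for u w
  have [measurable]: "(\<lambda>(u, w). h u w) \<in> borel_measurable (borel \<Otimes>\<^sub>M borel)"
    unfolding h_def indicator_def by measurable
  have [measurable]: "(\<lambda>(u, w, x). G u w x) \<in> borel_measurable (borel \<Otimes>\<^sub>M borel \<Otimes>\<^sub>M borel)"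
    unfolding G_def by measurable
  have G0: "G u w x \<ge> 0" if "u > 0" "w > 0" for u w x using that by (simp add: G_def)
  define J where "J x = (\<integral>\<^sup>+u. (\<integral>\<^sup>+w. h u w * ennreal (G u w x) \<partial>lborel) \<partial>lborel)" for x
  define c where "c = ennreal (Gamma b * Gamma g)"
  have c: "c \<noteq> 0" "c \<noteq> top" using Gamma_real_pos[OF b(1)] Gamma_real_pos[OF g(1)] by (auto simp: c_def)
  have J: "J x = c * f x" for x
  proof -
    have "J x = (\<integral>\<^sup>+u. (\<integral>\<^sup>+w. ennreal (u powr e * (u - w) powr (b - 1) * ((1 / sqrt u) ^ k * (1 / sqrt w) ^ d * exp (- q x / u) * exp (- a x / w)))
        * indicator {0<..<u} w \<partial>lborel) \<partial>lborel)"
      unfolding J_def by (intro nn_integral_cong) (auto simp: h_def G_def ennreal_mult[symmetric] split: split_indicator)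
    also have "\<dots> = c * (inv_powr (a x) b * inv_powr (q x + a x) g)"
      unfolding c_def by (intro nn_integral_mixture) (use b g qa in \<open>auto simp: d_def e_def\<close>)
    finally show ?thesis by (simp add: f_def a_def nx)
  qed
  have heatG: "(\<integral>\<^sup>+z. ennreal (heat_kernel s z) * ennreal (G u w (x + z)) \<partial>lborel) = ennreal (G (u + 2 * s) (w + 2 * s) x)"
    if uw: "u > 0" "w > 0" for u w
  proof -
    define U where "U v = (if v \<in> B1 then u else w)" for v
    have U1: "(\<Prod>v\<in>B1 \<union> B2. F v (U v)) = (\<Prod>v\<in>B1. F v u) * (\<Prod>v\<in>B2. F v w)" for F :: "'a \<Rightarrow> real \<Rightarrow> real"
    proof -
      have "(\<Prod>v\<in>B1 \<union> B2. F v (U v)) = (\<Prod>v\<in>B1. F v (U v)) * (\<Prod>v\<in>B2. F v (U v))"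
        by (rule prod.union_disjoint[OF fin1 fin2 disj])
      also have "(\<Prod>v\<in>B1. F v (U v)) = (\<Prod>v\<in>B1. F v u)" by (simp add: U_def)
      also have "(\<Prod>v\<in>B2. F v (U v)) = (\<Prod>v\<in>B2. F v w)" using disj by (intro prod.cong) (auto simp: U_def)
      finally show ?thesis .
    qed
    have expq: "(\<Prod>v\<in>B1. exp (- (y \<bullet> v)\<^sup>2 / t)) = exp (- q y / t)" "(\<Prod>v\<in>B2. exp (- (y \<bullet> v)\<^sup>2 / t)) = exp (- a y / t)" for y t
      by (simp_all add: q_def a_def sum_divide_distrib sum_negf fin1 fin2 flip: exp_sum)
    have "(\<integral>\<^sup>+z. ennreal (heat_kernel s z) * ennreal (G u w (x + z)) \<partial>lborel)
       = (\<integral>\<^sup>+z. ennreal ((1 / sqrt u) ^ k * (1 / sqrt w) ^ d) * ennreal (heat_kernel s z * (\<Prod>v\<in>B1 \<union> B2. exp (- ((x + z) \<bullet> v)\<^sup>2 / U v))) \<partial>lborel)"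
    proof (intro nn_integral_cong)
      fix z
      have "(\<Prod>v\<in>B1 \<union> B2. exp (- ((x + z) \<bullet> v)\<^sup>2 / U v)) = exp (- q (x + z) / u) * exp (- a (x + z) / w)"
        by (subst U1[of "\<lambda>v t. exp (- ((x + z) \<bullet> v)\<^sup>2 / t)"]) (simp only: expq)
      then show "ennreal (heat_kernel s z) * ennreal (G u w (x + z)) =
        ennreal ((1 / sqrt u) ^ k * (1 / sqrt w) ^ d) * ennreal (heat_kernel s z * (\<Prod>v\<in>B1 \<union> B2. exp (- ((x + z) \<bullet> v)\<^sup>2 / U v)))"
        using s uw by (simp add: G_def ennreal_mult[symmetric] mult_ac)
    qed
    also have "\<dots> = ennreal ((1 / sqrt u) ^ k * (1 / sqrt w) ^ d) * ennreal (\<Prod>v\<in>B1 \<union> B2. sqrt (U v / (U v + 2 * s)) * exp (- (x \<bullet> v)\<^sup>2 / (U v + 2 * s)))"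
      using heat_kernel_orthonormal_gaussian[OF orth nrm span card s, of U x] uw
      by (subst nn_integral_cmult) (auto simp: U_def)
    also have "(\<Prod>v\<in>B1 \<union> B2. sqrt (U v / (U v + 2 * s)) * exp (- (x \<bullet> v)\<^sup>2 / (U v + 2 * s)))
       = sqrt (u / (u + 2 * s)) ^ k * exp (- q x / (u + 2 * s)) * (sqrt (w / (w + 2 * s)) ^ d * exp (- a x / (w + 2 * s)))"
      by (subst U1[of "\<lambda>v t. sqrt (t / (t + 2 * s)) * exp (- (x \<bullet> v)\<^sup>2 / (t + 2 * s))"])
         (simp only: prod.distrib expq prod_constant k_def d_def)
    also have "ennreal ((1 / sqrt u) ^ k * (1 / sqrt w) ^ d) * ennreal \<dots> = ennreal (G (u + 2 * s) (w + 2 * s) x)"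
    proof -
      have root: "(1 / sqrt t) ^ m * sqrt (t / (t + 2 * s)) ^ m = (1 / sqrt (t + 2 * s)) ^ m" if "t > 0" for t and m :: nat
        using that s by (simp add: real_sqrt_divide flip: power_mult_distrib)
      have "(1 / sqrt u) ^ k * (1 / sqrt w) ^ d * (sqrt (u / (u + 2 * s)) ^ k * exp (- q x / (u + 2 * s)) * (sqrt (w / (w + 2 * s)) ^ d * exp (- a x / (w + 2 * s))))
         = ((1 / sqrt u) ^ k * sqrt (u / (u + 2 * s)) ^ k) * ((1 / sqrt w) ^ d * sqrt (w / (w + 2 * s)) ^ d) * exp (- q x / (u + 2 * s)) * exp (- a x / (w + 2 * s))"
        by (simp only: mult_ac)
      also have "\<dots> = G (u + 2 * s) (w + 2 * s) x"
        by (simp only: root[OF uw(1)] root[OF uw(2)] G_def)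
      finally have "(1 / sqrt u) ^ k * (1 / sqrt w) ^ d * (sqrt (u / (u + 2 * s)) ^ k * exp (- q x / (u + 2 * s)) * (sqrt (w / (w + 2 * s)) ^ d * exp (- a x / (w + 2 * s))))
         = G (u + 2 * s) (w + 2 * s) x" .
      then show ?thesis using uw s by (simp add: ennreal_mult[symmetric])
    qed
    finally show ?thesis .
  qed
  \<comment> \<open>The difference u - w is unchanged and the region 0 < w < u is mapped into
    itself, so only the factor \<open>u powr e\<close> can change, and it grows.\<close>
  have h_mono: "h u w \<le> h (u + 2 * s) (w + 2 * s)" for u w
    using s e by (auto simp: h_def split: split_indicator intro!: ennreal_leI mult_right_mono powr_mono2)
  have "(\<integral>\<^sup>+z. ennreal (heat_kernel s z) * J (x + z) \<partial>lborel)
     = (\<integral>\<^sup>+z. (\<integral>\<^sup>+u. (\<integral>\<^sup>+w. h u w * (ennreal (heat_kernel s z) * ennreal (G u w (x + z))) \<partial>lborel) \<partial>lborel) \<partial>lborel)"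
  proof (rule nn_integral_cong)
    fix z
    have "(\<integral>\<^sup>+w. h u w * (ennreal (heat_kernel s z) * ennreal (G u w (x + z))) \<partial>lborel)
        = ennreal (heat_kernel s z) * (\<integral>\<^sup>+w. h u w * ennreal (G u w (x + z)) \<partial>lborel)" for u
      by (subst nn_integral_cmult[symmetric]) (auto simp: mult_ac)
    then show "ennreal (heat_kernel s z) * J (x + z)
        = (\<integral>\<^sup>+u. (\<integral>\<^sup>+w. h u w * (ennreal (heat_kernel s z) * ennreal (G u w (x + z))) \<partial>lborel) \<partial>lborel)"
      unfolding J_def G_def by (simp only:) (rule nn_integral_cmult[symmetric], measurable)
  qed
  also have "\<dots> = (\<integral>\<^sup>+u. (\<integral>\<^sup>+z. (\<integral>\<^sup>+w. h u w * (ennreal (heat_kernel s z) * ennreal (G u w (x + z))) \<partial>lborel) \<partial>lborel) \<partial>lborel)"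
    unfolding G_def by (rule lborel_pair.Fubini') measurable
  also have "\<dots> = (\<integral>\<^sup>+u. (\<integral>\<^sup>+w. (\<integral>\<^sup>+z. h u w * (ennreal (heat_kernel s z) * ennreal (G u w (x + z))) \<partial>lborel) \<partial>lborel) \<partial>lborel)"
    unfolding G_def by (rule nn_integral_cong, rule lborel_pair.Fubini') measurable
  \<comment> \<open>The one inequality of the argument. The shifted density and the shifted Gaussian
    now have the same arguments, so that the two changes of variable below can remove the
    shift.\<close>
  also have "\<dots> \<le> (\<integral>\<^sup>+u. (\<integral>\<^sup>+w. h (2 * s + 1 * u) (2 * s + 1 * w) * ennreal (G (2 * s + 1 * u) (2 * s + 1 * w) x) \<partial>lborel) \<partial>lborel)"
  proof (intro nn_integral_mono)
    fix u w :: real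
    have "(\<integral>\<^sup>+z. h u w * (ennreal (heat_kernel s z) * ennreal (G u w (x + z))) \<partial>lborel)
        = h u w * (\<integral>\<^sup>+z. ennreal (heat_kernel s z) * ennreal (G u w (x + z)) \<partial>lborel)"
      by (rule nn_integral_cmult) measurable
    also have "\<dots> = h u w * ennreal (G (u + 2 * s) (w + 2 * s) x)"
      using heatG[of u w] by (cases "0 < w \<and> w < u") (auto simp: h_def)
    also have "\<dots> \<le> h (u + 2 * s) (w + 2 * s) * ennreal (G (u + 2 * s) (w + 2 * s) x)"
      by (intro mult_right_mono h_mono) simp
    finally show "(\<integral>\<^sup>+z. h u w * (ennreal (heat_kernel s z) * ennreal (G u w (x + z))) \<partial>lborel)
      \<le> h (2 * s + 1 * u) (2 * s + 1 * w) * ennreal (G (2 * s + 1 * u) (2 * s + 1 * w) x)" by (simp add: add.commute)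
  qed
  also have "\<dots> = (\<integral>\<^sup>+u. (\<integral>\<^sup>+w. h (2 * s + 1 * u) w * ennreal (G (2 * s + 1 * u) w x) \<partial>lborel) \<partial>lborel)"
  proof (rule nn_integral_cong)
    fix u
    show "(\<integral>\<^sup>+w. h (2 * s + 1 * u) (2 * s + 1 * w) * ennreal (G (2 * s + 1 * u) (2 * s + 1 * w) x) \<partial>lborel)
      = (\<integral>\<^sup>+w. h (2 * s + 1 * u) w * ennreal (G (2 * s + 1 * u) w x) \<partial>lborel)"
      using nn_integral_real_affine[of "\<lambda>w. h (2 * s + 1 * u) w * ennreal (G (2 * s + 1 * u) w x)" 1 "2 * s"] by simp
  qed
  also have "\<dots> = J x"
    unfolding J_def
    using nn_integral_real_affine[of "\<lambda>u. \<integral>\<^sup>+w. h u w * ennreal (G u w x) \<partial>lborel" 1 "2 * s"]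
    by (simp add: G_def)
  finally have "(\<integral>\<^sup>+z. ennreal (heat_kernel s z) * (c * f (x + z)) \<partial>lborel) \<le> c * f x" by (simp only: J)
  moreover have "(\<integral>\<^sup>+z. ennreal (heat_kernel s z) * (c * f (x + z)) \<partial>lborel) = c * (\<integral>\<^sup>+z. ennreal (heat_kernel s z) * f (x + z) \<partial>lborel)"
    unfolding f_def inv_powr_def by (subst nn_integral_cmult[symmetric]) (auto simp: mult_ac)
  ultimately show ?thesis
    using c by (simp add: ennreal_mult_le_mult_iff)
qed

section \<open>The prior as a function of one column\<close>

lemma span_image_finite_sum:
  fixes c :: "'i \<Rightarrow> 'v::real_vector"
  assumes "finite S" "y \<in> span (c ` S)"
  shows "\<exists>\<alpha>. y = (\<Sum>j\<in>S. \<alpha> j *\<^sub>R c j)"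
proof -
  let ?U = "range (\<lambda>\<alpha>. \<Sum>j\<in>S. \<alpha> j *\<^sub>R c j)"
  have "subspace ?U"
  proof (rule subspaceI)
    show "0 \<in> ?U" by (intro image_eqI[of _ _ "\<lambda>_. 0"]) auto
  next
    fix x y assume "x \<in> ?U" "y \<in> ?U"
    then obtain \<alpha> \<beta> where "x = (\<Sum>j\<in>S. \<alpha> j *\<^sub>R c j)" "y = (\<Sum>j\<in>S. \<beta> j *\<^sub>R c j)" by auto
    then show "x + y \<in> ?U"
      by (intro image_eqI[of _ _ "\<lambda>j. \<alpha> j + \<beta> j"]) (auto simp: scaleR_add_left sum.distrib)
  next
    fix r :: real and x assume "x \<in> ?U"
    then obtain \<alpha> where "x = (\<Sum>j\<in>S. \<alpha> j *\<^sub>R c j)" by auto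
    then show "r *\<^sub>R x \<in> ?U"
      by (intro image_eqI[of _ _ "\<lambda>j. r * \<alpha> j"]) (auto simp: scaleR_sum_right)
  qed
  moreover have "c ` S \<subseteq> ?U"
  proof
    fix x assume "x \<in> c ` S"
    then obtain i where i: "i \<in> S" "x = c i" by auto
    have "(\<Sum>j\<in>S. (if j = i then 1 else 0) *\<^sub>R c j) = (\<Sum>j\<in>S. if j = i then c i else 0)"
      by (intro sum.cong) auto
    then show "x \<in> ?U" using i \<open>finite S\<close> by (intro image_eqI[of _ _ "\<lambda>j. if j = i then 1 else 0"]) auto
  qed
  ultimately have "span (c ` S) \<subseteq> ?U" by (rule span_minimal[rotated])
  then show ?thesis using assms(2) by auto
qed

lemma det_row_eliminate:
  fixes A :: "real^'m^'m"
  assumes "row i A = r + (\<Sum>j\<in>- {i}. \<alpha> j *s row j A)"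
  shows "det A = det (\<chi> j. if j = i then r else row j A)"
proof -
  define B :: "real^'m^'m" where "B = (\<chi> j. if j = i then r else row j A)"
  have rowB: "row j B = (if j = i then r else row j A)" for j by (simp add: B_def row_def vec_eq_iff)
  have "(\<Sum>j\<in>- {i}. \<alpha> j *s row j A) \<in> vec.span {row j B |j. j \<noteq> i}"
    by (intro vec.span_sum vec.span_scale vec.span_base) (auto simp: rowB)
  then have "det (\<chi> k. if k = i then row i B + (\<Sum>j\<in>- {i}. \<alpha> j *s row j A) else row k B) = det B"
    by (rule det_row_span)
  moreover have "(\<chi> k. if k = i then row i B + (\<Sum>j\<in>- {i}. \<alpha> j *s row j A) else row k B) = A"
  proof -
    have "(if k = i then row i B + (\<Sum>j\<in>- {i}. \<alpha> j *s row j A) else row k B) = row k A" for k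
      using assms by (simp add: rowB)
    then show ?thesis by (simp add: vec_eq_iff row_def)
  qed
  ultimately show ?thesis by (simp add: B_def)
qed

text \<open>Subtracting from row i the combination of the other rows that expresses \<open>y\<close>
  leaves the products of \<open>z\<close> with the vectors, which vanish off the diagonal. In the
  remaining column i the products with \<open>c i\<close> equal those with \<open>y\<close>, since
  \<open>z\<close> is orthogonal to the other vectors, and the same coefficients clear it. The
  matrix on the right is the Gram matrix of the other vectors, padded by a unit row and column so as
  to keep its size.\<close>

lemma det_gram_eq:
  fixes c :: "'m::finite \<Rightarrow> 'v::real_inner"
  assumes y: "y \<in> span (c ` (- {i}))" and z: "\<And>x. x \<in> span (c ` (- {i})) \<Longrightarrow> x \<bullet> z = 0"
    and ci: "c i = y + z"
  shows "det ((\<chi> j k. c j \<bullet> c k) :: real^'m^'m)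
    = (z \<bullet> z) * det ((\<chi> j k. if j = i \<and> k = i then 1 else if j = i \<or> k = i then 0 else c j \<bullet> c k) :: real^'m^'m)"
proof -
  obtain \<alpha> where \<alpha>: "y = (\<Sum>j\<in>- {i}. \<alpha> j *\<^sub>R c j)"
    using span_image_finite_sum[OF _ y] by auto
  have z0: "c j \<bullet> z = 0" "z \<bullet> c j = 0" if "j \<noteq> i" for j
    using z[of "c j"] that by (auto simp: span_base inner_commute)
  have zi: "z \<bullet> c i = z \<bullet> z" using z[OF y] by (simp add: ci inner_add_right inner_commute)
  let ?A = "(\<chi> j k. c j \<bullet> c k) :: real^'m^'m"
  have rowA: "row j ?A $ k = c j \<bullet> c k" for j k by (simp add: row_def)
  have zrow: "z \<bullet> c k = (if k = i then z \<bullet> z else 0)" for k using z0[of k] zi by auto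
  have "row i ?A = (z \<bullet> z) *s axis i 1 + (\<Sum>j\<in>- {i}. \<alpha> j *s row j ?A)"
    unfolding vec_eq_iff
  proof
    fix k
    have "row i ?A $ k = z \<bullet> c k + y \<bullet> c k"
      by (simp add: rowA) (simp add: ci inner_add_left)
    also have "y \<bullet> c k = (\<Sum>j\<in>- {i}. \<alpha> j *s row j ?A) $ k"
      by (simp add: \<alpha> inner_sum_left rowA)
    also have "z \<bullet> c k = ((z \<bullet> z) *s axis i 1 :: real^'m) $ k"
      using zrow[of k] by (simp add: axis_def)
    finally show "row i ?A $ k = ((z \<bullet> z) *s axis i 1 + (\<Sum>j\<in>- {i}. \<alpha> j *s row j ?A)) $ k"
      by simp
  qed
  then have "det ?A = det (\<chi> j. if j = i then (z \<bullet> z) *s axis i 1 else row j ?A)"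
    by (rule det_row_eliminate)
  also have "\<dots> = (z \<bullet> z) * det (\<chi> j. if j = i then axis i 1 else row j ?A)"
    by (rule det_row_mul)
  also have "det (\<chi> j. if j = i then axis i 1 else row j ?A) = det (transpose (\<chi> j. if j = i then axis i 1 else row j ?A))"
    by (rule det_transpose[symmetric])
  also have "\<dots> = det (\<chi> j k. if j = i \<and> k = i then 1 else if j = i \<or> k = i then 0 else c j \<bullet> c k)"
  proof -
    define C where "C = transpose (\<chi> j. if j = i then axis i 1 else row j ?A)"
    have rowC: "row j C $ k = (if k = i then axis i 1 $ j else c k \<bullet> c j)" for j k
      by (simp add: C_def row_def transpose_def)
    have yci: "c k \<bullet> c i = c k \<bullet> y" if "k \<noteq> i" for k
      using z0[OF that] by (simp add: ci inner_add_right)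
    have "row i C = axis i 1 + (\<Sum>j\<in>- {i}. \<alpha> j *s row j C)"
      unfolding vec_eq_iff
    proof
      fix k
      show "row i C $ k = (axis i 1 + (\<Sum>j\<in>- {i}. \<alpha> j *s row j C)) $ k"
      proof (cases "k = i")
        case True
        then show ?thesis by (simp add: rowC axis_def sum.neutral)
      next
        case False
        then show ?thesis by (simp add: rowC yci \<alpha> inner_sum_right axis_def)
      qed
    qed
    then have "det C = det (\<chi> j. if j = i then axis i 1 else row j C)"
      by (rule det_row_eliminate)
    also have "(\<chi> j. if j = i then axis i 1 else row j C) = (\<chi> j k. if j = i \<and> k = i then 1 else if j = i \<or> k = i then 0 else c j \<bullet> c k)"
      by (auto simp: vec_eq_iff rowC axis_def inner_commute)
    finally show ?thesis by (simp only: C_def)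
  qed
  finally show ?thesis .
qed

section \<open>Moving a single column of the matrix\<close>

definition col_embed :: "'p::finite \<Rightarrow> real^'n \<Rightarrow> real^'p^'n" where
  "col_embed i x = (\<chi> a j. if j = i then x $ a else 0)"

lemma column_col_embed: "column j (M + col_embed i x) = (if j = i then column i M + x else column j M)"
  by (auto simp: column_def col_embed_def vec_eq_iff)

lemma gram_eq: "transpose M ** M = (\<chi> j k. column j M \<bullet> column k M)" for M :: "real^'p::finite^'n::finite"
  by (simp add: vec_eq_iff matrix_matrix_mult_def transpose_def column_def inner_vec_def)

text \<open>The prior has the junk value \<open>0\<close> on rank-deficient matrices; here they get the value \<open>\<infinity>\<close>, so that the
  heat flow inequality holds everywhere. That they form a null set then follows from the finiteness of the marginal.\<close>

definition msvs2_ext :: "real \<Rightarrow> real^'p^'n \<Rightarrow> ennreal" where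
  "msvs2_ext \<gamma> M = (if det (transpose M ** M) > 0 then ennreal (msvs2_prior \<gamma> M) else \<infinity>)"

lemma inj_matrix_vector_of_det_gram:
  fixes M :: "real^'p::finite^'n::finite"
  assumes "det (transpose M ** M) \<noteq> 0"
  shows "inj ((*v) M)"
proof -
  have "invertible (transpose M ** M)" using assms by (simp add: invertible_det_nz)
  then obtain B where B: "B ** (transpose M ** M) = mat 1" by (auto simp: invertible_def)
  have "(B ** transpose M) *v (M *v x) = x" for x
    using B by (simp add: matrix_vector_mul_assoc matrix_mul_assoc)
  then show ?thesis by (metis injI)
qed

text \<open>The columns are images of distinct unit vectors under an injective map. Applied to all
  columns but one it gives the dimension of their span, and applied to a singleton it shows that no
  column vanishes.\<close>

lemma dim_columns_of_det_gram:
  fixes M :: "real^'p::finite^'n::finite"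
  assumes "det (transpose M ** M) \<noteq> 0"
  shows "dim ((\<lambda>j. column j M) ` J) = card J"
proof -
  have "(\<lambda>j. column j M) ` J = (*v) M ` ((\<lambda>j. axis j 1) ` J)"
    by (simp add: image_image matrix_vector_mult_basis)
  then have "dim ((\<lambda>j. column j M) ` J) = dim ((\<lambda>j. axis j (1::real)) ` J)"
    using inj_matrix_vector_of_det_gram[OF assms] by (simp add: dim_image_eq inj_on_subset)
  also have "\<dots> = card ((\<lambda>j. axis j (1::real)) ` J)"
    by (intro dim_eq_card_independent independent_mono[OF independent_Basis]) (auto simp: axis_in_Basis_iff)
  also have "\<dots> = card J"
    by (intro card_image) (auto simp: inj_on_def axis_eq_axis)
  finally show ?thesis .
qed

text \<open>If the Gram determinant is not positive, the right side is infinite. Otherwise the other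
  columns are independent and do not move with z, so their span and its orthonormal bases can be
  fixed once; the prior then becomes a constant times the product of powers treated above.\<close>

lemma heat_kernel_col_embed_le:
  fixes M :: "real^'p::finite^'n::finite"
  assumes np: "CARD('p) + 2 \<le> CARD('n)" and \<gamma>: "0 < \<gamma>" "\<gamma> \<le> - real CARD('n) + 2 * real CARD('p)"
    and s: "s > 0"
  shows "(\<integral>\<^sup>+z. ennreal (heat_kernel s z) * msvs2_ext \<gamma> (M + col_embed i z) \<partial>lborel) \<le> msvs2_ext \<gamma> M"
proof (cases "det (transpose M ** M) > 0")
  case False
  then show ?thesis by (simp add: msvs2_ext_def)
next
  case pos: True
  define c where "c j = column j M" for j
  define W where "W = span (c ` (- {i}))"
  have W: "subspace W" by (simp add: W_def)
  have dimW: "dim W = CARD('p) - 1"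
    using dim_columns_of_det_gram[of M "- {i}"] pos by (simp add: W_def c_def[abs_def] Compl_eq_Diff_UNIV)
  obtain B1 where B1: "B1 \<subseteq> W" "pairwise orthogonal B1" "\<And>x. x \<in> B1 \<Longrightarrow> norm x = 1" "independent B1"
      "card B1 = dim W" "span B1 = W"
    using orthonormal_basis_subspace[OF W] by blast
  define V where "V = {y. \<forall>x\<in>W. orthogonal x y}"
  have V: "subspace V" unfolding V_def by (rule subspace_orthogonal_to_vectors)
  have "dim V + dim W = CARD('n)"
    using dim_subspace_orthogonal_to_vectors[OF W subspace_UNIV] by (simp add: V_def)
  then have dimV: "dim V = CARD('n) - CARD('p) + 1" using dimW np by simp
  obtain B2 where B2: "B2 \<subseteq> V" "pairwise orthogonal B2" "\<And>x. x \<in> B2 \<Longrightarrow> norm x = 1" "independent B2"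
      "card B2 = dim V" "span B2 = V"
    using orthonormal_basis_subspace[OF V] by blast
  have WV: "x \<bullet> y = 0" if "x \<in> W" "y \<in> V" for x y using that by (auto simp: V_def orthogonal_def)
  have fin: "finite B1" "finite B2" using B1(4) B2(4) by (auto intro: independent_imp_finite)
  have disj: "B1 \<inter> B2 = {}"
  proof (rule ccontr)
    assume "B1 \<inter> B2 \<noteq> {}"
    then obtain x where "x \<in> B1" "x \<in> B2" by auto
    then have "x \<bullet> x = 0" using WV[of x x] B1(1) B2(1) by auto
    then show False using B1(3)[OF \<open>x \<in> B1\<close>] by simp
  qed
  have orth: "pairwise orthogonal (B1 \<union> B2)"
  proof -
    have "y \<bullet> x = 0" if "x \<in> W" "y \<in> V" for x y using WV[OF that] by (simp add: inner_commute)
    then show ?thesis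
      using B1(1,2) B2(1,2) WV by (auto simp: pairwise_def orthogonal_def subset_iff)
  qed
  have nrm: "norm x = 1" if "x \<in> B1 \<union> B2" for x using that B1(3) B2(3) by auto
  have card: "card (B1 \<union> B2) = DIM(real^'n)"
    using card_Un_disjoint[OF fin disj] B1(5) B2(5) dimW dimV np by simp
  have indep: "independent (B1 \<union> B2)"
    using orth nrm[of 0] by (intro pairwise_orthogonal_independent) auto
  have span: "span (B1 \<union> B2) = UNIV"
    using card indep by (metis dim_eq_card_independent dim_eq_full)
  \<comment> \<open>\<open>a x\<close> is the squared distance of x from the span of the other
    columns, and \<open>D\<close> is the Gram determinant of those columns. Their product is the
    full Gram determinant, and only the first factor depends on z.\<close>
  define a where "a x = (\<Sum>v\<in>B2. (x \<bullet> v)\<^sup>2)" for x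
  define D where "D = det ((\<chi> j k. if j = i \<and> k = i then 1 else if j = i \<or> k = i then 0 else c j \<bullet> c k) :: real^'p^'p)"
  have det_eq: "det (transpose (M + col_embed i z) ** (M + col_embed i z)) = a (c i + z) * D" for z
  proof -
    define x where "x = c i + z"
    define c' where "c' j = (if j = i then x else c j)" for j
    define r where "r = (\<Sum>v\<in>B2. (x \<bullet> v) *\<^sub>R v)"
    define y where "y = (\<Sum>v\<in>B1. (x \<bullet> v) *\<^sub>R v)"
    have cc: "c' ` (- {i}) = c ` (- {i})" by (auto simp: c'_def)
    have "det ((\<chi> j k. c' j \<bullet> c' k) :: real^'p^'p)
      = (r \<bullet> r) * det ((\<chi> j k. if j = i \<and> k = i then 1 else if j = i \<or> k = i then 0 else c' j \<bullet> c' k) :: real^'p^'p)"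
    proof (rule det_gram_eq[where y=y])
      show "y \<in> span (c' ` (- {i}))"
        unfolding cc W_def[symmetric] y_def using W B1(1) by (auto intro!: subspace_sum subspace_scale)
      have "r \<in> V" unfolding r_def using V B2(1) by (auto intro!: subspace_sum subspace_scale)
      then show "w \<bullet> r = 0" if "w \<in> span (c' ` (- {i}))" for w
        using that WV unfolding cc W_def[symmetric] by auto
      have "x = (\<Sum>v\<in>B1 \<union> B2. (x \<bullet> v) *\<^sub>R v)"
        using span fin by (intro span_orthonormal_expansion orth nrm) auto
      then show "c' i = y + r" by (simp add: c'_def y_def r_def sum.union_disjoint fin disj)
    qed
    also have "r \<bullet> r = a x"
      using norm_sum_orthonormal[OF fin(2) B2(2,3), of "\<lambda>v. x \<bullet> v"] by (simp add: r_def a_def power2_norm_eq_inner)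
    also have "((\<chi> j k. if j = i \<and> k = i then 1 else if j = i \<or> k = i then 0 else c' j \<bullet> c' k) :: real^'p^'p)
       = (\<chi> j k. if j = i \<and> k = i then 1 else if j = i \<or> k = i then 0 else c j \<bullet> c k)"
      by (auto simp: vec_eq_iff c'_def)
    also have "((\<chi> j k. c' j \<bullet> c' k) :: real^'p^'p) = transpose (M + col_embed i z) ** (M + col_embed i z)"
      unfolding gram_eq column_col_embed c'_def c_def x_def by (simp add: vec_eq_iff)
    finally show ?thesis by (simp add: D_def x_def)
  qed
  have a0: "a x \<ge> 0" for x by (auto simp: a_def intro!: sum_nonneg)
  \<comment> \<open>Since \<open>D\<close> does not involve column i, its sign can be read off at z
    = 0.\<close>
  have "M + col_embed i 0 = M" by (simp add: col_embed_def vec_eq_iff)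
  then have "a (c i) * D > 0" using det_eq[of 0] pos by simp
  then have D: "D > 0" using a0[of "c i"] by (simp add: zero_less_mult_iff)
  define b where "b = (real CARD('n) - real CARD('p) - 1) / 2"
  have b: "b > 0" using np by (simp add: b_def)
  define f where "f x = inv_powr (\<Sum>v\<in>B2. (x \<bullet> v)\<^sup>2) b * inv_powr ((norm x)\<^sup>2) (\<gamma> / 2)" for x
  define K where "K = D powr (- b) * (\<Prod>j\<in>- {i}. norm (c j) powr (- \<gamma>))"
  have cnz: "c j \<noteq> 0" for j
    using dim_columns_of_det_gram[of M "{j}"] pos by (auto simp: c_def)
  have K: "K > 0" unfolding K_def using D cnz by (intro mult_pos_pos prod_pos) auto
  \<comment> \<open>Where \<open>a\<close> vanishes the matrix is rank deficient and both sides are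
    infinite; this is the case for which the extended prior and \<open>inv_powr\<close> agree by
    convention.\<close>
  have ext: "msvs2_ext \<gamma> (M + col_embed i z) = ennreal K * f (c i + z)" for z
  proof (cases "a (c i + z) = 0")
    case True
    have "inv_powr ((norm (c i + z))\<^sup>2) (\<gamma> / 2) \<noteq> 0" by (simp add: inv_powr_def)
    then show ?thesis using True K det_eq[of z]
      by (simp add: msvs2_ext_def f_def a_def[symmetric] inv_powr_def ennreal_mult_top ennreal_top_mult)
  next
    case False
    define x where "x = c i + z"
    have a: "a x > 0" using False a0[of x] by (simp add: x_def)
    have x: "x \<noteq> 0" using a by (auto simp: a_def)
    have "det (transpose (M + col_embed i z) ** (M + col_embed i z)) = a x * D" by (simp add: det_eq x_def)
    then have d: "det (transpose (M + col_embed i z) ** (M + col_embed i z)) powr (- (real CARD('n) - real CARD('p) - 1) / 2)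
        = a x powr (- b) * D powr (- b)"
    proof -
      have "- (real CARD('n) - real CARD('p) - 1) / 2 = - b" by (simp only: b_def minus_divide_left)
      moreover assume "det (transpose (M + col_embed i z) ** (M + col_embed i z)) = a x * D"
      ultimately show ?thesis using a D by (simp only: powr_mult less_imp_le)
    qed
    have "(\<Prod>j\<in>UNIV. norm (column j (M + col_embed i z)) powr (- \<gamma>))
       = norm (column i (M + col_embed i z)) powr (- \<gamma>) * (\<Prod>j\<in>- {i}. norm (column j (M + col_embed i z)) powr (- \<gamma>))"
      by (subst prod.remove[of _ i]) (auto simp: Compl_eq_Diff_UNIV)
    also have "\<dots> = norm x powr (- \<gamma>) * (\<Prod>j\<in>- {i}. norm (c j) powr (- \<gamma>))"
      by (simp add: column_col_embed c_def x_def)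
    also have "norm x powr (- \<gamma>) = (norm x)\<^sup>2 powr (- (\<gamma> / 2))"
    proof -
      have "(norm x)\<^sup>2 = norm x powr 2" by simp
      then have "(norm x)\<^sup>2 powr (- (\<gamma> / 2)) = norm x powr (2 * (- (\<gamma> / 2)))" by (simp only: powr_powr)
      then show ?thesis by simp
    qed
    finally have prod: "(\<Prod>j\<in>UNIV. norm (column j (M + col_embed i z)) powr (- \<gamma>))
        = (norm x)\<^sup>2 powr (- (\<gamma> / 2)) * (\<Prod>j\<in>- {i}. norm (c j) powr (- \<gamma>))" .
    have "msvs2_prior \<gamma> (M + col_embed i z) = K * (a x powr (- b) * (norm x)\<^sup>2 powr (- (\<gamma> / 2)))"
      unfolding msvs2_prior_def d prod K_def by (simp only: mult_ac)
    then show ?thesis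
      using a D K x det_eq[of z]
      by (simp add: msvs2_ext_def f_def inv_powr_def a_def[symmetric] x_def[symmetric] ennreal_mult)
  qed
  have fm[measurable]: "f \<in> borel_measurable borel" unfolding f_def inv_powr_def by measurable
  have "(\<integral>\<^sup>+z. ennreal (heat_kernel s z) * msvs2_ext \<gamma> (M + col_embed i z) \<partial>lborel)
     = ennreal K * (\<integral>\<^sup>+z. ennreal (heat_kernel s z) * f (c i + z) \<partial>lborel)"
    unfolding ext by (subst nn_integral_cmult[symmetric]) (auto simp: mult_ac)
  also have "\<dots> \<le> ennreal K * f (c i)"
    unfolding f_def
  \<comment> \<open>The complement has dimension n - p + 1, which is twice b + 1; the span has
    dimension p - 1, so the condition on the exponents becomes gamma <= 2 p - n.\<close>
  proof (intro mult_left_mono heat_kernel_inv_powr_le[OF orth nrm span card disj b _ _ _ s])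
    show "real (card B2) / 2 = b + 1" using np by (simp add: B2(5) dimV b_def field_simps)
    have "CARD('p) \<ge> 1" by simp
    then show "b + \<gamma> / 2 \<le> real (card B1) / 2" using \<gamma> by (simp add: B1(5) dimW b_def of_nat_diff field_simps)
  qed (use \<gamma> in auto)
  also have "\<dots> = msvs2_ext \<gamma> M" using ext[of 0] \<open>M + col_embed i 0 = M\<close> by simp
  finally show ?thesis .
qed

section \<open>Stein's identity and the risk of the posterior mean\<close>

lemma abs_power_le_exp: "\<bar>x\<bar> ^ k \<le> real k ^ k * exp \<bar>x\<bar>" for x :: real
proof (cases "k = 0")
  case False
  have "\<bar>x\<bar> ^ k = real k ^ k * (\<bar>x\<bar> / real k) ^ k"
    using False by (simp add: power_divide)
  also have "\<dots> \<le> real k ^ k * exp (\<bar>x\<bar> / real k) ^ k"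
  proof -
    have "\<bar>x\<bar> / real k \<le> exp (\<bar>x\<bar> / real k)"
      using exp_ge_add_one_self[of "\<bar>x\<bar> / real k"] by linarith
    then show ?thesis by (intro mult_left_mono power_mono) auto
  qed
  also have "exp (\<bar>x\<bar> / real k) ^ k = exp \<bar>x\<bar>"
    using False by (simp flip: exp_of_nat_mult)
  finally show ?thesis .
qed simp

lemma abs_exp_remainder_le: "\<bar>exp t - 1 - t\<bar> \<le> t\<^sup>2 * exp \<bar>t\<bar>" for t :: real
proof -
  obtain r where r: "\<bar>r\<bar> \<le> \<bar>t\<bar>" "exp t = (\<Sum>m<2. t ^ m / fact m) + exp r / fact 2 * t ^ 2"
    using Maclaurin_exp_le[of t 2] by blast
  have "\<bar>exp t - 1 - t\<bar> = exp r / 2 * t\<^sup>2"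
    by (simp add: r(2) numeral_2_eq_2)
  also have "\<dots> \<le> exp \<bar>t\<bar> * t\<^sup>2"
  proof (intro mult_right_mono)
    have "exp r \<le> exp \<bar>t\<bar>" using r(1) by simp
    then show "exp r / 2 \<le> exp \<bar>t\<bar>" using exp_gt_zero[of r] by linarith
  qed simp
  finally show ?thesis by (simp add: mult.commute)
qed

text \<open>Since exp |X| <= exp X + exp (-X), a power of X costs only a move of the parameter by
  one in either direction, which the hypothesis allows. The same device bounds the second-order
  remainder of exp (h X) for |h| <= 1 by h^2 times a fixed integrable function, so the difference
  quotient errs by at most a constant times |h|.\<close>

lemma mgf_integrable_and_derivative:
  fixes X :: "'a \<Rightarrow> real"
  assumes X[measurable]: "X \<in> borel_measurable \<mu>"
    and int: "\<And>l. integrable \<mu> (\<lambda>x. exp (l * X x))"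
  shows "integrable \<mu> (\<lambda>x. X x ^ k * exp (l * X x))"
    and "((\<lambda>l. \<integral>x. X x ^ k * exp (l * X x) \<partial>\<mu>) has_real_derivative
          (\<integral>x. X x ^ Suc k * exp (l * X x) \<partial>\<mu>)) (at l)"
proof -
  have I: "integrable \<mu> (\<lambda>x. X x ^ k * exp (l * X x))" for k l
  proof (rule Bochner_Integration.integrable_bound)
    show "integrable \<mu> (\<lambda>x. real k ^ k * (exp ((l + 1) * X x) + exp ((l - 1) * X x)))"
      by (intro integrable_mult_right Bochner_Integration.integrable_add int)
    show "AE x in \<mu>. norm (X x ^ k * exp (l * X x)) \<le> norm (real k ^ k * (exp ((l + 1) * X x) + exp ((l - 1) * X x)))"
    proof (intro AE_I2)
      fix x
      have "\<bar>X x\<bar> ^ k * exp (l * X x) \<le> (real k ^ k * exp \<bar>X x\<bar>) * exp (l * X x)"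
        by (intro mult_right_mono abs_power_le_exp) auto
      also have "exp \<bar>X x\<bar> \<le> exp (X x) + exp (- X x)"
        by (cases "X x \<ge> 0") auto
      also have "real k ^ k * (exp (X x) + exp (- X x)) * exp (l * X x)
          = real k ^ k * (exp ((l + 1) * X x) + exp ((l - 1) * X x))"
        by (simp add: algebra_simps flip: exp_add)
      finally show "norm (X x ^ k * exp (l * X x)) \<le> norm (real k ^ k * (exp ((l + 1) * X x) + exp ((l - 1) * X x)))"
        by (simp add: abs_mult power_abs mult_right_mono mult_left_mono)
    qed
  qed measurable
  show "integrable \<mu> (\<lambda>x. X x ^ k * exp (l * X x))" by (rule I)
  define w where "w x = \<bar>X x ^ (k + 2) * exp ((l + 1) * X x)\<bar> + \<bar>X x ^ (k + 2) * exp ((l - 1) * X x)\<bar>" for x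
  have w: "integrable \<mu> w" unfolding w_def
    by (intro Bochner_Integration.integrable_add integrable_abs I)
  define \<Phi> where "\<Phi> k l = (\<integral>x. X x ^ k * exp (l * X x) \<partial>\<mu>)" for k l
  have bound: "\<bar>(\<Phi> k (l + h) - \<Phi> k l) / h - \<Phi> (Suc k) l\<bar> \<le> \<bar>h\<bar> * (\<integral>x. w x \<partial>\<mu>)"
    if h: "h \<noteq> 0" "\<bar>h\<bar> \<le> 1" for h
  proof -
    have pw: "\<bar>X x ^ k * exp ((l + h) * X x) - X x ^ k * exp (l * X x) - h * (X x ^ Suc k * exp (l * X x))\<bar>
       \<le> h\<^sup>2 * w x" for x
    proof -
      have "X x ^ k * exp ((l + h) * X x) - X x ^ k * exp (l * X x) - h * (X x ^ Suc k * exp (l * X x))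
        = X x ^ k * exp (l * X x) * (exp (h * X x) - 1 - h * X x)"
        by (simp add: algebra_simps exp_add)
      then have "\<bar>X x ^ k * exp ((l + h) * X x) - X x ^ k * exp (l * X x) - h * (X x ^ Suc k * exp (l * X x))\<bar>
         = \<bar>X x\<bar> ^ k * exp (l * X x) * \<bar>exp (h * X x) - 1 - h * X x\<bar>"
        by (simp add: abs_mult power_abs)
      also have "\<dots> \<le> \<bar>X x\<bar> ^ k * exp (l * X x) * ((h * X x)\<^sup>2 * exp \<bar>h * X x\<bar>)"
        by (intro mult_left_mono abs_exp_remainder_le) auto
      also have "\<dots> \<le> \<bar>X x\<bar> ^ k * exp (l * X x) * ((h * X x)\<^sup>2 * (exp (X x) + exp (- X x)))"
      proof (intro mult_left_mono)
        have "\<bar>h * X x\<bar> \<le> \<bar>X x\<bar>" using h by (simp add: abs_mult mult_left_le_one_le)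
        then have "exp \<bar>h * X x\<bar> \<le> exp \<bar>X x\<bar>" by simp
        also have "exp \<bar>X x\<bar> \<le> exp (X x) + exp (- X x)"
          by (cases "X x \<ge> 0") auto
        finally show "exp \<bar>h * X x\<bar> \<le> exp (X x) + exp (- X x)" .
      qed auto
      also have "\<dots> = h\<^sup>2 * w x"
      proof -
        have "(h * X x)\<^sup>2 = h\<^sup>2 * \<bar>X x\<bar>\<^sup>2" by (simp add: power_mult_distrib)
        moreover have "exp ((l + 1) * X x) = exp (l * X x) * exp (X x)"
          "exp ((l - 1) * X x) = exp (l * X x) * exp (- X x)"
          by (simp_all add: algebra_simps flip: exp_add)
        moreover have "\<bar>X x\<bar> ^ (k + 2) = \<bar>X x\<bar> ^ k * \<bar>X x\<bar>\<^sup>2" by (rule power_add)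
        ultimately show ?thesis
          by (simp only: w_def abs_mult power_abs abs_exp_cancel) (simp add: algebra_simps)
      qed
      finally show ?thesis .
    qed
    have "\<Phi> k (l + h) - \<Phi> k l - h * \<Phi> (Suc k) l
       = (\<integral>x. X x ^ k * exp ((l + h) * X x) - X x ^ k * exp (l * X x) - h * (X x ^ Suc k * exp (l * X x)) \<partial>\<mu>)"
      unfolding \<Phi>_def using I[of k "l + h"] I[of k l] I[of "Suc k" l] by simp
    then have "\<bar>\<Phi> k (l + h) - \<Phi> k l - h * \<Phi> (Suc k) l\<bar> \<le> (\<integral>x. \<bar>X x ^ k * exp ((l + h) * X x) - X x ^ k * exp (l * X x) - h * (X x ^ Suc k * exp (l * X x))\<bar> \<partial>\<mu>)"
      by (simp only: integral_abs_bound)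
    also have "\<dots> \<le> (\<integral>x. h\<^sup>2 * w x \<partial>\<mu>)"
    proof (rule integral_mono)
      show "integrable \<mu> (\<lambda>x. \<bar>X x ^ k * exp ((l + h) * X x) - X x ^ k * exp (l * X x) - h * (X x ^ Suc k * exp (l * X x))\<bar>)"
        by (rule integrable_abs, rule Bochner_Integration.integrable_diff, rule Bochner_Integration.integrable_diff)
           (rule I, rule I, rule integrable_mult_right, rule I)
    qed (use w pw in auto)
    finally have "\<bar>\<Phi> k (l + h) - \<Phi> k l - h * \<Phi> (Suc k) l\<bar> \<le> h\<^sup>2 * (\<integral>x. w x \<partial>\<mu>)"
      by simp
    then have "\<bar>\<Phi> k (l + h) - \<Phi> k l - h * \<Phi> (Suc k) l\<bar> / \<bar>h\<bar> \<le> h\<^sup>2 * (\<integral>x. w x \<partial>\<mu>) / \<bar>h\<bar>"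
      by (intro divide_right_mono) auto
    also have "\<bar>\<Phi> k (l + h) - \<Phi> k l - h * \<Phi> (Suc k) l\<bar> / \<bar>h\<bar> = \<bar>(\<Phi> k (l + h) - \<Phi> k l) / h - \<Phi> (Suc k) l\<bar>"
      using h by (simp add: abs_divide[symmetric] diff_divide_distrib)
    also have "h\<^sup>2 * (\<integral>x. w x \<partial>\<mu>) / \<bar>h\<bar> = \<bar>h\<bar> * (\<integral>x. w x \<partial>\<mu>)"
      using h by (simp add: power2_eq_square field_simps abs_mult_self_eq)
    finally show ?thesis .
  qed
  have "((\<lambda>h. (\<Phi> k (l + h) - \<Phi> k l) / h - \<Phi> (Suc k) l) \<longlongrightarrow> 0) (at 0)"
  proof (rule Lim_null_comparison)
    show "\<forall>\<^sub>F h in at 0. norm ((\<Phi> k (l + h) - \<Phi> k l) / h - \<Phi> (Suc k) l) \<le> \<bar>h\<bar> * (\<integral>x. w x \<partial>\<mu>)"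
      unfolding eventually_at by (intro exI[of _ 1]) (auto simp: dist_real_def intro!: bound)
    show "((\<lambda>h. \<bar>h\<bar> * (\<integral>x. w x \<partial>\<mu>)) \<longlongrightarrow> 0) (at 0)"
      by (intro tendsto_eq_intros) (auto intro: tendsto_eq_intros)
  qed
  then have "((\<lambda>h. (\<Phi> k (l + h) - \<Phi> k l) / h) \<longlongrightarrow> \<Phi> (Suc k) l) (at 0)"
    by (simp add: LIM_zero_iff)
  then have "(\<Phi> k has_real_derivative \<Phi> (Suc k) l) (at l)"
    by (simp add: DERIV_def)
  then show "((\<lambda>l. \<integral>x. X x ^ k * exp (l * X x) \<partial>\<mu>) has_real_derivative
          (\<integral>x. X x ^ Suc k * exp (l * X x) \<partial>\<mu>)) (at l)"
    by (simp add: \<Phi>_def[abs_def])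
qed

section \<open>Integration by parts without boundary terms\<close>

lemma integrable_lborel_translation:
  fixes f :: "'a::euclidean_space \<Rightarrow> 'b::{banach, second_countable_topology}"
  assumes "integrable lborel f"
  shows "integrable lborel (\<lambda>x. f (x + a))"
proof -
  have "integrable (distr lborel borel ((+) a)) f" using assms by (simp add: lborel_distr_plus)
  then show ?thesis using assms by (subst (asm) integrable_distr_eq) (auto simp: add.commute)
qed

lemma integral_lborel_translation:
  fixes f :: "'a::euclidean_space \<Rightarrow> 'b::{banach, second_countable_topology}"
  assumes [measurable]: "f \<in> borel_measurable borel"
  shows "(\<integral>x. f (x + a) \<partial>lborel) = (\<integral>x. f x \<partial>lborel)"
proof -
  have "(\<integral>x. f x \<partial>lborel) = (\<integral>x. f x \<partial>distr lborel borel ((+) a))" by (simp add: lborel_distr_plus)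
  also have "\<dots> = (\<integral>x. f (x + a) \<partial>lborel)" by (subst integral_distr) (auto simp: add.commute)
  finally show ?thesis ..
qed

text \<open>Integrating \<open>F (y + b) - F y = \<integral>\<^sub>0\<^sup>1 F' (y + t b) dt\<close> over \<open>y\<close> avoids boundary terms.\<close>

lemma integral_directional_derivative_eq_0:
  fixes F F' :: "'a::euclidean_space \<Rightarrow> real"
  assumes F: "integrable lborel F" and F': "integrable lborel F'"
    and deriv: "\<And>y. ((\<lambda>t. F (y + t *\<^sub>R b)) has_real_derivative F' y) (at 0)"
  shows "(\<integral>y. F' y \<partial>lborel) = 0"
proof -
  have [measurable]: "F \<in> borel_measurable borel" "F' \<in> borel_measurable borel"
    using F F' by (simp_all add: integrable_iff_bounded)
  have deriv': "((\<lambda>t. F (y + t *\<^sub>R b)) has_real_derivative F' (y + t *\<^sub>R b)) (at t)" for y t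
  proof -
    have "((\<lambda>s. F (y + (s + t) *\<^sub>R b)) has_real_derivative F' (y + t *\<^sub>R b)) (at 0)"
      using deriv[of "y + t *\<^sub>R b"] by (simp add: scaleR_add_left algebra_simps)
    then show ?thesis
      using DERIV_shift[of "\<lambda>t. F (y + t *\<^sub>R b)" "F' (y + t *\<^sub>R b)" 0 t] by simp
  qed
  define H where "H = (\<lambda>(t::real, y::'a). indicator {0..1} t * F' (y + t *\<^sub>R b))"
  have [measurable]: "H \<in> borel_measurable (lborel \<Otimes>\<^sub>M lborel)"
    unfolding H_def by measurable
  have H: "integrable (lborel \<Otimes>\<^sub>M lborel) H"
  proof (rule lborel_pair.Fubini_integrable)
    have eq: "(\<integral>y. norm (H (t, y)) \<partial>lborel) = indicator {0..1} t * (\<integral>y. \<bar>F' y\<bar> \<partial>lborel)" for t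
      by (simp add: H_def abs_mult integral_lborel_translation[where f="\<lambda>y. \<bar>F' y\<bar>"])
    show "integrable lborel (\<lambda>t. \<integral>y. norm (H (t, y)) \<partial>lborel)"
      unfolding eq by (intro integrable_mult_left) simp
    show "AE t in lborel. integrable lborel (\<lambda>y. H (t, y))"
      by (simp add: H_def integrable_lborel_translation F')
  qed measurable
  have "(\<integral>t. (\<integral>y. H (t, y) \<partial>lborel) \<partial>lborel) = (\<integral>t. indicator {0..1::real} t * (\<integral>y. F' y \<partial>lborel) \<partial>lborel)"
    by (simp add: H_def integral_lborel_translation)
  also have "\<dots> = (\<integral>y. F' y \<partial>lborel)" by (simp add: content_real)
  finally have 1: "(\<integral>y. F' y \<partial>lborel) = (\<integral>t. (\<integral>y. H (t, y) \<partial>lborel) \<partial>lborel)" ..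
  also have "\<dots> = (\<integral>y. (\<integral>t. H (t, y) \<partial>lborel) \<partial>lborel)"
    using H lborel_pair.Fubini_integral[of "\<lambda>t y. H (t, y)"] by simp
  also have "\<dots> = (\<integral>y. F (y + b) - F y \<partial>lborel)"
  proof (rule integral_cong_AE)
    show "AE y in lborel. (\<integral>t. H (t, y) \<partial>lborel) = F (y + b) - F y"
    proof -
      \<comment> \<open>No continuity of \<open>F'\<close> is assumed. Fubini gives Lebesgue
        integrability along almost every segment, and there the Lebesgue integral agrees with the
        gauge integral of the fundamental theorem of calculus.\<close>
      have "AE y in lborel. integrable lborel (\<lambda>t. H (t, y))"
        using lborel_pair.AE_integrable_snd[of "\<lambda>t y. H (t, y)"] H by simp
      then show ?thesis
      proof eventually_elim
        fix y assume "integrable lborel (\<lambda>t. H (t, y))"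
        then have "((\<lambda>t. H (t, y)) has_integral (\<integral>t. H (t, y) \<partial>lborel)) UNIV"
          by (rule has_integral_integral_lborel)
        moreover have "((\<lambda>t. F' (y + t *\<^sub>R b)) has_integral F (y + 1 *\<^sub>R b) - F (y + 0 *\<^sub>R b)) {0..1}"
          using deriv'[of y] by (intro fundamental_theorem_of_calculus)
            (auto simp: has_real_derivative_iff_has_vector_derivative[symmetric] intro: has_field_derivative_at_within)
        then have "((\<lambda>t. H (t, y)) has_integral F (y + b) - F y) UNIV"
        proof -
          assume *: "((\<lambda>t. F' (y + t *\<^sub>R b)) has_integral F (y + 1 *\<^sub>R b) - F (y + 0 *\<^sub>R b)) {0..1}"
          have "(\<lambda>t. H (t, y)) = (\<lambda>t. if t \<in> {0..1} then F' (y + t *\<^sub>R b) else 0)"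
            by (auto simp: H_def fun_eq_iff)
          with * show ?thesis by (simp only: has_integral_restrict_UNIV scaleR_one scaleR_zero_left add_0_right)
        qed
        ultimately show "(\<integral>t. H (t, y) \<partial>lborel) = F (y + b) - F y"
          by (rule has_integral_unique)
      qed
    qed
  qed measurable
  also have "\<dots> = 0"
    using F by (simp add: integrable_lborel_translation integral_lborel_translation)
  finally show ?thesis .
qed

section \<open>The risk of a posterior mean\<close>

lemma abs_le_one_plus_square: "\<bar>x\<bar> \<le> 1 + x\<^sup>2" for x :: real
  using zero_le_power2[of "\<bar>x\<bar> - 1"] by (simp add: power2_diff)

text \<open>Here \<open>v b\<close> is coordinate b of the posterior mean minus y, and
  \<open>s b\<close> the posterior mean of the squared coordinate of M - y. The derivative of
  \<open>v b\<close> along b is 2 c times the posterior variance, minus 1. Integrated against the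
  Gaussian \<open>g\<close>, this expresses the cross term of the risk by \<open>s\<close> and the
  square of \<open>v\<close>. All integrals are kept unnormalised, with \<open>Z\<close> the mass of
  \<open>g\<close>.\<close>

lemma risk_le_of_posterior_second_moment_le:
  fixes prior :: "'a::euclidean_space \<Rightarrow> real" and c :: real and \<theta> :: 'a
  defines "w \<equiv> \<lambda>y M. exp (- c * (norm (y - M))\<^sup>2) * prior M"
  assumes c: "c > 0" and prior[measurable]: "prior \<in> borel_measurable borel"
    and prior_nonneg: "\<And>M. prior M \<ge> 0"
    and w_int: "\<And>y. integrable lborel (w y)"
    and K_pos: "\<And>y. 0 < (\<integral>M. w y M \<partial>lborel)"
    and mom_int: "\<And>y. integrable lborel (\<lambda>M. (norm (M - y))\<^sup>2 * w y M)"
    and mom: "\<And>y. (\<integral>M. (norm (M - y))\<^sup>2 * w y M \<partial>lborel) \<le> DIM('a) / (2 * c) * (\<integral>M. w y M \<partial>lborel)"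
    and Z_int: "integrable lborel (\<lambda>y. exp (- c * (norm (y - \<theta>))\<^sup>2))"
    and Z2_int: "integrable lborel (\<lambda>y. exp (- c * (norm (y - \<theta>))\<^sup>2) * (norm (y - \<theta>))\<^sup>2)"
  defines "K \<equiv> \<lambda>y. \<integral>M. w y M \<partial>lborel"
  defines "Z \<equiv> \<integral>y. exp (- c * (norm (y - \<theta>))\<^sup>2) \<partial>lborel"
  shows "(\<integral>\<^sup>+y. ennreal (exp (- c * (norm (y - \<theta>))\<^sup>2) *
            (norm ((1 / K y) *\<^sub>R (\<integral>M. w y M *\<^sub>R M \<partial>lborel) - \<theta>))\<^sup>2) \<partial>lborel)
    \<le> ennreal (DIM('a) / (2 * c) * Z)"
proof -
  define g where "g y = exp (- c * (norm (y - \<theta>))\<^sup>2)" for y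
  define C where "C = DIM('a) / (2 * c)"
  have C: "C \<ge> 0" using c by (simp add: C_def)
  have g0: "g y > 0" for y by (simp add: g_def)
  have g_int: "integrable lborel g" unfolding g_def by (rule Z_int)
  have g2_int: "integrable lborel (\<lambda>y. g y * (norm (y - \<theta>))\<^sup>2)" unfolding g_def by (rule Z2_int)
  have g[measurable]: "g \<in> borel_measurable borel" unfolding g_def by measurable
  have w_nonneg: "w y M \<ge> 0" for y M using prior_nonneg by (simp add: w_def)
  have w[measurable]: "(\<lambda>(y, M). w y M) \<in> borel_measurable (borel \<Otimes>\<^sub>M borel)"
    unfolding w_def by measurable
  have w'[measurable]: "w y \<in> borel_measurable borel" for y
    unfolding w_def by measurable
  have K: "K y > 0" for y using K_pos by (simp add: K_def)
  define L where "L b y = (\<integral>M. ((M - y) \<bullet> b) * w y M \<partial>lborel)" for b y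
  define S where "S b y = (\<integral>M. ((M - y) \<bullet> b)\<^sup>2 * w y M \<partial>lborel)" for b y
  have [measurable]: "K \<in> borel_measurable borel" "L b \<in> borel_measurable borel" "S b \<in> borel_measurable borel" for b
    unfolding K_def L_def S_def by measurable
  define v where "v b y = L b y / K y" for b y
  define s where "s b y = S b y / K y" for b y
  have [measurable]: "v b \<in> borel_measurable borel" "s b \<in> borel_measurable borel" for b
    unfolding v_def s_def by measurable
  have S_int: "integrable lborel (\<lambda>M. ((M - y) \<bullet> b)\<^sup>2 * w y M)" if "b \<in> Basis" for b y
  proof (rule Bochner_Integration.integrable_bound[OF mom_int[of y]])
    have "((M - y) \<bullet> b)\<^sup>2 \<le> (norm (M - y))\<^sup>2" for M
      using Basis_le_norm[OF that, of "M - y"] by (simp add: abs_le_square_iff[symmetric])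
    then show "AE M in lborel. norm (((M - y) \<bullet> b)\<^sup>2 * w y M) \<le> norm ((norm (M - y))\<^sup>2 * w y M)"
      using w_nonneg by (auto intro!: mult_right_mono)
  qed measurable
  have L_int: "integrable lborel (\<lambda>M. ((M - y) \<bullet> b) * w y M)" if "b \<in> Basis" for b y
  proof (rule Bochner_Integration.integrable_bound[OF Bochner_Integration.integrable_add[OF w_int[of y] S_int[OF that, of y]]])
    from abs_le_one_plus_square have "\<bar>x\<bar> * w y M \<le> (1 + x\<^sup>2) * w y M" for x M
      using w_nonneg by (intro mult_right_mono) auto
    then show "AE M in lborel. norm (((M - y) \<bullet> b) * w y M) \<le> norm (w y M + ((M - y) \<bullet> b)\<^sup>2 * w y M)"
      using w_nonneg by (auto simp: abs_mult distrib_right)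
  qed measurable
  have s_sum: "(\<Sum>b\<in>Basis. s b y) \<le> C" for y
  proof -
    have "(\<Sum>b\<in>Basis. S b y) = (\<integral>M. (\<Sum>b\<in>Basis. ((M - y) \<bullet> b)\<^sup>2 * w y M) \<partial>lborel)"
      unfolding S_def by (intro Bochner_Integration.integral_sum[symmetric] S_int)
    also have "\<dots> = (\<integral>M. (norm (M - y))\<^sup>2 * w y M \<partial>lborel)"
      by (simp add: norm_eq_sqrt_inner euclidean_inner[of "x - y" "x - y" for x] sum_nonneg
            flip: sum_distrib_right power2_eq_square)
    also have "\<dots> \<le> C * K y" using mom by (simp add: C_def K_def)
    finally show ?thesis using K[of y] by (simp add: s_def pos_divide_le_eq flip: sum_divide_distrib)
  qed
  have s_nonneg: "s b y \<ge> 0" for b y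
    using K[of y] w_nonneg unfolding s_def S_def by (intro divide_nonneg_pos integral_nonneg) auto
  have s_le: "s b y \<le> C" if "b \<in> Basis" for b y
    using member_le_sum[of b Basis "\<lambda>b. s b y"] s_nonneg that s_sum[of y] by force
  \<comment> \<open>A crude bound suffices: it only serves to make the products with
    \<open>g\<close> integrable.\<close>
  have v_le: "\<bar>v b y\<bar> \<le> 1 + C" if b: "b \<in> Basis" for b y
  proof -
    have "\<bar>L b y\<bar> \<le> (\<integral>M. \<bar>((M - y) \<bullet> b) * w y M\<bar> \<partial>lborel)"
      unfolding L_def by (rule integral_abs_bound)
    also have "\<dots> \<le> (\<integral>M. w y M + ((M - y) \<bullet> b)\<^sup>2 * w y M \<partial>lborel)"
    proof (rule integral_mono)
      from abs_le_one_plus_square have "\<bar>x\<bar> * w y M \<le> (1 + x\<^sup>2) * w y M" for x M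
        using w_nonneg by (intro mult_right_mono) auto
      then show "\<bar>((M - y) \<bullet> b) * w y M\<bar> \<le> w y M + ((M - y) \<bullet> b)\<^sup>2 * w y M" for M
        using w_nonneg by (auto simp: abs_mult distrib_right)
    qed (use L_int[OF b] w_int S_int[OF b] in auto)
    also have "\<dots> = K y + S b y" unfolding K_def S_def using w_int S_int[OF b] by simp
    finally have "\<bar>v b y\<bar> \<le> (K y + S b y) / K y"
      using K[of y] by (simp add: v_def abs_divide divide_right_mono)
    also have "\<dots> = 1 + s b y" using K[of y] by (simp add: s_def add_divide_distrib)
    finally show ?thesis using s_le[OF b, of y] by simp
  qed
  have v_deriv: "((\<lambda>t. v b (y + t *\<^sub>R b)) has_real_derivative 2 * c * (s b y - (v b y)\<^sup>2) - 1) (at 0)"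
    if b: "b \<in> Basis" for b y
  proof -
    define X where "X M = (M - y) \<bullet> b" for M
    define \<mu> where "\<mu> = density lborel (\<lambda>M. ennreal (w y M))"
    have [measurable_cong]: "sets \<mu> = sets borel" by (simp add: \<mu>_def)
    have X[measurable]: "X \<in> borel_measurable borel" unfolding X_def by measurable
    have X': "X \<in> borel_measurable \<mu>" by measurable
    \<comment> \<open>Moving y along b tilts the posterior exponentially in X, up to a factor free
      of M that cancels in \<open>v\<close>. So \<open>K\<close> and \<open>L\<close> along this
      line are moments of a tilted measure, hence values of a moment generating function and of its
      derivative.\<close>
    have wt: "w (y + t *\<^sub>R b) M = exp (- c * t\<^sup>2) * (exp (2 * c * t * X M) * w y M)" for t M
    proof -
      have "(norm (y + t *\<^sub>R b - M))\<^sup>2 = (norm (y - M))\<^sup>2 - 2 * t * X M + t\<^sup>2"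
        unfolding X_def power2_norm_eq_inner using b
        by (simp add: inner_simps inner_commute algebra_simps power2_eq_square)
      then have "- c * (norm (y + t *\<^sub>R b - M))\<^sup>2 = - c * t\<^sup>2 + (2 * c * t * X M + - c * (norm (y - M))\<^sup>2)"
        by (simp only:) (simp add: algebra_simps)
      then show ?thesis by (simp only: w_def exp_add)
    qed
    have dens: "integrable \<mu> f \<longleftrightarrow> integrable lborel (\<lambda>M. w y M * f M)"
        "(\<integral>M. f M \<partial>\<mu>) = (\<integral>M. w y M * f M \<partial>lborel)" if "f \<in> borel_measurable borel" for f :: "'a \<Rightarrow> real"
      unfolding \<mu>_def using w_nonneg that
      by (simp_all add: integrable_real_density integral_real_density)
    \<comment> \<open>The tilt by l is reached at t = l / (2 c), where the hypothesis
      \<open>w_int\<close> at the shifted point gives integrability.\<close>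
    have int: "integrable \<mu> (\<lambda>M. exp (l * X M))" for l
    proof -
      have "integrable lborel (\<lambda>M. exp (c * (l / (2 * c))\<^sup>2) * w (y + (l / (2 * c)) *\<^sub>R b) M)"
        by (intro integrable_mult_right w_int)
      also have "(\<lambda>M. exp (c * (l / (2 * c))\<^sup>2) * w (y + (l / (2 * c)) *\<^sub>R b) M) = (\<lambda>M. w y M * exp (l * X M))"
      proof
        fix M
        define r where "r = l / (2 * c)"
        have "exp (c * r\<^sup>2) * exp (- c * r\<^sup>2) = 1" by (simp flip: exp_add)
        moreover have "2 * c * r = l" using c by (simp add: r_def)
        ultimately show "exp (c * (l / (2 * c))\<^sup>2) * w (y + (l / (2 * c)) *\<^sub>R b) M = w y M * exp (l * X M)"
          unfolding r_def[symmetric] wt by (simp only: mult.assoc[symmetric] mult_1) (simp only: mult.commute)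
      qed
      finally show ?thesis by (simp add: dens)
    qed
    define \<Lambda> where "\<Lambda> k l = (\<integral>M. X M ^ k * exp (l * X M) \<partial>\<mu>)" for k :: nat and l
    have \<Lambda>d: "(\<Lambda> k has_real_derivative \<Lambda> (Suc k) l) (at l)" for k l
      using mgf_integrable_and_derivative(2)[OF X' int] by (simp add: \<Lambda>_def[abs_def])
    have \<Lambda>i: "integrable lborel (\<lambda>M. w y M * (X M ^ k * exp (l * X M)))" for k l
      using mgf_integrable_and_derivative(1)[OF X' int, of k l] by (subst (asm) dens) measurable
    have \<Lambda>w: "\<Lambda> k l = (\<integral>M. w y M * (X M ^ k * exp (l * X M)) \<partial>lborel)" for k l
      unfolding \<Lambda>_def by (intro dens) measurable
    have K_eq: "K (y + t *\<^sub>R b) = exp (- c * t\<^sup>2) * \<Lambda> 0 (2 * c * t)" for t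
      unfolding K_def \<Lambda>w wt by (simp add: mult.commute)
    have L_eq: "L b (y + t *\<^sub>R b) = exp (- c * t\<^sup>2) * (\<Lambda> 1 (2 * c * t) - t * \<Lambda> 0 (2 * c * t))" for t
    proof -
      have "((M - (y + t *\<^sub>R b)) \<bullet> b) * w (y + t *\<^sub>R b) M
        = exp (- c * t\<^sup>2) * (w y M * (X M ^ 1 * exp (2 * c * t * X M)) - t * (w y M * (X M ^ 0 * exp (2 * c * t * X M))))" for M
        unfolding wt X_def using b by (simp add: inner_simps algebra_simps)
      then show ?thesis
        unfolding L_def \<Lambda>w using \<Lambda>i[of 0 "2 * c * t"] \<Lambda>i[of 1 "2 * c * t"]
        by (simp only: integral_mult_right_zero Bochner_Integration.integral_diff integrable_mult_right)
    qed
    have \<Lambda>pos: "\<Lambda> 0 l > 0" for l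
    proof -
      have "0 < exp (- c * (l / (2 * c))\<^sup>2) * \<Lambda> 0 l"
        using K[of "y + (l / (2 * c)) *\<^sub>R b"] c unfolding K_eq by simp
      then show ?thesis by (simp add: zero_less_mult_iff)
    qed
    \<comment> \<open>The term - t is the displacement of the base point from which M is measured;
      it produces the -1 in the derivative.\<close>
    have v_eq: "v b (y + t *\<^sub>R b) = \<Lambda> 1 (2 * c * t) / \<Lambda> 0 (2 * c * t) - t" for t
      unfolding v_def K_eq L_eq using \<Lambda>pos[of "2 * c * t"] by (simp add: diff_divide_distrib)
    have "S b y = \<Lambda> 2 0" unfolding S_def \<Lambda>w by (simp add: X_def mult.commute)
    then have s_eq: "s b y = \<Lambda> 2 0 / \<Lambda> 0 0" using K_eq[of 0] by (simp add: s_def)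
    have "((\<lambda>t. \<Lambda> 1 (2 * c * t) / \<Lambda> 0 (2 * c * t) - t) has_real_derivative
        ((\<Lambda> 2 0 * (2 * c)) * \<Lambda> 0 0 - \<Lambda> 1 0 * (\<Lambda> 1 0 * (2 * c))) / (\<Lambda> 0 0 * \<Lambda> 0 0) - 1) (at 0)"
    proof (intro DERIV_diff DERIV_ident)
      have d: "((\<lambda>t. \<Lambda> k (2 * c * t)) has_real_derivative \<Lambda> (Suc k) 0 * (2 * c)) (at 0)" for k
        by (rule DERIV_chain2[where f="\<Lambda> k"]) (auto intro!: \<Lambda>d derivative_eq_intros)
      show "((\<lambda>t. \<Lambda> 1 (2 * c * t) / \<Lambda> 0 (2 * c * t)) has_real_derivative
        ((\<Lambda> 2 0 * (2 * c)) * \<Lambda> 0 0 - \<Lambda> 1 0 * (\<Lambda> 1 0 * (2 * c))) / (\<Lambda> 0 0 * \<Lambda> 0 0)) (at 0)"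
        using DERIV_divide[OF d[of 1] d[of 0]] \<Lambda>pos[of 0] by (simp add: numeral_2_eq_2)
    qed
    moreover have "((\<Lambda> 2 0 * (2 * c)) * \<Lambda> 0 0 - \<Lambda> 1 0 * (\<Lambda> 1 0 * (2 * c))) / (\<Lambda> 0 0 * \<Lambda> 0 0) - 1
        = 2 * c * (s b y - (v b y)\<^sup>2) - 1"
      using v_eq[of 0] \<Lambda>pos[of 0] unfolding s_eq
      by (simp add: power2_eq_square diff_divide_distrib right_diff_distrib mult_ac)
    ultimately show ?thesis unfolding v_eq by simp
  qed
  have x_deriv: "((\<lambda>t. (y + t *\<^sub>R b - \<theta>) \<bullet> b) has_real_derivative 1) (at 0)" if "b \<in> Basis" for b y
    using that by (auto simp: inner_simps intro!: derivative_eq_intros)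
  have g_deriv: "((\<lambda>t. g (y + t *\<^sub>R b)) has_real_derivative g y * (- 2 * c * ((y - \<theta>) \<bullet> b))) (at 0)"
    if b: "b \<in> Basis" for b y
  proof -
    have eq: "g (y + t *\<^sub>R b) = exp (- c * ((norm (y - \<theta>))\<^sup>2 + 2 * t * ((y - \<theta>) \<bullet> b) + t\<^sup>2))" for t
      unfolding g_def power2_norm_eq_inner using b
      by (simp add: inner_simps inner_commute algebra_simps power2_eq_square)
    show ?thesis unfolding eq by (rule derivative_eq_intros refl)+ (simp add: g_def)
  qed
  have gx2_int: "integrable lborel (\<lambda>y. g y * ((y - \<theta>) \<bullet> b)\<^sup>2)" if "b \<in> Basis" for b
  proof (rule Bochner_Integration.integrable_bound[OF g2_int])
    have "((y - \<theta>) \<bullet> b)\<^sup>2 \<le> (norm (y - \<theta>))\<^sup>2" for y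
      using Basis_le_norm[OF that, of "y - \<theta>"] by (simp add: abs_le_square_iff[symmetric])
    then show "AE y in lborel. norm (g y * ((y - \<theta>) \<bullet> b)\<^sup>2) \<le> norm (g y * (norm (y - \<theta>))\<^sup>2)"
      using g0 by (auto simp: abs_mult intro!: mult_left_mono)
  qed measurable
  have gx_int: "integrable lborel (\<lambda>y. g y * ((y - \<theta>) \<bullet> b))" if "b \<in> Basis" for b
  proof (rule Bochner_Integration.integrable_bound[OF Bochner_Integration.integrable_add[OF g_int gx2_int[OF that]]])
    from abs_le_one_plus_square have "g y * \<bar>x\<bar> \<le> g y * (1 + x\<^sup>2)" for x y
      using g0 by (intro mult_left_mono) (auto simp: less_imp_le)
    then show "AE y in lborel. norm (g y * ((y - \<theta>) \<bullet> b)) \<le> norm (g y + g y * ((y - \<theta>) \<bullet> b)\<^sup>2)"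
      using g0 by (auto simp: abs_mult distrib_left less_imp_le intro!: order_trans[OF _ abs_ge_self])
  qed measurable
  have bdd_int: "integrable lborel (\<lambda>y. f y * h y)"
    if "integrable lborel f" "h \<in> borel_measurable borel" "\<And>y. \<bar>h y\<bar> \<le> D" for f h :: "'a \<Rightarrow> real" and D
  proof (rule Bochner_Integration.integrable_bound)
    show "integrable lborel (\<lambda>y. D * f y)" using that by simp
    have "D \<ge> 0" using that(3)[of undefined] by linarith
    moreover have "\<bar>f y\<bar> * \<bar>h y\<bar> \<le> \<bar>f y\<bar> * D" for y
      using that(3) by (intro mult_left_mono) auto
    ultimately show "AE y in lborel. norm (f y * h y) \<le> norm (D * f y)"
      by (simp add: abs_mult mult.commute)
    show "(\<lambda>y. f y * h y) \<in> borel_measurable lborel" using that(1,2) by auto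
  qed
  have gv_int: "integrable lborel (\<lambda>y. g y * v b y)" "integrable lborel (\<lambda>y. g y * (v b y)\<^sup>2)"
      "integrable lborel (\<lambda>y. g y * s b y)" "integrable lborel (\<lambda>y. g y * ((y - \<theta>) \<bullet> b) * v b y)"
    if b: "b \<in> Basis" for b
  proof -
    show "integrable lborel (\<lambda>y. g y * v b y)" "integrable lborel (\<lambda>y. g y * ((y - \<theta>) \<bullet> b) * v b y)"
      by (rule bdd_int[OF _ _ v_le[OF b]]; simp add: g_int gx_int[OF b])+
    show "integrable lborel (\<lambda>y. g y * s b y)"
      by (rule bdd_int[OF g_int, where D=C]) (use s_le[OF b] s_nonneg in auto)
    show "integrable lborel (\<lambda>y. g y * (v b y)\<^sup>2)"
    proof (rule bdd_int[OF g_int])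
      show "\<bar>(v b y)\<^sup>2\<bar> \<le> (1 + C)\<^sup>2" for y
        using power_mono[OF v_le[OF b, of y], of 2] by simp
    qed measurable
  qed
  define P where "P b = (\<integral>y. g y * ((y - \<theta>) \<bullet> b)\<^sup>2 \<partial>lborel)" for b
  define Q where "Q b = (\<integral>y. g y * ((y - \<theta>) \<bullet> b) * v b y \<partial>lborel)" for b
  define R where "R b = (\<integral>y. g y * (v b y)\<^sup>2 \<partial>lborel)" for b
  define T where "T b = (\<integral>y. g y * s b y \<partial>lborel)" for b
  have Zg: "Z = (\<integral>y. g y \<partial>lborel)" by (simp add: Z_def g_def)
  \<comment> \<open>Stein's identity for coordinate b: the derivative of \<open>g\<close> times
    \<open>v b\<close> along b integrates to zero.\<close>
  have I1: "- 2 * c * Q b + 2 * c * T b - 2 * c * R b - Z = 0" if b: "b \<in> Basis" for b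
  proof -
    define F' where "F' y = - 2 * c * (g y * ((y - \<theta>) \<bullet> b) * v b y) + 2 * c * (g y * s b y)
       - 2 * c * (g y * (v b y)\<^sup>2) - g y" for y
    have i: "integrable lborel (\<lambda>y. - 2 * c * (g y * ((y - \<theta>) \<bullet> b) * v b y))"
      "integrable lborel (\<lambda>y. 2 * c * (g y * s b y))" "integrable lborel (\<lambda>y. 2 * c * (g y * (v b y)\<^sup>2))"
      using gv_int[OF b] by (auto intro!: integrable_mult_right)
    have "(\<integral>y. F' y \<partial>lborel) = 0"
    proof (rule integral_directional_derivative_eq_0[OF gv_int(1)[OF b]])
      show "integrable lborel F'"
        unfolding F'_def by (intro Bochner_Integration.integrable_diff Bochner_Integration.integrable_add i g_int)
      fix y
      show "((\<lambda>t. g (y + t *\<^sub>R b) * v b (y + t *\<^sub>R b)) has_real_derivative F' y) (at 0)"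
        by (rule derivative_eq_intros g_deriv[OF b] v_deriv[OF b])+
           (simp add: F'_def algebra_simps)
    qed
    then show ?thesis
      unfolding F'_def Q_def R_def T_def Zg using i g_int by simp
  qed
  \<comment> \<open>The same identity with the coordinate of y - theta in place of
    \<open>v b\<close>; it evaluates the Gaussian variance.\<close>
  have I2: "Z = 2 * c * P b" if b: "b \<in> Basis" for b
  proof -
    have "(\<integral>y. g y - 2 * c * (g y * ((y - \<theta>) \<bullet> b)\<^sup>2) \<partial>lborel) = 0"
    proof (rule integral_directional_derivative_eq_0[OF gx_int[OF b]])
      show "integrable lborel (\<lambda>y. g y - 2 * c * (g y * ((y - \<theta>) \<bullet> b)\<^sup>2))"
        by (intro Bochner_Integration.integrable_diff g_int integrable_mult_right gx2_int[OF b])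
      fix y
      show "((\<lambda>t. g (y + t *\<^sub>R b) * ((y + t *\<^sub>R b - \<theta>) \<bullet> b)) has_real_derivative g y - 2 * c * (g y * ((y - \<theta>) \<bullet> b)\<^sup>2)) (at 0)"
        by (rule derivative_eq_intros g_deriv[OF b] x_deriv[OF b])+
           (simp add: algebra_simps power2_eq_square)
    qed
    then show ?thesis unfolding P_def Zg using g_int gx2_int[OF b] by simp
  qed
  have est: "((1 / K y) *\<^sub>R (\<integral>M. w y M *\<^sub>R M \<partial>lborel) - \<theta>) \<bullet> b = (y - \<theta>) \<bullet> b + v b y" if b: "b \<in> Basis" for b y
  proof -
    have wM: "integrable lborel (\<lambda>M. w y M *\<^sub>R M)"
    proof (rule Bochner_Integration.integrable_bound)
      show "integrable lborel (\<lambda>M. (1 + norm y) * w y M + (norm (M - y))\<^sup>2 * w y M)"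
        by (intro Bochner_Integration.integrable_add integrable_mult_right w_int mom_int)
      from abs_le_one_plus_square have "norm M \<le> 1 + norm y + (norm (M - y))\<^sup>2" for M
        using norm_triangle_sub[of M y] by (smt (verit) norm_ge_zero)
      then have "norm M * w y M \<le> (1 + norm y + (norm (M - y))\<^sup>2) * w y M" for M
        using w_nonneg by (intro mult_right_mono) auto
      then show "AE M in lborel. norm (w y M *\<^sub>R M) \<le> norm ((1 + norm y) * w y M + (norm (M - y))\<^sup>2 * w y M)"
        using w_nonneg by (auto simp: algebra_simps intro!: order_trans[OF _ abs_ge_self])
    qed measurable
    have "L b y = (\<integral>M. (w y M *\<^sub>R M) \<bullet> b - (y \<bullet> b) * w y M \<partial>lborel)"
      unfolding L_def by (simp add: inner_simps algebra_simps)
    also have "\<dots> = (\<integral>M. w y M *\<^sub>R M \<partial>lborel) \<bullet> b - (y \<bullet> b) * K y"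
      unfolding K_def using wM w_int[of y] by (simp add: integral_inner_left del: inner_scaleR_left)
    finally show ?thesis
      using K[of y] by (simp add: v_def inner_simps field_simps)
  qed
  have sq_int: "integrable lborel (\<lambda>y. g y * ((y - \<theta>) \<bullet> b + v b y)\<^sup>2)"
    and sq: "(\<integral>y. g y * ((y - \<theta>) \<bullet> b + v b y)\<^sup>2 \<partial>lborel) = P b + 2 * Q b + R b" if b: "b \<in> Basis" for b
  proof -
    have eq: "g y * ((y - \<theta>) \<bullet> b + v b y)\<^sup>2
      = g y * ((y - \<theta>) \<bullet> b)\<^sup>2 + 2 * (g y * ((y - \<theta>) \<bullet> b) * v b y) + g y * (v b y)\<^sup>2" for y
      by algebra
    have i: "integrable lborel (\<lambda>y. 2 * (g y * ((y - \<theta>) \<bullet> b) * v b y))"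
      using gv_int(4)[OF b] by (intro integrable_mult_right)
    show "integrable lborel (\<lambda>y. g y * ((y - \<theta>) \<bullet> b + v b y)\<^sup>2)"
      unfolding eq by (intro Bochner_Integration.integrable_add i gx2_int[OF b] gv_int(2)[OF b])
    show "(\<integral>y. g y * ((y - \<theta>) \<bullet> b + v b y)\<^sup>2 \<partial>lborel) = P b + 2 * Q b + R b"
      unfolding eq P_def Q_def R_def using i gx2_int[OF b] gv_int(2)[OF b] by simp
  qed
  have Tsum: "(\<Sum>b\<in>Basis. T b) \<le> C * Z"
  proof -
    have "(\<Sum>b\<in>Basis. T b) = (\<integral>y. (\<Sum>b\<in>Basis. g y * s b y) \<partial>lborel)"
      unfolding T_def by (intro Bochner_Integration.integral_sum[symmetric] gv_int)
    also have "\<dots> \<le> (\<integral>y. C * g y \<partial>lborel)"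
    proof (rule integral_mono)
      show "integrable lborel (\<lambda>y. \<Sum>b\<in>Basis. g y * s b y)"
        by (intro Bochner_Integration.integrable_sum gv_int)
      show "(\<Sum>b\<in>Basis. g y * s b y) \<le> C * g y" for y
        using s_sum[of y] g0[of y] by (simp add: mult.commute flip: sum_distrib_left)
    qed (simp add: g_int)
    finally show ?thesis by (simp add: Zg)
  qed
  have "(\<Sum>b\<in>Basis. P b + 2 * Q b + R b) \<le> (\<Sum>b\<in>(Basis::'a set). 2 * T b - Z / (2 * c))"
  proof (rule sum_mono)
    fix b :: 'a assume b: "b \<in> Basis"
    \<comment> \<open>By the two identities the sum equals 2 T - R - Z / (2 c), so discarding the
      square of \<open>v\<close> is all that is lost here.\<close>
    have "R b \<ge> 0" unfolding R_def using g0 by (intro Bochner_Integration.integral_nonneg) (simp add: less_imp_le)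
    moreover have "Q b = T b - R b - Z / (2 * c)"
      using I1[OF b] c by (simp add: field_simps)
    moreover have "P b = Z / (2 * c)" using I2[OF b] c by simp
    ultimately show "P b + 2 * Q b + R b \<le> 2 * T b - Z / (2 * c)" by simp
  qed
  also have "\<dots> = 2 * (\<Sum>b\<in>Basis. T b) - C * Z"
    by (simp add: sum_subtractf sum_distrib_left C_def)
  also have "\<dots> \<le> C * Z" using Tsum by simp
  finally have fin: "(\<Sum>b\<in>Basis. P b + 2 * Q b + R b) \<le> C * Z" .
  have "(\<integral>\<^sup>+y. ennreal (g y * (norm ((1 / K y) *\<^sub>R (\<integral>M. w y M *\<^sub>R M \<partial>lborel) - \<theta>))\<^sup>2) \<partial>lborel)
     = (\<integral>\<^sup>+y. ennreal (\<Sum>b\<in>Basis. g y * ((y - \<theta>) \<bullet> b + v b y)\<^sup>2) \<partial>lborel)"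
  proof (rule nn_integral_cong)
    fix y
    have "(norm x)\<^sup>2 = (\<Sum>b\<in>Basis. (x \<bullet> b)\<^sup>2)" for x :: 'a
      by (subst power2_norm_eq_inner, subst euclidean_inner) (simp add: power2_eq_square)
    then show "ennreal (g y * (norm ((1 / K y) *\<^sub>R (\<integral>M. w y M *\<^sub>R M \<partial>lborel) - \<theta>))\<^sup>2)
       = ennreal (\<Sum>b\<in>Basis. g y * ((y - \<theta>) \<bullet> b + v b y)\<^sup>2)"
      by (simp only: est sum_distrib_left cong: sum.cong)
  qed
  also have "\<dots> = ennreal (\<integral>y. (\<Sum>b\<in>Basis. g y * ((y - \<theta>) \<bullet> b + v b y)\<^sup>2) \<partial>lborel)"
    using g0 by (intro nn_integral_eq_integral Bochner_Integration.integrable_sum sq_int)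
      (auto intro!: sum_nonneg simp: less_imp_le)
  also have "(\<integral>y. (\<Sum>b\<in>Basis. g y * ((y - \<theta>) \<bullet> b + v b y)\<^sup>2) \<partial>lborel) = (\<Sum>b\<in>Basis. P b + 2 * Q b + R b)"
    by (subst Bochner_Integration.integral_sum) (auto intro!: sum.cong sq_int sq)
  also have "ennreal \<dots> \<le> ennreal (C * Z)" using fin by (rule ennreal_leI)
  finally show ?thesis by (simp add: g_def C_def)
qed

section \<open>Priors decreasing under the heat flow\<close>

lemma nn_integral_lborel_translation:
  fixes f :: "'a::euclidean_space \<Rightarrow> ennreal"
  assumes [measurable]: "f \<in> borel_measurable borel"
  shows "(\<integral>\<^sup>+x. f (a + x) \<partial>lborel) = (\<integral>\<^sup>+x. f x \<partial>lborel)"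
proof -
  have "(\<integral>\<^sup>+x. f x \<partial>lborel) = (\<integral>\<^sup>+x. f x \<partial>distr lborel borel ((+) a))" by (simp add: lborel_distr_plus)
  also have "\<dots> = (\<integral>\<^sup>+x. f (a + x) \<partial>lborel)" by (subst nn_integral_distr) auto
  finally show ?thesis ..
qed

text \<open>The kernel at time t is a Gaussian of width 2 t in every direction, so this is the case
  of equal widths in the standard basis.\<close>

lemma heat_kernel_convolution:
  fixes z :: "'a::euclidean_space"
  assumes s: "s > 0" and t: "t > 0"
  shows "(\<integral>\<^sup>+u. ennreal (heat_kernel s u) * ennreal (heat_kernel t (z - u)) \<partial>lborel) = ennreal (heat_kernel (t + s) z)"
proof -
  let ?C = "1 / sqrt (2 * pi * t) ^ DIM('a)"
  have sq: "(norm x)\<^sup>2 = (\<Sum>b\<in>Basis. (x \<bullet> b)\<^sup>2)" for x :: 'a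
    by (subst power2_norm_eq_inner, subst euclidean_inner) (simp add: power2_eq_square)
  have prod_exp: "(\<Prod>b\<in>Basis. exp (- (x \<bullet> b)\<^sup>2 / r)) = exp (- (norm x)\<^sup>2 / r)" for x :: 'a and r
    by (simp add: sq sum_divide_distrib sum_negf flip: exp_sum)
  have "(\<integral>\<^sup>+u. ennreal (heat_kernel s u) * ennreal (heat_kernel t (z - u)) \<partial>lborel)
     = (\<integral>\<^sup>+u. ennreal ?C * ennreal (heat_kernel s u * (\<Prod>b\<in>Basis. exp (- ((- z + u) \<bullet> b)\<^sup>2 / (2 * t)))) \<partial>lborel)"
  proof (intro nn_integral_cong)
    fix u
    have "heat_kernel t (z - u) = ?C * (\<Prod>b\<in>Basis. exp (- ((- z + u) \<bullet> b)\<^sup>2 / (2 * t)))"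
      unfolding prod_exp heat_kernel_def by (simp add: norm_minus_commute)
    then show "ennreal (heat_kernel s u) * ennreal (heat_kernel t (z - u))
      = ennreal ?C * ennreal (heat_kernel s u * (\<Prod>b\<in>Basis. exp (- ((- z + u) \<bullet> b)\<^sup>2 / (2 * t))))"
      using s t by (simp only: ennreal_mult[symmetric] heat_kernel_nonneg) (simp add: ennreal_mult[symmetric] prod_nonneg mult_ac)
  qed
  also have "\<dots> = ennreal ?C * ennreal (\<Prod>b\<in>Basis. sqrt (2 * t / (2 * t + 2 * s)) * exp (- (- z \<bullet> b)\<^sup>2 / (2 * t + 2 * s)))"
    using heat_kernel_orthonormal_gaussian[of Basis s "\<lambda>_. 2 * t" "- z"] s t
    by (subst nn_integral_cmult) (auto simp: pairwise_def orthogonal_def inner_not_same_Basis)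
  also have "(\<Prod>b\<in>(Basis::'a set). sqrt (2 * t / (2 * t + 2 * s)) * exp (- (- z \<bullet> b)\<^sup>2 / (2 * t + 2 * s)))
     = sqrt (t / (t + s)) ^ DIM('a) * exp (- (norm z)\<^sup>2 / (2 * (t + s)))"
  proof -
    have "2 * t / (2 * t + 2 * s) = t / (t + s)" using s t by (simp add: divide_simps)
    moreover have "2 * t + 2 * s = 2 * (t + s)" by simp
    moreover have "exp (- (- z \<bullet> b)\<^sup>2 / r) = exp (- (z \<bullet> b)\<^sup>2 / r)" for b r by simp
    ultimately show ?thesis by (simp only: prod.distrib prod_constant prod_exp)
  qed
  also have "ennreal ?C * ennreal \<dots> = ennreal (heat_kernel (t + s) z)"
  proof -
    have "sqrt (t / (t + s)) ^ DIM('a) / sqrt (2 * pi * t) ^ DIM('a) = 1 / sqrt (2 * pi * (t + s)) ^ DIM('a)"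
    proof -
      have "sqrt (t / (t + s)) / sqrt (2 * pi * t) = 1 / sqrt (2 * pi * (t + s))"
        using s t unfolding real_sqrt_divide[symmetric] by (simp add: real_sqrt_divide real_sqrt_mult)
      then show ?thesis by (simp add: power_divide[symmetric] power_one_over[symmetric])
    qed
    moreover have "?C * (sqrt (t / (t + s)) ^ DIM('a) * e) = sqrt (t / (t + s)) ^ DIM('a) / sqrt (2 * pi * t) ^ DIM('a) * e" for e
      by simp
    ultimately have "?C * (sqrt (t / (t + s)) ^ DIM('a) * exp (- (norm z)\<^sup>2 / (2 * (t + s)))) = heat_kernel (t + s) z"
      unfolding heat_kernel_def by (simp only:) simp
    then show ?thesis using s t by (simp only: ennreal_mult[symmetric] divide_nonneg_nonneg zero_le_power mult_nonneg_nonneg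
      exp_ge_zero real_sqrt_ge_zero less_imp_le zero_le_one add_nonneg_nonneg pi_ge_zero zero_le_numeral)
  qed
  finally show ?thesis .
qed

text \<open>By the semigroup property the flow by s may act first, around each point y + z, where
  \<open>super\<close> applies; the flow by t preserves the inequality.\<close>

lemma heat_flow_antimono:
  fixes \<rho> :: "'a::euclidean_space \<Rightarrow> ennreal"
  assumes [measurable]: "\<rho> \<in> borel_measurable borel"
    and super: "\<And>s x. s > 0 \<Longrightarrow> (\<integral>\<^sup>+z. ennreal (heat_kernel s z) * \<rho> (x + z) \<partial>lborel) \<le> \<rho> x"
    and st: "s > 0" "t > 0"
  shows "(\<integral>\<^sup>+z. ennreal (heat_kernel (t + s) z) * \<rho> (y + z) \<partial>lborel) \<le> (\<integral>\<^sup>+z. ennreal (heat_kernel t z) * \<rho> (y + z) \<partial>lborel)"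
proof -
  have "(\<integral>\<^sup>+z. ennreal (heat_kernel (t + s) z) * \<rho> (y + z) \<partial>lborel)
     = (\<integral>\<^sup>+z. (\<integral>\<^sup>+u. ennreal (heat_kernel s u) * ennreal (heat_kernel t (z - u)) * \<rho> (y + z) \<partial>lborel) \<partial>lborel)"
    using st by (intro nn_integral_cong) (simp add: nn_integral_multc heat_kernel_convolution)
  also have "\<dots> = (\<integral>\<^sup>+u. (\<integral>\<^sup>+z. ennreal (heat_kernel s u) * ennreal (heat_kernel t (z - u)) * \<rho> (y + z) \<partial>lborel) \<partial>lborel)"
    by (rule lborel_pair.Fubini') measurable
  also have "\<dots> = (\<integral>\<^sup>+u. (\<integral>\<^sup>+z. ennreal (heat_kernel t z) * (ennreal (heat_kernel s u) * \<rho> (y + z + u)) \<partial>lborel) \<partial>lborel)"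
  proof (rule nn_integral_cong)
    fix u
    show "(\<integral>\<^sup>+z. ennreal (heat_kernel s u) * ennreal (heat_kernel t (z - u)) * \<rho> (y + z) \<partial>lborel)
      = (\<integral>\<^sup>+z. ennreal (heat_kernel t z) * (ennreal (heat_kernel s u) * \<rho> (y + z + u)) \<partial>lborel)"
      using nn_integral_lborel_translation[of "\<lambda>z. ennreal (heat_kernel s u) * ennreal (heat_kernel t (z - u)) * \<rho> (y + z)" u]
      by (simp add: mult_ac add_ac)
  qed
  also have "\<dots> = (\<integral>\<^sup>+z. (\<integral>\<^sup>+u. ennreal (heat_kernel t z) * (ennreal (heat_kernel s u) * \<rho> (y + z + u)) \<partial>lborel) \<partial>lborel)"
    by (rule lborel_pair.Fubini') measurable
  also have "\<dots> = (\<integral>\<^sup>+z. ennreal (heat_kernel t z) * (\<integral>\<^sup>+u. ennreal (heat_kernel s u) * \<rho> (y + z + u) \<partial>lborel) \<partial>lborel)"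
    by (simp add: nn_integral_cmult)
  also have "\<dots> \<le> (\<integral>\<^sup>+z. ennreal (heat_kernel t z) * \<rho> (y + z) \<partial>lborel)"
    using super[OF st(1)] by (intro nn_integral_mono mult_left_mono) auto
  finally show ?thesis .
qed

section \<open>Gaussian marginals of a superharmonic prior\<close>

lemma nn_integral_gaussian_eq_heat:
  fixes \<rho> :: "'a::euclidean_space \<Rightarrow> ennreal"
  assumes [measurable]: "\<rho> \<in> borel_measurable borel" and c: "c > 0"
  shows "(\<integral>\<^sup>+M. ennreal (exp (- c * (norm (y - M))\<^sup>2)) * \<rho> M \<partial>lborel)
    = ennreal (sqrt (pi / c) ^ DIM('a)) * (\<integral>\<^sup>+z. ennreal (heat_kernel (1 / (2 * c)) z) * \<rho> (y + z) \<partial>lborel)"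
proof -
  have "exp (- c * (norm z)\<^sup>2) = sqrt (pi / c) ^ DIM('a) * heat_kernel (1 / (2 * c)) z" for z :: 'a
    using c by (simp add: heat_kernel_def)
  then have eq: "ennreal (exp (- c * (norm z)\<^sup>2)) = ennreal (sqrt (pi / c) ^ DIM('a)) * ennreal (heat_kernel (1 / (2 * c)) z)" for z :: 'a
    using c by (simp only: ennreal_mult[symmetric] heat_kernel_nonneg divide_pos_pos mult_pos_pos zero_less_one zero_less_numeral
       zero_le_power real_sqrt_ge_zero divide_nonneg_pos pi_ge_zero)
  have "(\<integral>\<^sup>+M. ennreal (exp (- c * (norm (y - M))\<^sup>2)) * \<rho> M \<partial>lborel)
     = (\<integral>\<^sup>+z. ennreal (exp (- c * (norm z)\<^sup>2)) * \<rho> (y + z) \<partial>lborel)"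
    using nn_integral_lborel_translation[of "\<lambda>M. ennreal (exp (- c * (norm (y - M))\<^sup>2)) * \<rho> M" y] by simp
  also have "\<dots> = (\<integral>\<^sup>+z. ennreal (sqrt (pi / c) ^ DIM('a)) * (ennreal (heat_kernel (1 / (2 * c)) z) * \<rho> (y + z)) \<partial>lborel)"
    unfolding eq by (simp only: mult.assoc)
  also have "\<dots> = ennreal (sqrt (pi / c) ^ DIM('a)) * (\<integral>\<^sup>+z. ennreal (heat_kernel (1 / (2 * c)) z) * \<rho> (y + z) \<partial>lborel)"
    by (rule nn_integral_cmult) measurable
  finally show ?thesis .
qed

text \<open>Giving up half of the exponent moves the centre from y to \<open>x0\<close>, at the cost
  of a constant factor. At \<open>x0\<close> the integral is a heat flow of \<open>\<rho>\<close>,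
  bounded by the finite value there.\<close>

lemma superharmonic_gaussian_finite:
  fixes \<rho> :: "'a::euclidean_space \<Rightarrow> ennreal"
  assumes [measurable]: "\<rho> \<in> borel_measurable borel"
    and super: "\<And>s x. s > 0 \<Longrightarrow> (\<integral>\<^sup>+z. ennreal (heat_kernel s z) * \<rho> (x + z) \<partial>lborel) \<le> \<rho> x"
    and x0: "\<rho> x0 < \<infinity>" and c: "c > 0"
  shows "(\<integral>\<^sup>+M. ennreal (exp (- c * (norm (y - M))\<^sup>2)) * \<rho> M \<partial>lborel) < \<infinity>"
proof -
  have "exp (- c * (norm (y - M))\<^sup>2) \<le> exp (c * (norm (y - x0))\<^sup>2) * exp (- (c / 2) * (norm (x0 - M))\<^sup>2)" for M
  proof -
    have "norm (x0 - M) \<le> norm (y - M) + norm (y - x0)"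
      by (metis add.commute norm_minus_commute norm_diff_triangle_ineq norm_triangle_ineq4 diff_diff_eq2 diff_add_cancel norm_diff_triangle_le order_refl)
    then have "(norm (x0 - M))\<^sup>2 \<le> (norm (y - M) + norm (y - x0))\<^sup>2" by (intro power_mono) auto
    also have "\<dots> \<le> 2 * (norm (y - M))\<^sup>2 + 2 * (norm (y - x0))\<^sup>2"
      using sum_squares_bound[of "norm (y - M)" "norm (y - x0)"] by (simp add: power2_sum)
    finally have "(c / 2) * (norm (x0 - M))\<^sup>2 \<le> (c / 2) * (2 * (norm (y - M))\<^sup>2 + 2 * (norm (y - x0))\<^sup>2)"
      using c by (intro mult_left_mono) auto
    then have "- c * (norm (y - M))\<^sup>2 \<le> c * (norm (y - x0))\<^sup>2 + - (c / 2) * (norm (x0 - M))\<^sup>2"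
      by (simp add: algebra_simps)
    then show ?thesis by (simp only: exp_add[symmetric] exp_le_cancel_iff)
  qed
  then have "(\<integral>\<^sup>+M. ennreal (exp (- c * (norm (y - M))\<^sup>2)) * \<rho> M \<partial>lborel)
     \<le> (\<integral>\<^sup>+M. ennreal (exp (c * (norm (y - x0))\<^sup>2)) * (ennreal (exp (- (c / 2) * (norm (x0 - M))\<^sup>2)) * \<rho> M) \<partial>lborel)"
    by (intro nn_integral_mono) (simp only: mult.assoc[symmetric] ennreal_mult[symmetric] exp_ge_zero, intro mult_right_mono ennreal_leI, auto)
  also have "\<dots> = ennreal (exp (c * (norm (y - x0))\<^sup>2)) * (\<integral>\<^sup>+M. ennreal (exp (- (c / 2) * (norm (x0 - M))\<^sup>2)) * \<rho> M \<partial>lborel)"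
    by (rule nn_integral_cmult) measurable
  also have "\<dots> = ennreal (exp (c * (norm (y - x0))\<^sup>2)) * (ennreal (sqrt (pi / (c / 2)) ^ DIM('a)) *
      (\<integral>\<^sup>+z. ennreal (heat_kernel (1 / (2 * (c / 2))) z) * \<rho> (x0 + z) \<partial>lborel))"
    using c by (subst nn_integral_gaussian_eq_heat) auto
  also have "\<dots> \<le> ennreal (exp (c * (norm (y - x0))\<^sup>2)) * (ennreal (sqrt (pi / (c / 2)) ^ DIM('a)) * \<rho> x0)"
    using c by (intro mult_left_mono super) auto
  also have "\<dots> < \<infinity>" using x0 by (simp add: ennreal_mult_less_top)
  finally show ?thesis .
qed

text \<open>The derivative of the marginal in \<open>c\<close> is bounded through \<open>exp (h r) \<ge> 1 + h r\<close>, without differentiating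
  under the integral.\<close>

lemma superharmonic_second_moment_le:
  fixes \<rho> :: "'a::euclidean_space \<Rightarrow> ennreal" and y :: 'a
  assumes [measurable]: "\<rho> \<in> borel_measurable borel"
    and super: "\<And>s x. s > 0 \<Longrightarrow> (\<integral>\<^sup>+z. ennreal (heat_kernel s z) * \<rho> (x + z) \<partial>lborel) \<le> \<rho> x"
    and c: "c > 0"
    and fin: "(\<integral>\<^sup>+M. ennreal (exp (- c * (norm (y - M))\<^sup>2)) * \<rho> M \<partial>lborel) < \<infinity>"
  shows "(\<integral>\<^sup>+M. ennreal ((norm (M - y))\<^sup>2 * exp (- c * (norm (y - M))\<^sup>2)) * \<rho> M \<partial>lborel)
    \<le> ennreal (DIM('a) / (2 * c)) * (\<integral>\<^sup>+M. ennreal (exp (- c * (norm (y - M))\<^sup>2)) * \<rho> M \<partial>lborel)"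
proof -
  define F where "F c = (\<integral>\<^sup>+M. ennreal (exp (- c * (norm (y - M))\<^sup>2)) * \<rho> M \<partial>lborel)" for c
  define V where "V = (\<integral>\<^sup>+M. ennreal ((norm (M - y))\<^sup>2 * exp (- c * (norm (y - M))\<^sup>2)) * \<rho> M \<partial>lborel)"
  \<comment> \<open>The ratio of the Gaussian masses for precisions c - h and c. Its derivative at 0
    is DIM / (2 c), the constant of the moment bound.\<close>
  define \<phi> where "\<phi> h = sqrt (c / (c - h)) ^ DIM('a)" for h
  have step: "F c + ennreal h * V \<le> ennreal (\<phi> h) * F c" if h: "0 < h" "h < c" for h
  proof -
    have "F c + ennreal h * V = (\<integral>\<^sup>+M. ennreal (exp (- c * (norm (y - M))\<^sup>2)) * \<rho> M
        + ennreal h * (ennreal ((norm (M - y))\<^sup>2 * exp (- c * (norm (y - M))\<^sup>2)) * \<rho> M) \<partial>lborel)"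
      unfolding F_def V_def by (simp add: nn_integral_add nn_integral_cmult)
    also have "\<dots> \<le> F (c - h)" unfolding F_def
    proof (intro nn_integral_mono)
      fix M
      define r where "r = (norm (y - M))\<^sup>2"
      have "(1 + h * r) * exp (- c * r) \<le> exp (h * r) * exp (- c * r)"
        using exp_ge_add_one_self[of "h * r"] by (intro mult_right_mono) auto
      also have "\<dots> = exp (- (c - h) * r)" by (simp add: algebra_simps flip: exp_add)
      finally have "exp (- c * r) + h * (r * exp (- c * r)) \<le> exp (- (c - h) * r)" by (simp add: algebra_simps)
      then have "ennreal (exp (- c * r) + h * (r * exp (- c * r))) * \<rho> M \<le> ennreal (exp (- (c - h) * r)) * \<rho> M"
        by (intro mult_right_mono ennreal_leI) auto
      moreover have "ennreal (exp (- c * r) + h * (r * exp (- c * r))) = ennreal (exp (- c * r)) + ennreal h * ennreal (r * exp (- c * r))"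
        using h by (simp add: r_def ennreal_mult)
      ultimately show "ennreal (exp (- c * (norm (y - M))\<^sup>2)) * \<rho> M
        + ennreal h * (ennreal ((norm (M - y))\<^sup>2 * exp (- c * (norm (y - M))\<^sup>2)) * \<rho> M)
        \<le> ennreal (exp (- (c - h) * (norm (y - M))\<^sup>2)) * \<rho> M"
        unfolding norm_minus_commute[of M y] r_def[symmetric] by (simp add: distrib_right mult.assoc)
    qed
    also have "F (c - h) = ennreal (sqrt (pi / (c - h)) ^ DIM('a)) * (\<integral>\<^sup>+z. ennreal (heat_kernel (1 / (2 * (c - h))) z) * \<rho> (y + z) \<partial>lborel)"
      unfolding F_def using h by (intro nn_integral_gaussian_eq_heat) auto
    also have "\<dots> \<le> ennreal (sqrt (pi / (c - h)) ^ DIM('a)) * (\<integral>\<^sup>+z. ennreal (heat_kernel (1 / (2 * c)) z) * \<rho> (y + z) \<partial>lborel)"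
    proof (intro mult_left_mono)
      \<comment> \<open>Lowering the precision means a later time of the heat flow.\<close>
      have "1 / (2 * c) < 1 / (2 * (c - h))" using h c by (intro divide_strict_left_mono) auto
      then show "(\<integral>\<^sup>+z. ennreal (heat_kernel (1 / (2 * (c - h))) z) * \<rho> (y + z) \<partial>lborel) \<le> (\<integral>\<^sup>+z. ennreal (heat_kernel (1 / (2 * c)) z) * \<rho> (y + z) \<partial>lborel)"
        using heat_flow_antimono[OF assms(1) super, of "1 / (2 * (c - h)) - 1 / (2 * c)" "1 / (2 * c)" y] c by simp
    qed simp
    also have "\<dots> = ennreal (\<phi> h) * F c"
    proof -
      have "sqrt (pi / (c - h)) = sqrt (c / (c - h)) * sqrt (pi / c)"
        using c by (simp flip: real_sqrt_mult)
      then have "sqrt (pi / (c - h)) ^ DIM('a) = \<phi> h * sqrt (pi / c) ^ DIM('a)"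
        by (simp only: \<phi>_def power_mult_distrib)
      then have "ennreal (sqrt (pi / (c - h)) ^ DIM('a)) = ennreal (\<phi> h) * ennreal (sqrt (pi / c) ^ DIM('a))"
        using h c by (simp add: ennreal_mult \<phi>_def)
      then show ?thesis unfolding F_def using c by (subst nn_integral_gaussian_eq_heat[OF _ c]) (auto simp: mult.assoc)
    qed
    finally show ?thesis .
  qed
  obtain f where f: "F c = ennreal f" "f \<ge> 0" using fin by (cases "F c") (auto simp: F_def)
  \<comment> \<open>One admissible h, here c / 2, bounds V by a finite quantity; the limit can then
    be taken in the reals.\<close>
  have "V \<noteq> \<infinity>"
  proof
    assume "V = \<infinity>"
    then have "F c + ennreal (c / 2) * V = \<infinity>" using c by (simp add: ennreal_mult_top)
    then have "ennreal (\<phi> (c / 2)) * F c = \<infinity>" using step[of "c / 2"] c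
      by (metis half_gt_zero field_sum_of_halves infinity_ennreal_def less_add_same_cancel1 top_unique)
    then show False using f by (simp add: ennreal_mult[symmetric] \<phi>_def ennreal_mult_eq_top_iff)
  qed
  then obtain v where v: "V = ennreal v" "v \<ge> 0" by (cases V) auto
  have \<phi>0: "\<phi> h \<ge> 0" if "h < c" for h using that c by (simp add: \<phi>_def)
  have bound: "v \<le> f * ((\<phi> h - \<phi> 0) / h)" if h: "0 < h" "h < c" for h
  proof -
    have "ennreal (f + h * v) \<le> ennreal (\<phi> h * f)"
      using step[OF h] h v f \<phi>0[OF h(2)] by (simp add: ennreal_mult[symmetric] ennreal_plus[symmetric] del: ennreal_plus)
    then have "f + h * v \<le> \<phi> h * f" using f \<phi>0[OF h(2)] by (simp add: ennreal_le_iff)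
    moreover have "\<phi> 0 = 1" using c by (simp add: \<phi>_def)
    ultimately show ?thesis using h by (simp add: field_simps)
  qed
  have "(\<phi> has_real_derivative real DIM('a) / (2 * c)) (at 0)"
  proof -
    have "((\<lambda>h. c / (c - h)) has_real_derivative 1 / c) (at 0)"
      using c by (auto intro!: derivative_eq_intros simp: power2_eq_square)
    then have "((\<lambda>h. sqrt (c / (c - h))) has_real_derivative 1 / c * (inverse (sqrt (c / (c - 0))) / 2)) (at 0)"
      using c by (auto intro!: derivative_eq_intros simp: power2_eq_square)
    then have "(\<phi> has_real_derivative real DIM('a) * (1 / c * (inverse (sqrt (c / (c - 0))) / 2)  * sqrt (c / (c - 0)) ^ (DIM('a) - Suc 0))) (at 0)"
      unfolding \<phi>_def by (rule DERIV_power)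
    then show ?thesis using c by (simp add: mult.commute[of c])
  qed
  then have "((\<lambda>h. (\<phi> h - \<phi> 0) / h) \<longlongrightarrow> real DIM('a) / (2 * c)) (at 0)"
    by (simp add: DERIV_def)
  then have lim: "((\<lambda>h. f * ((\<phi> h - \<phi> 0) / h)) \<longlongrightarrow> f * (real DIM('a) / (2 * c))) (at_right 0)"
    by (intro tendsto_mult_left) (rule tendsto_mono[OF at_le], auto)
  have "v \<le> f * (real DIM('a) / (2 * c))"
  proof (rule tendsto_lowerbound[OF lim])
    show "\<forall>\<^sub>F h in at_right 0. v \<le> f * ((\<phi> h - \<phi> 0) / h)"
      using bound c by (auto simp: eventually_at_right_field intro!: exI[of _ c])
  qed simp
  then have "V \<le> ennreal (DIM('a) / (2 * c)) * F c"
    using v f c by (simp add: ennreal_mult[symmetric] mult.commute)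
  then show ?thesis by (simp add: V_def F_def)
qed

text \<open>The heat flow inequality concerns \<open>\<rho>\<close>, which may be infinite on an
  exceptional set, while the estimator is built from the real function \<open>prior\<close>.
  Finiteness of the marginal makes the two agree almost everywhere. The risk bound is unnormalised:
  divided by the Gaussian mass \<open>sqrt (pi / c) ^ DIM('a)\<close> it reads DIM / (2 c).\<close>

lemma superharmonic_prior_minimax:
  fixes \<rho> :: "'a::euclidean_space \<Rightarrow> ennreal" and prior :: "'a \<Rightarrow> real" and \<theta> :: 'a
  assumes \<rho>[measurable]: "\<rho> \<in> borel_measurable borel"
    and super: "\<And>s x. s > 0 \<Longrightarrow> (\<integral>\<^sup>+z. ennreal (heat_kernel s z) * \<rho> (x + z) \<partial>lborel) \<le> \<rho> x"
    and x0: "\<rho> x0 < \<infinity>"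
    and prior[measurable]: "prior \<in> borel_measurable borel"
    and prior_pos: "\<And>M. \<rho> M < \<infinity> \<Longrightarrow> prior M > 0 \<and> \<rho> M = ennreal (prior M)"
    and prior_nonneg: "\<And>M. prior M \<ge> 0" and c: "c > 0"
  defines "w \<equiv> \<lambda>y M. exp (- c * (norm (y - M))\<^sup>2) * prior M"
  shows "integrable lborel (w y)"
    and "(\<integral>M. w y M \<partial>lborel) > 0"
    and "(\<integral>\<^sup>+y. ennreal (exp (- c * (norm (y - \<theta>))\<^sup>2) *
            (norm ((1 / (\<integral>M. w y M \<partial>lborel)) *\<^sub>R (\<integral>M. w y M *\<^sub>R M \<partial>lborel) - \<theta>))\<^sup>2) \<partial>lborel)
         \<le> ennreal (DIM('a) / (2 * c) * sqrt (pi / c) ^ DIM('a))"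
proof -
  have [measurable]: "w y \<in> borel_measurable borel" for y unfolding w_def by measurable
  have w_nonneg: "w y M \<ge> 0" for y M using prior_nonneg by (simp add: w_def)
  have fin: "(\<integral>\<^sup>+M. ennreal (exp (- c * (norm (y - M))\<^sup>2)) * \<rho> M \<partial>lborel) < \<infinity>" for y
    by (rule superharmonic_gaussian_finite[OF \<rho> super x0 c])
  \<comment> \<open>A finite integral against a positive weight forces \<open>\<rho>\<close> to be
    finite almost everywhere. So the exceptional set is null, and \<open>prior\<close> is positive
    off it, which also makes the marginal positive.\<close>
  have "AE M in lborel. ennreal (exp (- c * (norm (0 - M))\<^sup>2)) * \<rho> M \<noteq> \<infinity>"
    using fin[of 0] by (intro nn_integral_PInf_AE) auto
  then have ae: "AE M in lborel. prior M > 0 \<and> \<rho> M = ennreal (prior M)"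
    by eventually_elim (intro prior_pos, auto simp: ennreal_mult_eq_top_iff less_top)
  have w_eq: "(\<integral>\<^sup>+M. ennreal (w y M) \<partial>lborel) = (\<integral>\<^sup>+M. ennreal (exp (- c * (norm (y - M))\<^sup>2)) * \<rho> M \<partial>lborel)" for y
    by (rule nn_integral_cong_AE, use ae in eventually_elim) (simp add: w_def ennreal_mult)
  show w_int: "integrable lborel (w y)" for y
    using fin[of y] w_nonneg by (intro integrableI_nonneg) (auto simp: w_eq)
  show K_pos: "(\<integral>M. w y M \<partial>lborel) > 0" for y
  proof -
    have "(\<integral>M. w y M \<partial>lborel) \<noteq> 0"
    proof
      assume "(\<integral>M. w y M \<partial>lborel) = 0"
      then have "AE M in lborel. w y M = 0"
        using integral_nonneg_eq_0_iff_AE[OF w_int[of y]] w_nonneg by simp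
      with ae have "AE M in (lborel :: 'a measure). False"
        by eventually_elim (auto simp: w_def)
      then show False
        using ae_filter_eq_bot_iff[of "lborel :: 'a measure"] emeasure_lborel_UNIV[where 'a='a]
        by (simp add: trivial_limit_def)
    qed
    moreover have "(\<integral>M. w y M \<partial>lborel) \<ge> 0" using w_nonneg by (intro Bochner_Integration.integral_nonneg) auto
    ultimately show ?thesis by simp
  qed
  have V_eq: "(\<integral>\<^sup>+M. ennreal ((norm (M - y))\<^sup>2 * w y M) \<partial>lborel)
      = (\<integral>\<^sup>+M. ennreal ((norm (M - y))\<^sup>2 * exp (- c * (norm (y - M))\<^sup>2)) * \<rho> M \<partial>lborel)" for y
    by (rule nn_integral_cong_AE, use ae in eventually_elim) (simp add: w_def ennreal_mult mult.assoc)
  have V_le: "(\<integral>\<^sup>+M. ennreal ((norm (M - y))\<^sup>2 * w y M) \<partial>lborel) \<le> ennreal (DIM('a) / (2 * c) * (\<integral>M. w y M \<partial>lborel))" for y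
  proof -
    have "(\<integral>\<^sup>+M. ennreal ((norm (M - y))\<^sup>2 * w y M) \<partial>lborel) \<le> ennreal (DIM('a) / (2 * c)) * (\<integral>\<^sup>+M. ennreal (w y M) \<partial>lborel)"
      unfolding V_eq w_eq by (rule superharmonic_second_moment_le[OF \<rho> super c fin])
    also have "(\<integral>\<^sup>+M. ennreal (w y M) \<partial>lborel) = ennreal (\<integral>M. w y M \<partial>lborel)"
      using w_int w_nonneg by (intro nn_integral_eq_integral) auto
    also have "ennreal (DIM('a) / (2 * c)) * \<dots> = ennreal (DIM('a) / (2 * c) * (\<integral>M. w y M \<partial>lborel))"
      using c K_pos[of y] by (intro ennreal_mult[symmetric]) auto
    finally show ?thesis .
  qed
  have V_int: "integrable lborel (\<lambda>M. (norm (M - y))\<^sup>2 * w y M)" for y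
  proof (rule integrableI_nonneg)
    show "(\<integral>\<^sup>+M. ennreal ((norm (M - y))\<^sup>2 * w y M) \<partial>lborel) < \<infinity>"
      using V_le[of y] by (metis ennreal_less_top infinity_ennreal_def le_less_trans)
  qed (use w_nonneg in auto)
  have V_real: "(\<integral>M. (norm (M - y))\<^sup>2 * w y M \<partial>lborel) \<le> DIM('a) / (2 * c) * (\<integral>M. w y M \<partial>lborel)" for y
  proof -
    have "ennreal (\<integral>M. (norm (M - y))\<^sup>2 * w y M \<partial>lborel) \<le> ennreal (DIM('a) / (2 * c) * (\<integral>M. w y M \<partial>lborel))"
      using V_le[of y] V_int[of y] w_nonneg by (subst (asm) nn_integral_eq_integral) auto
    then show ?thesis using c K_pos[of y] by (subst (asm) ennreal_le_iff) auto
  qed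
  have gauss: "(\<integral>\<^sup>+y. ennreal (exp (- d * (norm (y - \<theta>))\<^sup>2)) \<partial>lborel) = ennreal (sqrt (pi / d) ^ DIM('a))" if "d > 0" for d
    using nn_integral_lborel_translation[of "\<lambda>y. ennreal (exp (- d * (norm (y - \<theta>))\<^sup>2))" \<theta>] nn_integral_gaussian[OF that, where 'a='a]
    by simp
  have g_int: "integrable lborel (\<lambda>y. exp (- d * (norm (y - \<theta>))\<^sup>2))" if "d > 0" for d
  proof (rule integrableI_nonneg)
    show "(\<integral>\<^sup>+y. ennreal (exp (- d * (norm (y - \<theta>))\<^sup>2)) \<partial>lborel) < \<infinity>"
      unfolding gauss[OF that] by simp
  qed auto
  have g2_int: "integrable lborel (\<lambda>y. exp (- c * (norm (y - \<theta>))\<^sup>2) * (norm (y - \<theta>))\<^sup>2)"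
  proof (rule Bochner_Integration.integrable_bound)
    show "integrable lborel (\<lambda>y. 2 / c * exp (- (c / 2) * (norm (y - \<theta>))\<^sup>2))"
      using c by (intro integrable_mult_right g_int) simp
    have "exp (- c * r) * r \<le> 2 / c * exp (- (c / 2) * r)" for r
    proof -
      have "c / 2 * r \<le> exp (c / 2 * r)" using exp_ge_add_one_self[of "c / 2 * r"] by linarith
      then have "exp (- c * r) * (c / 2 * r) \<le> exp (- c * r) * exp (c / 2 * r)" by (intro mult_left_mono) auto
      also have "\<dots> = exp (- (c / 2) * r)" by (simp flip: exp_add)
      finally show ?thesis using c by (simp add: field_simps)
    qed
    then show "AE y in lborel. norm (exp (- c * (norm (y - \<theta>))\<^sup>2) * (norm (y - \<theta>))\<^sup>2) \<le> norm (2 / c * exp (- (c / 2) * (norm (y - \<theta>))\<^sup>2))"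
      using c by (auto simp: abs_mult)
  qed measurable
  have Z: "(\<integral>y. exp (- c * (norm (y - \<theta>))\<^sup>2) \<partial>lborel) = sqrt (pi / c) ^ DIM('a)"
  proof -
    have "(\<integral>y. exp (- c * (norm (y - \<theta>))\<^sup>2) \<partial>lborel) = enn2real (\<integral>\<^sup>+y. ennreal (exp (- c * (norm (y - \<theta>))\<^sup>2)) \<partial>lborel)"
      by (rule integral_eq_nn_integral) auto
    then show ?thesis unfolding gauss[OF c] using c by simp
  qed
  show "(\<integral>\<^sup>+y. ennreal (exp (- c * (norm (y - \<theta>))\<^sup>2) *
            (norm ((1 / (\<integral>M. w y M \<partial>lborel)) *\<^sub>R (\<integral>M. w y M *\<^sub>R M \<partial>lborel) - \<theta>))\<^sup>2) \<partial>lborel)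
         \<le> ennreal (DIM('a) / (2 * c) * sqrt (pi / c) ^ DIM('a))"
    using risk_le_of_posterior_second_moment_le[OF c prior prior_nonneg w_int[unfolded w_def] K_pos[unfolded w_def]
        V_int[unfolded w_def] V_real[unfolded w_def] g_int[OF c] g2_int]
    unfolding Z w_def .
qed

section \<open>The prior on matrices\<close>

lemma norm_matrix_columns: "(norm M)\<^sup>2 = (\<Sum>j\<in>UNIV. (norm (column j M))\<^sup>2)" for M :: "real^'p::finite^'n::finite"
proof -
  have "(norm M)\<^sup>2 = (\<Sum>a\<in>UNIV. \<Sum>j\<in>UNIV. (M $ a $ j)\<^sup>2)"
    by (simp add: power2_norm_eq_inner inner_vec_def) (simp add: power2_eq_square)
  also have "\<dots> = (\<Sum>j\<in>UNIV. \<Sum>a\<in>UNIV. (M $ a $ j)\<^sup>2)" by (rule sum.swap)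
  also have "\<dots> = (\<Sum>j\<in>UNIV. (norm (column j M))\<^sup>2)"
    by (simp add: power2_norm_eq_inner inner_vec_def column_def) (simp add: power2_eq_square)
  finally show ?thesis .
qed

lemma column_sum_col_embed: "column j (\<Sum>i\<in>UNIV. col_embed i (x i)) = x j"
  by (simp add: column_def col_embed_def vec_eq_iff sum.delta)

lemma linear_col_embed: "linear (col_embed i)"
  by (auto simp: linear_iff col_embed_def vec_eq_iff)

lemma col_embed_measurable [measurable]: "col_embed i \<in> borel_measurable borel"
  using linear_col_embed[of i]
  by (intro borel_measurable_continuous_onI linear_continuous_on) (simp add: linear_conv_bounded_linear)

lemma measurable_det_gram [measurable]:
  "(\<lambda>M::real^'p::finite^'n::finite. det (transpose M ** M)) \<in> borel_measurable borel"
  unfolding gram_eq det_def column_def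
  by (intro borel_measurable_continuous_onI) (auto intro!: continuous_intros)

lemma measurable_norm_column [measurable]:
  "(\<lambda>M::real^'p::finite^'n::finite. norm (column i M)) \<in> borel_measurable borel"
  unfolding column_def by (intro borel_measurable_continuous_onI) (auto intro!: continuous_intros)

lemma msvs2_prior_measurable [measurable]:
  "(msvs2_prior \<gamma> :: real^'p::finite^'n::finite \<Rightarrow> real) \<in> borel_measurable borel"
  unfolding msvs2_prior_def by measurable

lemma msvs2_ext_measurable [measurable]:
  "(msvs2_ext \<gamma> :: real^'p::finite^'n::finite \<Rightarrow> ennreal) \<in> borel_measurable borel"
  unfolding msvs2_ext_def by measurable

lemma msvs2_prior_pos:
  fixes M :: "real^'p::finite^'n::finite"
  assumes "det (transpose M ** M) > 0"
  shows "msvs2_prior \<gamma> M > 0"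
proof -
  have "column j M \<noteq> 0" for j
    using dim_columns_of_det_gram[of M "{j}"] assms by auto
  then show ?thesis unfolding msvs2_prior_def using assms by (intro mult_pos_pos prod_pos) auto
qed

text \<open>Under the isometry between tuples of columns and matrices the heat kernel factors over
  the columns, so the one-column inequality can be applied to one column after another.\<close>

lemma msvs2_ext_superharmonic:
  fixes M :: "real^'p::finite^'n::finite"
  assumes np: "CARD('p) + 2 \<le> CARD('n)" and \<gamma>: "0 < \<gamma>" "\<gamma> \<le> - real CARD('n) + 2 * real CARD('p)"
    and s: "s > 0"
  shows "(\<integral>\<^sup>+Z. ennreal (heat_kernel s Z) * msvs2_ext \<gamma> (M + Z) \<partial>lborel) \<le> msvs2_ext \<gamma> M"
proof -
  let ?P = "\<lambda>J. PiM J (\<lambda>_::'p. lborel :: (real^'n) measure)"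
  interpret product_sigma_finite "\<lambda>_::'p. lborel :: (real^'n) measure" ..
  \<comment> \<open>Only the columns in \<open>J\<close> are perturbed. In the induction step the
    new column is integrated innermost, with the perturbed columns of \<open>J\<close> as part of
    the base matrix.\<close>
  have ind: "(\<integral>\<^sup>+x. (\<Prod>j\<in>J. ennreal (heat_kernel s (x j))) * msvs2_ext \<gamma> (M + (\<Sum>j\<in>J. col_embed j (x j))) \<partial>?P J) \<le> msvs2_ext \<gamma> M" for J
  proof (induction J rule: finite_induct[OF finite])
    case 1
    show ?case by (simp add: space_PiM)
  next
    case (2 i J)
    let ?S = "\<lambda>x. \<Sum>j\<in>J. col_embed j (x j)"
    have "(\<integral>\<^sup>+x. (\<Prod>j\<in>insert i J. ennreal (heat_kernel s (x j))) * msvs2_ext \<gamma> (M + (\<Sum>j\<in>insert i J. col_embed j (x j))) \<partial>?P (insert i J))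
      = (\<integral>\<^sup>+x. (\<integral>\<^sup>+z. (\<Prod>j\<in>insert i J. ennreal (heat_kernel s ((x(i := z)) j))) * msvs2_ext \<gamma> (M + (\<Sum>j\<in>insert i J. col_embed j ((x(i := z)) j))) \<partial>lborel) \<partial>?P J)"
      using 2 by (intro product_nn_integral_insert) auto
    also have "\<dots> = (\<integral>\<^sup>+x. (\<integral>\<^sup>+z. (\<Prod>j\<in>J. ennreal (heat_kernel s (x j))) * (ennreal (heat_kernel s z) * msvs2_ext \<gamma> (M + ?S x + col_embed i z)) \<partial>lborel) \<partial>?P J)"
    proof (intro nn_integral_cong)
      fix x :: "'p \<Rightarrow> real^'n" and z
      have "(\<Prod>j\<in>J. ennreal (heat_kernel s ((x(i := z)) j))) = (\<Prod>j\<in>J. ennreal (heat_kernel s (x j)))"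
        "(\<Sum>j\<in>J. col_embed j ((x(i := z)) j)) = ?S x"
        using 2(2) by (auto intro!: prod.cong sum.cong)
      then show "(\<Prod>j\<in>insert i J. ennreal (heat_kernel s ((x(i := z)) j))) * msvs2_ext \<gamma> (M + (\<Sum>j\<in>insert i J. col_embed j ((x(i := z)) j)))
        = (\<Prod>j\<in>J. ennreal (heat_kernel s (x j))) * (ennreal (heat_kernel s z) * msvs2_ext \<gamma> (M + ?S x + col_embed i z))"
        using 2 by (simp add: mult_ac add_ac)
    qed
    also have "\<dots> \<le> (\<integral>\<^sup>+x. (\<Prod>j\<in>J. ennreal (heat_kernel s (x j))) * msvs2_ext \<gamma> (M + ?S x) \<partial>?P J)"
    proof (intro nn_integral_mono)
      fix x
      have "(\<integral>\<^sup>+z. (\<Prod>j\<in>J. ennreal (heat_kernel s (x j))) * (ennreal (heat_kernel s z) * msvs2_ext \<gamma> (M + ?S x + col_embed i z)) \<partial>lborel)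
         = (\<Prod>j\<in>J. ennreal (heat_kernel s (x j))) * (\<integral>\<^sup>+z. ennreal (heat_kernel s z) * msvs2_ext \<gamma> (M + ?S x + col_embed i z) \<partial>lborel)"
        by (rule nn_integral_cmult) measurable
      also have "\<dots> \<le> (\<Prod>j\<in>J. ennreal (heat_kernel s (x j))) * msvs2_ext \<gamma> (M + ?S x)"
        \<comment> \<open>The base matrix is arbitrary here and may be rank deficient, so the
          inequality is needed everywhere and not just almost everywhere.\<close>
        by (intro mult_left_mono heat_kernel_col_embed_le[OF np \<gamma> s]) simp
      finally show "(\<integral>\<^sup>+z. (\<Prod>j\<in>J. ennreal (heat_kernel s (x j))) * (ennreal (heat_kernel s z) * msvs2_ext \<gamma> (M + ?S x + col_embed i z)) \<partial>lborel)
         \<le> (\<Prod>j\<in>J. ennreal (heat_kernel s (x j))) * msvs2_ext \<gamma> (M + ?S x)" .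
    qed
    also have "\<dots> \<le> msvs2_ext \<gamma> M" by (rule 2)
    finally show ?case .
  qed
  let ?S = "\<lambda>x. \<Sum>j\<in>UNIV. col_embed j (x j) :: real^'p^'n"
  have D: "distr (?P UNIV) borel ?S = lborel"
  proof (rule lborel_eq_distr_PiM_isometry)
    show "(norm (?S x))\<^sup>2 = (\<Sum>j\<in>UNIV. (norm (x j))\<^sup>2)" for x
      by (simp add: norm_matrix_columns column_sum_col_embed)
    show "\<exists>x. a = ?S x" for a
    proof
      have "?S (\<lambda>j. column j a) $ r $ j = a $ r $ j" for r j
      proof -
        have "?S (\<lambda>j. column j a) $ r $ j = column j (?S (\<lambda>j. column j a)) $ r"
          by (simp only: column_def vec_lambda_beta)
        also have "\<dots> = a $ r $ j"
          by (simp only: column_sum_col_embed) (simp add: column_def)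
        finally show ?thesis .
      qed
      then show "a = ?S (\<lambda>j. column j a)" by (simp only: vec_eq_iff simp_thms)
    qed
  qed (auto simp: linear_col_embed)
  have heat: "heat_kernel s (?S x) = (\<Prod>j\<in>UNIV. heat_kernel s (x j))" for x
  proof -
    have "- (norm (?S x))\<^sup>2 / (2 * s) = (\<Sum>j\<in>UNIV. - (norm (x j))\<^sup>2 / (2 * s))"
      by (simp add: norm_matrix_columns column_sum_col_embed sum_divide_distrib sum_negf)
    then show ?thesis
      by (simp add: heat_kernel_def exp_sum prod_dividef power_mult mult.commute[of "CARD('n)"] flip: power_mult)
  qed
  have "(\<integral>\<^sup>+Z. ennreal (heat_kernel s Z) * msvs2_ext \<gamma> (M + Z) \<partial>lborel)
     = (\<integral>\<^sup>+x. ennreal (heat_kernel s (?S x)) * msvs2_ext \<gamma> (M + ?S x) \<partial>?P UNIV)"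
    by (subst D[symmetric], intro nn_integral_distr) measurable
  also have "\<dots> = (\<integral>\<^sup>+x. (\<Prod>j\<in>UNIV. ennreal (heat_kernel s (x j))) * msvs2_ext \<gamma> (M + ?S x) \<partial>?P UNIV)"
    using s by (simp add: heat prod_ennreal)
  also have "\<dots> \<le> msvs2_ext \<gamma> M" by (rule ind)
  finally show ?thesis .
qed

text \<open>Distinct unit vectors as columns have the identity as Gram matrix. This supplies the
  point at which the extended prior is finite.\<close>

lemma ex_det_gram_pos:
  assumes "CARD('p::finite) \<le> CARD('n::finite)"
  shows "\<exists>M :: real^'p^'n. det (transpose M ** M) > 0"
proof -
  obtain f :: "'p \<Rightarrow> 'n" where f: "inj f" using assms inj_on_iff_card_le[of "UNIV :: 'p set" "UNIV :: 'n set"] by auto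
  define M :: "real^'p^'n" where "M = (\<chi> a j. if a = f j then 1 else 0)"
  have "column j M = axis (f j) 1" for j by (auto simp: M_def column_def axis_def vec_eq_iff)
  then have "column i M \<bullet> column j M = (if i = j then 1 else 0)" for i j
    using f by (simp add: inner_axis_axis inj_eq)
  then have "transpose M ** M = mat 1"
    unfolding gram_eq by (simp add: vec_eq_iff mat_def)
  then show ?thesis by (intro exI[of _ M]) simp
qed

section \<open>The Gaussian model and the risk bound\<close>

lemma gauss_lik_eq:
  fixes Y M :: "real^'p::finite^'n::finite"
  shows "gauss_lik N Y M = sqrt (N / (2 * pi)) ^ (CARD('n) * CARD('p)) * exp (- (N / 2) * (norm (Y - M))\<^sup>2)"
proof -
  have "(norm (Y - M))\<^sup>2 = (\<Sum>a\<in>UNIV. \<Sum>i\<in>UNIV. (Y $ a $ i - M $ a $ i)\<^sup>2)"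
    by (simp add: power2_norm_eq_inner inner_vec_def) (simp add: power2_eq_square)
  then show ?thesis
    by (simp add: gauss_lik_def prod.distrib power_mult[symmetric] mult.commute[of "CARD('p)"] sum_distrib_left flip: exp_sum sum_negf)
qed

lemma frob_sq_eq: "frob_sq A = (norm A)\<^sup>2"
  by (simp add: frob_sq_def power2_norm_eq_inner inner_vec_def) (simp add: power2_eq_square)

theorem theorem7:
  fixes N \<gamma> :: real
  assumes "CARD('p::finite) \<ge> 3"
    and "CARD('p) + 2 \<le> CARD('n::finite)"
    and "CARD('n) < 2 * CARD('p)"
    and "N > 0"
    and "0 < \<gamma>"
    and "\<gamma> \<le> - real CARD('n) + 2 * real CARD('p)"
  shows "(\<forall>Y::real^'p^'n.
            (\<integral>\<^sup>+M. ennreal (gauss_lik N Y M * msvs2_prior \<gamma> M) \<partial>lborel) < \<infinity>)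
       \<and> (\<forall>M::real^'p^'n.
            gb_risk N \<gamma> M \<le> ennreal (real (CARD('n) * CARD('p)) / N))"
proof -
  \<comment> \<open>With this \<open>c\<close>, the bound DIM / (2 c) is n p / N. The normalising
    constant \<open>k\<close> of the likelihood cancels in the estimator and survives only in the
    risk.\<close>
  define c where "c = N / 2"
  have c: "c > 0" using \<open>N > 0\<close> by (simp add: c_def)
  define k where "k = sqrt (N / (2 * pi)) ^ (CARD('n) * CARD('p))"
  have k: "k > 0" using \<open>N > 0\<close> by (simp add: k_def)
  define w where "w Y M = exp (- c * (norm (Y - M))\<^sup>2) * msvs2_prior \<gamma> M" for Y M :: "real^'p^'n"
  have lik: "gauss_lik N Y M = k * exp (- c * (norm (Y - M))\<^sup>2)" for Y M :: "real^'p^'n"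
    unfolding gauss_lik_eq k_def c_def by simp
  have lw: "gauss_lik N Y M * msvs2_prior \<gamma> M = k * w Y M" for Y M by (simp add: lik w_def)
  obtain x0 :: "real^'p^'n" where "det (transpose x0 ** x0) > 0"
    using ex_det_gram_pos[where 'p='p and 'n='n] assms by auto
  then have x0: "msvs2_ext \<gamma> x0 < \<infinity>" by (simp add: msvs2_ext_def)
  have prior_pos: "msvs2_prior \<gamma> M > 0 \<and> msvs2_ext \<gamma> M = ennreal (msvs2_prior \<gamma> M)"
    if "msvs2_ext \<gamma> M < \<infinity>" for M :: "real^'p^'n"
    using that msvs2_prior_pos[of M \<gamma>] by (auto simp: msvs2_ext_def split: if_splits)
  have prior_nonneg: "msvs2_prior \<gamma> M \<ge> 0" for M :: "real^'p^'n"
    by (auto simp: msvs2_prior_def intro!: mult_nonneg_nonneg prod_nonneg)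
  note main = superharmonic_prior_minimax[OF msvs2_ext_measurable msvs2_ext_superharmonic[OF assms(2,5,6)] x0
      msvs2_prior_measurable prior_pos prior_nonneg c, folded w_def]
  have w_nonneg: "w Y M \<ge> 0" for Y M using prior_nonneg by (simp add: w_def)
  \<comment> \<open>\<open>gb_marginal\<close> is a Bochner integral, whose value is 0 when the
    integrand is not integrable; finiteness excludes that default.\<close>
  have "(\<integral>\<^sup>+M. ennreal (gauss_lik N Y M * msvs2_prior \<gamma> M) \<partial>lborel) < \<infinity>" for Y :: "real^'p^'n"
  proof -
    have "(\<integral>\<^sup>+M. ennreal (k * w Y M) \<partial>lborel) = ennreal (\<integral>M. k * w Y M \<partial>lborel)"
      using main(1)[of Y] k w_nonneg by (intro nn_integral_eq_integral) auto
    then show ?thesis by (simp add: lw)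
  qed
  moreover have "gb_risk N \<gamma> \<theta> \<le> ennreal (real (CARD('n) * CARD('p)) / N)" for \<theta> :: "real^'p^'n"
  proof -
    have est: "gb_estimator N \<gamma> Y = (1 / (\<integral>M. w Y M \<partial>lborel)) *\<^sub>R (\<integral>M. w Y M *\<^sub>R M \<partial>lborel)" for Y :: "real^'p^'n"
    proof -
      have "(\<integral>M. (k * w Y M) *\<^sub>R M \<partial>lborel) = k *\<^sub>R (\<integral>M. w Y M *\<^sub>R M \<partial>lborel)"
        by (simp flip: scaleR_scaleR)
      then show ?thesis unfolding gb_estimator_def gb_marginal_def lw using k by simp
    qed
    have "gb_risk N \<gamma> \<theta> = (\<integral>\<^sup>+Y. ennreal k * ennreal (exp (- c * (norm (Y - \<theta>))\<^sup>2) *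
        (norm ((1 / (\<integral>M. w Y M \<partial>lborel)) *\<^sub>R (\<integral>M. w Y M *\<^sub>R M \<partial>lborel) - \<theta>))\<^sup>2) \<partial>lborel)"
      unfolding gb_risk_def est frob_sq_eq lik using k by (simp add: ennreal_mult[symmetric] mult.assoc)
    also have "\<dots> = ennreal k * (\<integral>\<^sup>+Y. ennreal (exp (- c * (norm (Y - \<theta>))\<^sup>2) *
        (norm ((1 / (\<integral>M. w Y M \<partial>lborel)) *\<^sub>R (\<integral>M. w Y M *\<^sub>R M \<partial>lborel) - \<theta>))\<^sup>2) \<partial>lborel)"
      unfolding w_def by (rule nn_integral_cmult) measurable
    also have "\<dots> \<le> ennreal k * ennreal (DIM(real^'p^'n) / (2 * c) * sqrt (pi / c) ^ DIM(real^'p^'n))"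
      by (intro mult_left_mono main(3)) simp_all
    also have "\<dots> = ennreal (real (CARD('n) * CARD('p)) / N)"
    proof -
      \<comment> \<open>The likelihood is a probability density in Y: its normalising constant is
        the inverse of the Gaussian mass.\<close>
      have "k * sqrt (pi / c) ^ (CARD('n) * CARD('p)) = 1"
        using \<open>N > 0\<close> unfolding k_def c_def by (simp add: power_mult_distrib[symmetric] real_sqrt_mult[symmetric])
      then have "k * (real (CARD('n) * CARD('p)) / (2 * c) * sqrt (pi / c) ^ (CARD('n) * CARD('p))) = real (CARD('n) * CARD('p)) / (2 * c)"
        by (metis (no_types, opaque_lifting) mult.left_commute mult.right_neutral)
      then show ?thesis using k c by (simp add: ennreal_mult[symmetric] c_def)
    qed
    finally show ?thesis .
  qed
  ultimately show ?thesis by blast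
qed

end
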